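(* Let $X$ be a separable complex Hilbert space and let $A:D(A)\subset X\to X$ be an unbounded sectorial operator with compact resolvent such that, for some $\lambda_0>0$, $\mathrm{Re}\,\lambda>\lambda_0$ for all $\lambda\in\sigma(A)$. Let $0\leqslant\eta<1$, let $Z=X^{\frac23}\times X^{\frac13}\times X$, and let $\mathbb{B}_{(\eta)}:D(\mathbb{B}_{(\eta)})\subset Z\to Z$ be defined by $D(\mathbb{B}_{(\eta)})=X^1\times X^{\frac23}\times X^{\frac13}$ and $$\mathbb{B}_{(\eta)}\begin{bmatrix} u\\ v\\ w\end{bmatrix}=\begin{bmatrix} A^{\frac13}u-v\\ -w\\ A^{\frac23}v+(\eta-1)A^{\frac13}w\end{bmatrix}.$$ Then $-\mathbb{B}_{(\eta)}$ is not the infinitesimal generator of a strongly continuous semigroup of bounded linear operators on $Z$; i.e., the Cauchy problem $\frac{d}{dt}U+\mathbb{B}_{(\eta)}U=F(U)$, $U(0)=U_0$, is ill-posed in this sense on $Z$.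
   Context: For $\alpha\in(0,1]$, $A^{\alpha}$ denotes the fractional power of $A$, $X^\alpha=D(A^\alpha)$ with norm $\|A^\alpha\cdot\|_X$, and $X^0=X$. The space $Z$ carries the norm $\|(u,v,w)\|_Z^2=\|u\|^2_{X^{2/3}}+\|v\|^2_{X^{1/3}}+\|w\|_X^2$. Here $F(u,v,w)=(0,0,f(u))$ for a nonlinearity $f$; the ill-posedness meant is exactly the failure of $-\mathbb{B}_{(\eta)}$ to generate a strongly continuous semigroup on $Z$. *)

theory Defs
  imports "HOL-Analysis.Analysis"
begin

text \<open>A complex Hilbert space is modelled as a Banach space type 'a (real structure
  from the type class) together with a complex scalar multiplication sc extending
  scaleR and a complex inner product ip (linear in the first argument) inducing the norm.\<close>

definition complex_hilbert :: "(complex \<Rightarrow> 'a::banach \<Rightarrow> 'a) \<Rightarrow> ('a \<Rightarrow> 'a \<Rightarrow> complex) \<Rightarrow> bool" where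
  "complex_hilbert sc ip \<longleftrightarrow>
     (\<forall>x. sc 1 x = x) \<and>
     (\<forall>a b x. sc a (sc b x) = sc (a * b) x) \<and>
     (\<forall>a x y. sc a (x + y) = sc a x + sc a y) \<and>
     (\<forall>a b x. sc (a + b) x = sc a x + sc b x) \<and>
     (\<forall>r x. sc (complex_of_real r) x = r *\<^sub>R x) \<and>
     (\<forall>a x y z. ip (sc a x + y) z = a * ip x z + ip y z) \<and>
     (\<forall>x y. ip y x = cnj (ip x y)) \<and>
     (\<forall>x. (norm x)\<^sup>2 = Re (ip x x))"

definition separable_set :: "'a::metric_space set \<Rightarrow> bool" where
  "separable_set S \<longleftrightarrow> (\<exists>C. countable C \<and> C \<subseteq> S \<and> S \<subseteq> closure C)"

definition csubspace :: "(complex \<Rightarrow> 'a \<Rightarrow> 'a) \<Rightarrow> 'a::real_vector set \<Rightarrow> bool" where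
  "csubspace sc D \<longleftrightarrow> 0 \<in> D \<and> (\<forall>x\<in>D. \<forall>y\<in>D. x + y \<in> D) \<and> (\<forall>a. \<forall>x\<in>D. sc a x \<in> D)"

definition clinear_on :: "(complex \<Rightarrow> 'a \<Rightarrow> 'a) \<Rightarrow> (complex \<Rightarrow> 'b \<Rightarrow> 'b) \<Rightarrow> 'a::real_vector set
    \<Rightarrow> ('a \<Rightarrow> 'b::real_vector) \<Rightarrow> bool" where
  "clinear_on sca scb D f \<longleftrightarrow> csubspace sca D \<and>
     (\<forall>x\<in>D. \<forall>y\<in>D. f (x + y) = f x + f y) \<and> (\<forall>a. \<forall>x\<in>D. f (sca a x) = scb a (f x))"

definition resolvent_op :: "(complex \<Rightarrow> 'a \<Rightarrow> 'a) \<Rightarrow> 'a set \<Rightarrow> ('a \<Rightarrow> 'a::real_normed_vector) \<Rightarrow> complex \<Rightarrow> 'a \<Rightarrow> 'a" where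
  "resolvent_op sc D A lam y = (THE x. x \<in> D \<and> sc lam x - A x = y)"

definition resolvent_set :: "(complex \<Rightarrow> 'a \<Rightarrow> 'a) \<Rightarrow> 'a set \<Rightarrow> ('a \<Rightarrow> 'a::real_normed_vector) \<Rightarrow> complex set" where
  "resolvent_set sc D A = {lam. (\<forall>y. \<exists>!x. x \<in> D \<and> sc lam x - A x = y) \<and>
      (\<exists>K. \<forall>y. norm (resolvent_op sc D A lam y) \<le> K * norm y)}"

definition spectrum_op :: "(complex \<Rightarrow> 'a \<Rightarrow> 'a) \<Rightarrow> 'a set \<Rightarrow> ('a \<Rightarrow> 'a::real_normed_vector) \<Rightarrow> complex set" where
  "spectrum_op sc D A = - resolvent_set sc D A"

definition closed_operator :: "'a set \<Rightarrow> ('a \<Rightarrow> 'a::real_normed_vector) \<Rightarrow> bool" where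
  "closed_operator D A \<longleftrightarrow> closed {(x, A x) | x. x \<in> D}"

definition unbounded_operator :: "'a set \<Rightarrow> ('a \<Rightarrow> 'a::real_normed_vector) \<Rightarrow> bool" where
  "unbounded_operator D A \<longleftrightarrow> \<not> (\<exists>K. \<forall>x\<in>D. norm (A x) \<le> K * norm x)"

text \<open>Sectorial operator in the sense of Henry (Def. 1.3.1).\<close>
definition sectorial :: "(complex \<Rightarrow> 'a \<Rightarrow> 'a) \<Rightarrow> 'a set \<Rightarrow> ('a \<Rightarrow> 'a::real_normed_vector) \<Rightarrow> bool" where
  "sectorial sc D A \<longleftrightarrow> clinear_on sc sc D A \<and> closed_operator D A \<and> closure D = UNIV \<and>
     (\<exists>a::real. \<exists>\<phi> M::real. 0 < \<phi> \<and> \<phi> < pi / 2 \<and> M \<ge> 1 \<and>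
        (\<forall>lam. lam \<noteq> complex_of_real a \<and> \<phi> \<le> \<bar>Arg (lam - complex_of_real a)\<bar> \<longrightarrow>
           lam \<in> resolvent_set sc D A \<and>
           (\<forall>y. norm (resolvent_op sc D A lam y) \<le> M / cmod (lam - complex_of_real a) * norm y)))"

definition compact_resolvent :: "(complex \<Rightarrow> 'a \<Rightarrow> 'a) \<Rightarrow> 'a set \<Rightarrow> ('a \<Rightarrow> 'a::real_normed_vector) \<Rightarrow> bool" where
  "compact_resolvent sc D A \<longleftrightarrow> (\<exists>lam\<in>resolvent_set sc D A.
      \<forall>B. bounded B \<longrightarrow> compact (closure (resolvent_op sc D A lam ` B)))"

text \<open>Negative fractional powers via the Balakrishnan formula, for 0 < a < 1:
  A^(-a) x = (sin (pi a) / pi) * integral over (0,inf) of t^(-a) (t + A)^(-1) x dt.\<close>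
definition neg_frac_pow :: "(complex \<Rightarrow> 'a \<Rightarrow> 'a) \<Rightarrow> 'a set \<Rightarrow> ('a \<Rightarrow> 'a::banach) \<Rightarrow> real \<Rightarrow> 'a \<Rightarrow> 'a" where
  "neg_frac_pow sc D A \<alpha> x = (sin (pi * \<alpha>) / pi) *\<^sub>R
      integral {0<..} (%t::real. (t powr (- \<alpha>)) *\<^sub>R (- resolvent_op sc D A (complex_of_real (- t)) x))"

definition frac_pow :: "(complex \<Rightarrow> 'a \<Rightarrow> 'a) \<Rightarrow> 'a set \<Rightarrow> ('a \<Rightarrow> 'a::banach) \<Rightarrow> real \<Rightarrow> 'a \<Rightarrow> 'a" where
  "frac_pow sc D A \<alpha> x = (if \<alpha> = 1 then A x else (THE y. neg_frac_pow sc D A \<alpha> y = x))"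

definition frac_dom :: "(complex \<Rightarrow> 'a \<Rightarrow> 'a) \<Rightarrow> 'a set \<Rightarrow> ('a \<Rightarrow> 'a::banach) \<Rightarrow> real \<Rightarrow> 'a set" where
  "frac_dom sc D A \<alpha> = (if \<alpha> = 0 then UNIV else if \<alpha> = 1 then D else range (neg_frac_pow sc D A \<alpha>))"

definition C0_semigroup_on :: "'b set \<Rightarrow> ('b \<Rightarrow> real) \<Rightarrow> (complex \<Rightarrow> 'b \<Rightarrow> 'b) \<Rightarrow> (real \<Rightarrow> 'b \<Rightarrow> 'b::real_vector) \<Rightarrow> bool" where
  "C0_semigroup_on Z N sc T \<longleftrightarrow>
     (\<forall>t\<ge>0. T t ` Z \<subseteq> Z \<and> clinear_on sc sc Z (T t) \<and> (\<exists>K. \<forall>z\<in>Z. N (T t z) \<le> K * N z)) \<and>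
     (\<forall>z\<in>Z. T 0 z = z) \<and>
     (\<forall>t s z. t \<ge> 0 \<longrightarrow> s \<ge> 0 \<longrightarrow> z \<in> Z \<longrightarrow> T (t + s) z = T t (T s z)) \<and>
     (\<forall>z\<in>Z. ((%t. N (T t z - z)) \<longlongrightarrow> 0) (at_right 0))"

definition is_C0_generator :: "'b set \<Rightarrow> ('b \<Rightarrow> real) \<Rightarrow> (complex \<Rightarrow> 'b \<Rightarrow> 'b) \<Rightarrow> 'b set \<Rightarrow> ('b \<Rightarrow> 'b::real_vector) \<Rightarrow> bool" where
  "is_C0_generator Z N sc DG G \<longleftrightarrow> (\<exists>T. C0_semigroup_on Z N sc T \<and>
     DG = {z \<in> Z. \<exists>y\<in>Z. ((%t. N ((1 / t) *\<^sub>R (T t z - z) - y)) \<longlongrightarrow> 0) (at_right 0)} \<and>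
     (\<forall>z\<in>DG. G z \<in> Z \<and> ((%t. N ((1 / t) *\<^sub>R (T t z - z) - G z)) \<longlongrightarrow> 0) (at_right 0)))"

definition Zspace :: "(complex \<Rightarrow> 'a \<Rightarrow> 'a) \<Rightarrow> 'a set \<Rightarrow> ('a \<Rightarrow> 'a::banach) \<Rightarrow> ('a \<times> 'a \<times> 'a) set" where
  "Zspace sc D A = frac_dom sc D A (2/3) \<times> frac_dom sc D A (1/3) \<times> UNIV"

definition Znorm :: "(complex \<Rightarrow> 'a \<Rightarrow> 'a) \<Rightarrow> 'a set \<Rightarrow> ('a \<Rightarrow> 'a::banach) \<Rightarrow> 'a \<times> 'a \<times> 'a \<Rightarrow> real" where
  "Znorm sc D A z = (case z of (u, v, w) \<Rightarrow>
     sqrt ((norm (frac_pow sc D A (2/3) u))\<^sup>2 + (norm (frac_pow sc D A (1/3) v))\<^sup>2 + (norm w)\<^sup>2))"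

definition sc3 :: "(complex \<Rightarrow> 'a \<Rightarrow> 'a) \<Rightarrow> complex \<Rightarrow> 'a \<times> 'a \<times> 'a \<Rightarrow> 'a \<times> 'a \<times> 'a" where
  "sc3 sc a z = (case z of (u, v, w) \<Rightarrow> (sc a u, sc a v, sc a w))"

definition B_dom :: "(complex \<Rightarrow> 'a \<Rightarrow> 'a) \<Rightarrow> 'a set \<Rightarrow> ('a \<Rightarrow> 'a::banach) \<Rightarrow> ('a \<times> 'a \<times> 'a) set" where
  "B_dom sc D A = frac_dom sc D A 1 \<times> frac_dom sc D A (2/3) \<times> frac_dom sc D A (1/3)"

definition B_op :: "(complex \<Rightarrow> 'a \<Rightarrow> 'a) \<Rightarrow> 'a set \<Rightarrow> ('a \<Rightarrow> 'a::banach) \<Rightarrow> real \<Rightarrow> 'a \<times> 'a \<times> 'a \<Rightarrow> 'a \<times> 'a \<times> 'a" where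
  "B_op sc D A \<eta> z = (case z of (u, v, w) \<Rightarrow>
     (frac_pow sc D A (1/3) u - v,
      - w,
      frac_pow sc D A (2/3) v + (\<eta> - 1) *\<^sub>R frac_pow sc D A (1/3) w))"

end

theory Submission
  imports Defs "HOL-Complex_Analysis.Complex_Analysis" "HOL-Real_Asymp.Real_Asymp"
begin

text \<open>
  Write \<open>C = A\<^bsup>1/3\<^esup>\<close> and \<open>L = C\<^bsup>-1\<^esup>\<close>. The isometry \<open>(p, q, r) \<mapsto> (L\<^sup>2 p, L q, r)\<close> of \<open>X\<^sup>3\<close> onto \<open>Z\<close>
  turns the operator into \<open>C \<otimes> M\<close> with a scalar \<open>3 \<times> 3\<close> matrix \<open>M\<close>. Two eigenvalues of \<open>-M\<close> are
  \<open>\<kappa>\<close> and its conjugate, where \<open>|\<kappa>| = 1\<close> and \<open>Re \<kappa> = (1 - \<eta>) / 2\<close> lies in \<open>(0, 1/2]\<close>. If there were a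
  semigroup, then \<open>C\<close> would have a resolvent of at most polynomial growth on the two half planes
  \<open>Re (\<mu> \<kappa>) \<ge> \<Omega>\<close> and \<open>Re (\<mu> cnj \<kappa>) \<ge> \<Omega>\<close>. Since \<open>C\<^sup>3 = A\<close>, the factorisation
  \<open>\<mu>\<^sup>3 - C\<^sup>3 = (\<mu> - C) (\<mu>\<^sup>2 + \<mu> C + C\<^sup>2)\<close> gives such a resolvent wherever \<open>\<mu>\<^sup>3\<close> lies outside the sector of
  \<open>A\<close>. The three regions cover a neighbourhood of infinity, and an operator whose resolvent grows
  polynomially near infinity is bounded by the maximum principle; hence \<open>A\<close> would be bounded.
  The spectrum of \<open>A\<close> may be empty, so no argument through eigenvectors of \<open>A\<close> is available.
\<close>

section \<open>Generators of strongly continuous semigroups\<close>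

text \<open>Write \<kappa> = e^(i \<theta>). From \<eta> < 1 follows \<theta> < pi/2, so the two
  half planes overlap around the positive axis; from \<eta> \<ge> 0 follows \<theta> \<ge> pi/3, so
  what they miss is, up to bounded shifts, a sector of half-angle pi/2 - \<theta> \<le> pi/6 around
  the negative axis. Cubing triples the angle, so \<mu>^3 lies in the left half plane up to lower
  order terms, and the opening \<phi> < pi/2 of the sector of A leaves room for these. The other
  obstacle is the identity L^3 = A^(-1). In \<open>neg_frac_pow\<close> the powers A^(-1/3) and
  A^(-2/3) are two unrelated integrals, so their composition laws have to be proved. With t = q^3
  all weights become polynomial. A composition, tested against functionals, is a double integral in
  q and p; after p = q r, homogeneity separates a universal factor depending on r from the expected
  vector, and this factor can be read off from A = 1.\<close>

lemma banach_Baire_interior: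
  fixes F :: "nat \<Rightarrow> 'b::banach set"
  assumes "\<And>n. closed (F n)" "(\<Union>n. F n) = UNIV"
  shows "\<exists>n. interior (F n) \<noteq> {}"
proof (rule ccontr)
  assume "\<not> ?thesis"
  then have "Met_TC.mtopology interior_of \<Union>(range F) = {}"
    using assms(1) by (intro Met_TC.metric_Baire_category_alt) (auto simp: complete_UNIV)
  then show False using assms(2) by simp
qed

text \<open>Uniform boundedness for the family of all small times: strong continuity at 0 bounds
  each orbit on an interval that depends on the vector, and Baire's theorem makes the interval
  uniform.\<close>

lemma semigroup_bounded_near_0:
  fixes T :: "real \<Rightarrow> 'b::banach \<Rightarrow> 'b"
  assumes bl: "\<And>t. t \<ge> 0 \<Longrightarrow> bounded_linear (T t)"
    and T0: "\<And>x. T 0 x = x"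
    and cont: "\<And>x. ((\<lambda>t. T t x) \<longlongrightarrow> x) (at_right 0)"
  shows "\<exists>d>0. \<exists>M\<ge>0. \<forall>t\<in>{0..d}. \<forall>x. norm (T t x) \<le> M * norm x"
proof -
  \<comment> \<open>One index both shrinks the interval and raises the bound, so that every vector
    lies in some \<open>F n\<close>.\<close>
  define F where "F n = {x. \<forall>t\<in>{0..1/real (Suc n)}. norm (T t x) \<le> real (Suc n)}" for n
  have "closed (F n)" for n
  proof -
    have "F n = (\<Inter>t\<in>{0..1/real (Suc n)}. {x. norm (T t x) \<le> real (Suc n)})"
      by (auto simp: F_def)
    moreover have "closed {x. norm (T t x) \<le> real (Suc n)}" if "t \<in> {0..1/real (Suc n)}" for t
      using that bl[of t]
      by (intro closed_Collect_le continuous_intros linear_continuous_on) auto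
    ultimately show ?thesis by auto
  qed
  moreover have "(\<Union>n. F n) = UNIV"
  proof -
    have "\<exists>n. x \<in> F n" for x
    proof -
      have "eventually (\<lambda>t. norm (T t x) < norm x + 1) (at_right 0)"
        using tendsto_norm[OF cont[of x]] by (rule order_tendstoD) simp
      then obtain b where b: "b > 0" "\<And>t. 0 < t \<Longrightarrow> t < b \<Longrightarrow> norm (T t x) < norm x + 1"
        unfolding eventually_at_right_field by auto
      obtain n :: nat where n: "real n > max (norm x + 1) (1 / b)"
        using reals_Archimedean2 by blast
      have "1 / real (Suc n) < b"
        using n b(1) by (simp add: field_simps)
      then have "norm (T t x) \<le> real (Suc n)" if "t \<in> {0..1/real (Suc n)}" for t
        using that b(2)[of t] n T0[of x] by (cases "t = 0") auto
      then have "x \<in> F n" by (simp add: F_def)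
      then show ?thesis ..
    qed
    then show ?thesis by auto
  qed
  ultimately obtain n where "interior (F n) \<noteq> {}"
    using banach_Baire_interior by blast
  then obtain x0 e where e: "e > 0" "cball x0 e \<subseteq> F n"
    by (metis ex_in_conv mem_interior_cball)
  \<comment> \<open>A vector \<open>y\<close> of length \<open>e\<close> is the difference of
    \<open>x0 + y\<close> and \<open>x0\<close>, whose images have norm at most
    \<open>Suc n\<close>; hence the factor 2.\<close>
  have "norm (T t x) \<le> (2 * real (Suc n) / e) * norm x" if t: "t \<in> {0..1/real (Suc n)}" for t x
  proof (cases "x = 0")
    case False
    interpret bounded_linear "T t" using bl t by simp
    define y where "y = (e / norm x) *\<^sub>R x"
    have "x0 + y \<in> F n" "x0 \<in> F n"
      using e False by (auto simp: subset_iff y_def dist_norm)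
    then have "norm (T t (x0 + y)) \<le> real (Suc n)" "norm (T t x0) \<le> real (Suc n)"
      using t unfolding F_def by blast+
    moreover have "T t y = T t (x0 + y) - T t x0" by (simp add: add)
    ultimately have "norm (T t y) \<le> 2 * real (Suc n)"
      using norm_triangle_ineq4[of "T t (x0 + y)" "T t x0"] by simp
    moreover have "norm (T t y) = (e / norm x) * norm (T t x)"
      using e by (simp add: y_def scale)
    ultimately show ?thesis
      using e False by (simp add: field_simps)
  next
    case True
    then show ?thesis
      using bl[of t] t linear_0[of "T t"] bounded_linear.linear by auto
  qed
  then show ?thesis
    using e by (intro exI[of _ "1/real (Suc n)"] conjI exI[of _ "2 * real (Suc n) / e"]) auto
qed

text \<open>The graph of the generator, as right derivative of the orbit at 0. Being a relation, it
  needs no domain and no value outside it.\<close>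

definition gen_at :: "(real \<Rightarrow> 'b::real_normed_vector \<Rightarrow> 'b) \<Rightarrow> 'b \<Rightarrow> 'b \<Rightarrow> bool" where
  "gen_at S x y \<longleftrightarrow> ((\<lambda>h. (1 / h) *\<^sub>R (S h x - x)) \<longlongrightarrow> y) (at_right 0)"

lemma integral_average_at_right:
  fixes f :: "real \<Rightarrow> 'b::banach"
  assumes "c < b" "continuous_on {c..b} f"
  shows "((\<lambda>h. (1 / h) *\<^sub>R integral {c..c+h} f) \<longlongrightarrow> f c) (at_right 0)"
proof (rule tendstoI)
  fix e :: real assume e: "e > 0"
  have "\<exists>d>0. \<forall>x\<in>{c..b}. dist x c < d \<longrightarrow> dist (f x) (f c) < e / 2"
    using assms e unfolding continuous_on_iff by (metis atLeastAtMost_iff half_gt_zero less_eq_real_def)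
  then obtain d where d: "d > 0" "\<And>x. x \<in> {c..b} \<Longrightarrow> dist x c < d \<Longrightarrow> dist (f x) (f c) < e / 2"
    by blast
  have "dist ((1 / h) *\<^sub>R integral {c..c+h} f) (f c) < e" if h: "0 < h" "h < min d (b - c)" for h
  proof -
    have cont: "continuous_on {c..c+h} f"
      using assms(2) by (rule continuous_on_subset) (use h in auto)
    have fi: "f integrable_on {c..c+h}"
      using cont by (rule integrable_continuous_interval)
    have "norm (integral {c..c+h} (\<lambda>x. f x - f c)) \<le> (e / 2) * (c + h - c)"
      using h d(2) by (intro integral_bound continuous_intros cont) 
        (auto simp: dist_norm dist_real_def intro!: less_imp_le)
    moreover have "integral {c..c+h} (\<lambda>x. f x - f c) = integral {c..c+h} f - h *\<^sub>R f c"
      using h fi by (subst integral_diff) auto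
    ultimately have "norm (integral {c..c+h} f - h *\<^sub>R f c) \<le> (e / 2) * h" by simp
    moreover
    have "(1 / h) *\<^sub>R integral {c..c+h} f - f c = (1 / h) *\<^sub>R (integral {c..c+h} f - h *\<^sub>R f c)"
      using h by (simp add: algebra_simps)
    then have "norm ((1 / h) *\<^sub>R integral {c..c+h} f - f c) = (1 / h) * norm (integral {c..c+h} f - h *\<^sub>R f c)"
      using h by simp
    ultimately have "norm ((1 / h) *\<^sub>R integral {c..c+h} f - f c) \<le> e / 2"
      using h by (simp add: divide_le_eq)
    then show ?thesis using e by (simp add: dist_norm)
  qed
  then show "\<forall>\<^sub>F h in at_right 0. dist ((1 / h) *\<^sub>R integral {c..c+h} f) (f c) < e"
    unfolding eventually_at_right_field using d(1) assms(1)
    by (intro exI[of _ "min d (b - c)"]) auto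
qed

text \<open>With V = \<open>\<integral>\<^sub>0\<^sup>d S(s) ds\<close> and G the generator, both \<open>V G \<subseteq> S d - 1\<close> and \<open>G V = S d - 1\<close>;
  since \<open>S d\<close> is a strict contraction, \<open>S d - 1\<close> is invertible, and so is G.\<close>

lemma contractive_semigroup_generator_bijective:
  fixes S :: "real \<Rightarrow> 'b::banach \<Rightarrow> 'b"
  assumes bl: "\<And>t. t \<ge> 0 \<Longrightarrow> bounded_linear (S t)"
    and S0: "\<And>x. S 0 x = x"
    and sg: "\<And>s t x. s \<ge> 0 \<Longrightarrow> t \<ge> 0 \<Longrightarrow> S (s + t) x = S s (S t x)"
    and cont: "\<And>x. ((\<lambda>t. S t x) \<longlongrightarrow> x) (at_right 0)"
    and d: "d > 0" and M: "\<And>t x. t \<in> {0..2*d} \<Longrightarrow> norm (S t x) \<le> M * norm x"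
    and half: "\<And>x. norm (S d x) \<le> norm x / 2"
  shows "\<exists>x. gen_at S x y"
    and "gen_at S x y \<Longrightarrow> norm x \<le> 2 * d * M * norm y"
proof -
  have S_lin: "S t (a + b) = S t a + S t b" "S t (a - b) = S t a - S t b" 
    "S t (r *\<^sub>R a) = r *\<^sub>R S t a" if "t \<ge> 0" for t a b r
  proof -
    interpret bounded_linear "S t" using bl that .
    show "S t (a + b) = S t a + S t b" "S t (a - b) = S t a - S t b" 
      "S t (r *\<^sub>R a) = r *\<^sub>R S t a" by (simp_all add: add diff scale)
  qed
  \<comment> \<open>For \<open>s < s'\<close> the semigroup law gives
    \<open>S s' x - S s x = S s (S (s' - s) x - x)\<close>; the uniform bound turns right continuity
    at 0 into continuity from both sides.\<close>
  have contS: "continuous_on {0..2*d} (\<lambda>t. S t x)" for x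
    unfolding continuous_on_iff
  proof safe
    fix t e :: real assume t: "t \<in> {0..2*d}" and e: "e > 0"
    define M' where "M' = max M 1"
    have M': "norm (S t x) \<le> M' * norm x" if "t \<in> {0..2*d}" for t x
      using M[OF that, of x] mult_right_mono[of M M' "norm x"] by (simp add: M'_def)
    have "M' > 0" by (simp add: M'_def)
    then have "eventually (\<lambda>h. dist (S h x) x < e / M') (at_right 0)"
      using e by (intro tendstoD[OF cont]) auto
    then obtain b where b: "b > 0" "\<And>h. 0 < h \<Longrightarrow> h < b \<Longrightarrow> norm (S h x - x) < e / M'"
      unfolding eventually_at_right_field dist_norm by auto
    have *: "dist (S s' x) (S s x) < e" if "s \<in> {0..2*d}" "s' \<in> {0..2*d}" "s < s'" "s' - s < b" for s s'
    proof -
      have "S s' x = S s (S (s' - s) x)"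
        using sg[of s "s' - s" x] that by simp
      then have "norm (S s' x - S s x) = norm (S s (S (s' - s) x - x))"
        using that by (simp add: S_lin)
      also have "\<dots> \<le> M' * norm (S (s' - s) x - x)" using that by (intro M') auto
      also have "\<dots> < M' * (e / M')" using \<open>M' > 0\<close> b(2)[of "s' - s"] that by (intro mult_strict_left_mono) auto
      finally show ?thesis using \<open>M' > 0\<close> by (simp add: dist_norm)
    qed
    show "\<exists>d'>0. \<forall>t'\<in>{0..2*d}. dist t' t < d' \<longrightarrow> dist (S t' x) (S t x) < e"
    proof (intro exI[of _ b] conjI ballI impI b(1))
      fix t' assume "t' \<in> {0..2*d}" "dist t' t < b"
      then show "dist (S t' x) (S t x) < e"
        using *[of t t'] *[of t' t] t e by (cases t t' rule: linorder_cases) (auto simp: dist_real_def dist_commute)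
    qed
  qed
  have intS: "(\<lambda>t. S t x) integrable_on {a..b}" if "0 \<le> a" "b \<le> 2*d" for a b x
    using that by (intro integrable_continuous_interval continuous_on_subset[OF contS]) auto
  define V where "V x = integral {0..d} (\<lambda>t. S t x)" for x
  have V_bound: "norm (V x) \<le> d * M * norm x" for x
    unfolding V_def using d integral_bound[of 0 d "\<lambda>t. S t x" "M * norm x"] M[of _ x] continuous_on_subset[OF contS, of "{0..d}"]
    by (auto simp: mult_ac)
  have V_lin: "bounded_linear V"
  proof (rule bounded_linear_intro)
    show "V (x + y) = V x + V y" for x y
      unfolding V_def using d by (subst integral_add[symmetric]) (auto intro!: intS integral_cong simp: S_lin)
    show "V (r *\<^sub>R x) = r *\<^sub>R V x" for r x
      unfolding V_def integral_cmul[symmetric] using d by (intro integral_cong) (simp add: S_lin)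
    show "norm (V x) \<le> norm x * (d * M)" for x using V_bound[of x] by (simp add: mult_ac)
  qed
  have V_comm: "S h (V x) = V (S h x)" if "h \<ge> 0" for h x
  proof -
    have "S h (V x) = integral {0..d} (S h \<circ> (\<lambda>t. S t x))"
      unfolding V_def using d that by (intro integral_linear[symmetric] intS bl) auto
    also have "\<dots> = V (S h x)"
      unfolding V_def using that by (intro integral_cong) (simp add: sg[symmetric] add.commute)
    finally show ?thesis .
  qed
  have genV: "gen_at S (V x) (S d x - x)" for x
  proof -
    have lim: "((\<lambda>h. (1 / h) *\<^sub>R integral {d..d+h} (\<lambda>t. S t x) - (1 / h) *\<^sub>R integral {0..0+h} (\<lambda>t. S t x)) 
         \<longlongrightarrow> S d x - S 0 x) (at_right 0)"
      using d by (intro tendsto_diff integral_average_at_right[of _ "2*d"] continuous_on_subset[OF contS]) auto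
    \<comment> \<open>Shifting the integral by \<open>h\<close> changes it only near the two
      endpoints; \<open>h < d\<close> keeps everything inside \<open>{0..2*d}\<close>.\<close>
    have ev: "eventually (\<lambda>h. (1 / h) *\<^sub>R integral {d..d+h} (\<lambda>t. S t x) - (1 / h) *\<^sub>R integral {0..0+h} (\<lambda>t. S t x)
       = (1 / h) *\<^sub>R (S h (V x) - V x)) (at_right 0)"
      unfolding eventually_at_right_field
    proof (intro exI[of _ d] conjI allI impI d)
      fix h assume h: "0 < h" "h < d"
      have "S h (V x) = integral {0..d} (\<lambda>t. S (t + h) x)"
        unfolding V_comm[OF less_imp_le[OF h(1)]] unfolding V_def using h
        by (intro integral_cong) (simp add: sg)
      also have "\<dots> = integral {h..d+h} (\<lambda>t. S t x)"
        using integral_shift_real_ivl[of h h "d + h" "\<lambda>t. S t x"] by simp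
      finally have 1: "S h (V x) = integral {h..d+h} (\<lambda>t. S t x)" .
      have 2: "integral {0..h} (\<lambda>t. S t x) + integral {h..d+h} (\<lambda>t. S t x) = integral {0..d+h} (\<lambda>t. S t x)"
        using h by (intro Henstock_Kurzweil_Integration.integral_combine intS) auto
      have 3: "V x + integral {d..d+h} (\<lambda>t. S t x) = integral {0..d+h} (\<lambda>t. S t x)"
        unfolding V_def using h by (intro Henstock_Kurzweil_Integration.integral_combine intS) auto
      have "S h (V x) - V x = integral {d..d+h} (\<lambda>t. S t x) - integral {0..h} (\<lambda>t. S t x)"
        using 1 2 3 by (simp add: algebra_simps)
      then show "(1 / h) *\<^sub>R integral {d..d+h} (\<lambda>t. S t x) - (1 / h) *\<^sub>R integral {0..0+h} (\<lambda>t. S t x)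
       = (1 / h) *\<^sub>R (S h (V x) - V x)"
        by (simp add: scaleR_diff_right)
    qed
    show ?thesis unfolding gen_at_def using Lim_transform_eventually[OF lim ev] by (simp only: S0)
  qed
  show "\<exists>x. gen_at S x y"
  proof -
    \<comment> \<open>A solution of \<open>S d z - z = y\<close> is a fixed point of the contraction
      \<open>z \<mapsto> S d z - y\<close>.\<close>
    have "dist (S d z - y) (S d w - y) \<le> (1/2) * dist z w" for z w
      using half[of "z - w"] d by (simp add: dist_norm S_lin)
    then have "\<exists>!z. S d z - y = z" by (intro banach_fix_type[of "1/2"]) auto
    then obtain z where "S d z - y = z" by blast
    then have "S d z - z = y" by (simp add: algebra_simps)
    then show ?thesis using genV[of z] by auto
  qed
  show "norm x \<le> 2 * d * M * norm y" if gen: "gen_at S x y"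
  proof -
    interpret V: bounded_linear V by (rule V_lin)
    have lim: "((\<lambda>h. V ((1 / h) *\<^sub>R (S h x - x))) \<longlongrightarrow> V y) (at_right 0)"
      using gen unfolding gen_at_def by (rule V.tendsto)
    have ev: "eventually (\<lambda>h. V ((1 / h) *\<^sub>R (S h x - x)) = (1 / h) *\<^sub>R (S h (V x) - V x)) (at_right 0)"
      unfolding eventually_at_right_field by (intro exI[of _ 1]) (auto simp: V.scale V.diff V_comm)
    \<comment> \<open>Both sides are limits of the same quotient, by continuity of \<open>V\<close>
      and by \<open>genV\<close>. In \<open>x = S d x - V y\<close> half of \<open>norm x\<close> is
      then absorbed, which gives the factor 2.\<close>
    have "V y = S d x - x"
      by (rule tendsto_unique[OF _ Lim_transform_eventually[OF lim ev] genV[unfolded gen_at_def]]) simp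
    then have "x = S d x - V y" by simp
    then have "norm x \<le> norm (S d x) + norm (V y)" by (metis norm_triangle_ineq4)
    then show ?thesis using half[of x] V_bound[of y] by simp
  qed
qed

section \<open>Scalar integrals for the composition of cube roots\<close>

text \<open>The partial fractions for \<open>j = 0\<close> and \<open>j = 1\<close> differ only in
  the sign \<open>e\<close> of the logarithmic part. That part vanishes at 0 and at infinity, so the
  arctangent alone gives the common value.\<close>

lemma integral_cube_denominator:
  fixes j :: nat
  assumes "j \<le> 1"
  shows "set_integrable lborel {0<..} (\<lambda>p::real. p ^ j / (1 + p ^ 3))"
    and "(LINT p:{0<..}|lborel. p ^ j / (1 + p ^ 3)) = 2 * pi / (3 * sqrt 3)"
proof -
  define e :: real where "e = (if j = 1 then 1 else -1)"
  define F where "F p = e * (ln (p\<^sup>2 - p + 1) - 2 * ln (p + 1)) / 6 + arctan ((2 * p - 1) / sqrt 3) / sqrt 3" for p :: real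
  have q: "p\<^sup>2 - p + 1 > 0" for p :: real
  proof -
    have "p\<^sup>2 - p + 1 = (p - 1/2)\<^sup>2 + 3/4" by (simp add: power2_eq_square algebra_simps)
    then show ?thesis by (simp add: add_nonneg_pos)
  qed
  have D: "DERIV F p :> p ^ j / (1 + p ^ 3)" if "p > 0" for p
  proof -
    have 1: "1 + ((2 * p - 1) / sqrt 3)\<^sup>2 = 4/3 * (p\<^sup>2 - p + 1)"
      by (simp add: power_divide) (simp add: power2_eq_square field_simps)
    have "DERIV F p :> e * ((2 * p - 1) / (p\<^sup>2 - p + 1) - 2 / (p + 1)) / 6 + (1 / (1 + ((2 * p - 1) / sqrt 3)\<^sup>2)) * (2 / sqrt 3) / sqrt 3"
    proof -
      have "DERIV (\<lambda>p. ln (p\<^sup>2 - p + 1)) p :> (2 * p - 1) / (p\<^sup>2 - p + 1)"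
        using q[of p] by (auto intro!: derivative_eq_intros)
      moreover have "DERIV (\<lambda>p. 2 * ln (p + 1)) p :> 2 / (p + 1)"
        using that by (auto intro!: derivative_eq_intros)
      moreover have "DERIV (\<lambda>p. arctan ((2 * p - 1) / sqrt 3)) p :> (1 / (1 + ((2 * p - 1) / sqrt 3)\<^sup>2)) * (2 / sqrt 3)"
      proof -
        have "DERIV (\<lambda>p. (2 * p - 1) / sqrt 3) p :> 2 / sqrt 3"
          by (intro DERIV_cdivide) (auto intro!: derivative_eq_intros)
        then show ?thesis
          unfolding inverse_eq_divide[symmetric] by (intro DERIV_chain2[OF DERIV_arctan])
      qed
      ultimately show ?thesis unfolding F_def
        by (intro DERIV_add DERIV_cdivide DERIV_cmult DERIV_diff)
    qed
    moreover have "e * ((2 * p - 1) / (p\<^sup>2 - p + 1) - 2 / (p + 1)) / 6 + (1 / (1 + ((2 * p - 1) / sqrt 3)\<^sup>2)) * (2 / sqrt 3) / sqrt 3 = p ^ j / (1 + p ^ 3)"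
    proof -
      have c: "1 + p ^ 3 = (p + 1) * (p\<^sup>2 - p + 1)" by (simp add: power2_eq_square power3_eq_cube algebra_simps)
      have s: "(1 / (1 + ((2 * p - 1) / sqrt 3)\<^sup>2)) * (2 / sqrt 3) / sqrt 3 = (1/2) / (p\<^sup>2 - p + 1)"
      proof -
        have "(1 / (4/3 * Q)) * (2 / sqrt 3) / sqrt 3 = (1/2) / Q" for Q :: real
        proof -
          have "(1 / (4/3 * Q)) * (2 / sqrt 3) / sqrt 3 = (1 / (4/3 * Q)) * (2 / (sqrt 3 * sqrt 3))"
            by (simp only: divide_divide_eq_left times_divide_eq_right mult_1_right)
          also have "\<dots> = (1 / (4/3 * Q)) * (2 / 3)" by (simp only: real_sqrt_mult_self abs_numeral)
          finally show ?thesis by simp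
        qed
        then show ?thesis unfolding 1 .
      qed
      have j: "j = 0 \<or> j = 1" using assms by auto
      have nz: "p + 1 \<noteq> 0" "p\<^sup>2 - p + 1 \<noteq> 0" using that q[of p] by auto
      show ?thesis unfolding s c using j nz
        by (auto simp: e_def divide_simps) (auto simp: algebra_simps power2_eq_square)
    qed
    ultimately show ?thesis by simp
  qed
  have e: "e = 1 \<or> e = -1" by (auto simp: e_def)
  have lim0: "(F \<longlongrightarrow> - (pi / 6) / sqrt 3) (at_right 0)"
  proof -
    have "isCont F 0" unfolding F_def by (intro continuous_intros) auto
    then have "(F \<longlongrightarrow> F 0) (at_right 0)"
      by (simp add: isCont_def filterlim_at_split)
    moreover have "arctan (-1 / sqrt 3) = - (pi / 6)"
    proof (rule arctan_unique)
      show "- (pi / 2) < - (pi / 6)" "- (pi / 6) < pi / 2" using pi_gt_zero by linarith+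
    qed (simp add: tan_30)
    ultimately show ?thesis by (simp add: F_def)
  qed
  have limoo: "(F \<longlongrightarrow> (pi / 2) / sqrt 3) at_top"
  proof -
    have "((\<lambda>p::real. ln (p\<^sup>2 - p + 1) - 2 * ln (p + 1)) \<longlongrightarrow> 0) at_top" by real_asymp
    then have "((\<lambda>p::real. e * (ln (p\<^sup>2 - p + 1) - 2 * ln (p + 1)) / 6) \<longlongrightarrow> e * 0 / 6) at_top"
      by (intro tendsto_intros) auto
    moreover have "filterlim (\<lambda>p::real. (2 * p - 1) / sqrt 3) at_top at_top" by real_asymp
    then have "((\<lambda>p. arctan ((2 * p - 1) / sqrt 3) / sqrt 3) \<longlongrightarrow> (pi / 2) / sqrt 3) at_top"
      by (intro tendsto_intros filterlim_compose[OF tendsto_arctan_at_top]) auto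
    ultimately have "(F \<longlongrightarrow> e * 0 / 6 + (pi / 2) / sqrt 3) at_top" unfolding F_def by (rule tendsto_add)
    then show ?thesis by simp
  qed
  have E: "einterval 0 \<infinity> = {0<..}" by (auto simp: einterval_def)
  note FTC = interval_integral_FTC_nonneg[of 0 \<infinity> F "\<lambda>p. p ^ j / (1 + p ^ 3)" "- (pi / 6) / sqrt 3" "(pi / 2) / sqrt 3"]
  have prem: "((F \<circ> real_of_ereal) \<longlongrightarrow> - (pi / 6) / sqrt 3) (at_right 0)"
     "((F \<circ> real_of_ereal) \<longlongrightarrow> (pi / 2) / sqrt 3) (at_left \<infinity>)"
    using lim0 limoo by (simp_all add: ereal_tendsto_simps zero_ereal_def)
  have cont: "isCont (\<lambda>p::real. p ^ j / (1 + p ^ 3)) x" if "x > 0" for x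
    using that zero_less_power[OF that, of 3] by (intro continuous_intros) linarith
  show "set_integrable lborel {0<..} (\<lambda>p::real. p ^ j / (1 + p ^ 3))"
    using FTC(1) prem D cont unfolding E by simp
  have "(LBINT p=0..\<infinity>. p ^ j / (1 + p ^ 3)) = (pi / 2) / sqrt 3 - - (pi / 6) / sqrt 3"
    using prem D cont by (intro FTC(2)) auto
  then show "(LINT p:{0<..}|lborel. p ^ j / (1 + p ^ 3)) = 2 * pi / (3 * sqrt 3)"
    unfolding interval_lebesgue_integral_def E by (simp add: field_simps)
qed

text \<open>The difference is the integral of \<open>w y / y\<close> from \<open>x\<close> to
  \<open>r * x\<close>, hence close to \<open>ln r * c\<close> where \<open>w\<close> is close to
  \<open>c\<close>. The filter is arbitrary in order to serve both \<open>x \<rightarrow> 0\<close>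
  and \<open>x \<rightarrow> \<infinity>\<close>.\<close>

lemma frullani_limit:
  fixes w F :: "real \<Rightarrow> complex"
  assumes F: "\<And>x. x > 0 \<Longrightarrow> (F has_vector_derivative w x / of_real x) (at x)"
    and r: "r > 0"
    and ev: "\<And>e. e > 0 \<Longrightarrow> eventually (\<lambda>x. x > 0 \<and> (\<forall>s\<in>closed_segment 1 r. norm (w (s * x) - c) \<le> e)) \<F>"
  shows "((\<lambda>x. F (r * x) - F x) \<longlongrightarrow> of_real (ln r) * c) \<F>"
proof (rule tendstoI)
  fix e :: real assume e: "e > 0"
  define m where "m = min 1 r"
  have m: "m > 0" "\<And>s. s \<in> closed_segment 1 r \<Longrightarrow> m \<le> s"
    using r by (auto simp: m_def closed_segment_eq_real_ivl split: if_splits)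
  \<comment> \<open>The mean value estimate on the segment from 1 to \<open>r\<close> costs
    \<open>\<bar>r - 1\<bar> / m\<close>; the added 1 covers \<open>r = 1\<close> and makes the
    final inequality strict.\<close>
  define e' where "e' = e * m / (\<bar>r - 1\<bar> + 1)"
  have e': "e' > 0" using e m by (simp add: e'_def)
  have "dist (F (r * x) - F x) (of_real (ln r) * c) < e"
    if x: "x > 0" "\<forall>s\<in>closed_segment 1 r. norm (w (s * x) - c) \<le> e'" for x
  proof -
    define g where "g s = F (s * x) - of_real (ln s) * c" for s
    have "norm (g r - g 1) \<le> (e' / m) * norm (r - 1)"
    proof (rule differentiable_bound[of "closed_segment 1 r"])
      fix s assume s: "s \<in> closed_segment 1 r"
      then have "s > 0" using m by force
      have "((\<lambda>s. F (s * x)) has_vector_derivative x *\<^sub>R (w (s * x) / of_real (s * x))) (at s)"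
      proof -
        have "((\<lambda>s. s * x) has_vector_derivative x) (at s)"
          unfolding has_real_derivative_iff_has_vector_derivative[symmetric] by (auto intro!: derivative_eq_intros)
        from vector_diff_chain_at[OF this F[of "s * x"]] \<open>s > 0\<close> x show ?thesis by (simp add: o_def)
      qed
      moreover have "((\<lambda>s. of_real (ln s) * c) has_vector_derivative of_real (1 / s) * c) (at s)"
        using \<open>s > 0\<close> by (auto intro!: derivative_eq_intros has_vector_derivative_mult_left 
            has_vector_derivative_of_real simp: has_real_derivative_iff_has_vector_derivative[symmetric] inverse_eq_divide)
      ultimately have "(g has_vector_derivative x *\<^sub>R (w (s * x) / of_real (s * x)) - of_real (1 / s) * c) (at s)"
        unfolding g_def by (rule has_vector_derivative_diff)
      moreover have "x *\<^sub>R (w (s * x) / of_real (s * x)) - of_real (1 / s) * c = (w (s * x) - c) / of_real s"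
        using x \<open>s > 0\<close> by (simp add: scaleR_conv_of_real field_simps)
      ultimately have "(g has_vector_derivative (w (s * x) - c) / of_real s) (at s)" by simp
      then show "(g has_derivative (\<lambda>h. h *\<^sub>R ((w (s * x) - c) / of_real s))) (at s within closed_segment 1 r)"
        unfolding has_vector_derivative_def by (rule has_derivative_at_withinI)
      have "norm ((w (s * x) - c) / of_real s) \<le> e' / m"
        using x(2) s m \<open>s > 0\<close> e' by (auto simp: norm_divide intro!: frac_le)
      then show "onorm (\<lambda>h. h *\<^sub>R ((w (s * x) - c) / of_real s)) \<le> e' / m"
        by (intro onorm_le) (metis norm_scaleR mult.commute mult_right_mono norm_ge_zero real_norm_def)
    qed auto
    also have "\<dots> < e" 
    proof -
      have "(e' / m) * norm (r - 1) = e * (\<bar>r - 1\<bar> / (\<bar>r - 1\<bar> + 1))" using m by (simp add: e'_def)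
      also have "\<dots> < e * 1" using e by (intro mult_strict_left_mono) auto
      finally show ?thesis by simp
    qed
    finally show ?thesis by (simp add: g_def dist_norm algebra_simps)
  qed
  then show "\<forall>\<^sub>F x in \<F>. dist (F (r * x) - F x) (of_real (ln r) * c) < e"
    by (intro eventually_mono[OF ev[OF e']]) simp
qed

text \<open>Frullani's integral. A primitive of \<open>w q / q\<close> may diverge at 0, but its
  differences \<open>F (r * q) - F q\<close> have limits at both ends.\<close>

lemma frullani:
  fixes w :: "real \<Rightarrow> complex"
  assumes cont: "continuous_on {0..} w" and lim: "(w \<longlongrightarrow> 0) at_top" and r: "r > 0"
    and int: "set_integrable lborel {0<..} (\<lambda>q. (w (r * q) - w q) / of_real q)"
  shows "(LINT q:{0<..}|lborel. (w (r * q) - w q) / of_real q) = - (of_real (ln r) * w 0)"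
proof -
  have isc: "isCont w x" if "x > 0" for x
  proof -
    have "continuous_on {0<..} w" using cont by (rule continuous_on_subset) auto
    then show ?thesis using that by (simp add: continuous_on_eq_continuous_at)
  qed
  have "\<exists>F. \<forall>x. 0 < ereal x \<longrightarrow> ereal x < \<infinity> \<longrightarrow> (F has_vector_derivative w x / of_real x) (at x)"
    by (rule einterval_antiderivative) (auto intro!: continuous_intros isc)
  then obtain F where F: "\<And>x. x > 0 \<Longrightarrow> (F has_vector_derivative w x / of_real x) (at x)"
    by auto
  define M where "M = max 1 r"
  define m where "m = min 1 r"
  have mM: "m > 0" "M > 0" "\<And>s. s \<in> closed_segment 1 r \<Longrightarrow> m \<le> s" "\<And>s. s \<in> closed_segment 1 r \<Longrightarrow> s \<le> M"
    using r by (auto simp: m_def M_def closed_segment_eq_real_ivl split: if_splits)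
  have lim0: "((\<lambda>x. F (r * x) - F x) \<longlongrightarrow> of_real (ln r) * w 0) (at_right 0)"
  proof (rule frullani_limit[OF F r])
    fix e :: real assume "e > 0"
    then have "\<exists>d>0. \<forall>x\<in>{0..}. dist x 0 < d \<longrightarrow> dist (w x) (w 0) < e"
      using cont[unfolded continuous_on_iff, THEN bspec, of 0] by simp
    then obtain d where d: "d > 0" "\<And>x. x \<ge> 0 \<Longrightarrow> x < d \<Longrightarrow> norm (w x - w 0) < e"
      by (auto simp: dist_norm)
    show "\<forall>\<^sub>F x in at_right 0. x > 0 \<and> (\<forall>s\<in>closed_segment 1 r. norm (w (s * x) - w 0) \<le> e)"
      unfolding eventually_at_right_field
    proof (intro exI[of _ "d / M"] conjI allI impI ballI)
      fix x s assume x: "0 < x" "x < d / M" and s: "s \<in> closed_segment 1 r"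
      have "s > 0" using mM(1) mM(3)[OF s] by simp
      have "s * x \<le> M * x" using mM s x by (intro mult_right_mono) auto
      also have "\<dots> < d" using x mM by (simp add: field_simps)
      finally show "norm (w (s * x) - w 0) \<le> e" using d(2)[of "s * x"] \<open>s > 0\<close> x by simp
    qed (use d mM in auto)
  qed
  have limoo: "((\<lambda>x. F (r * x) - F x) \<longlongrightarrow> of_real (ln r) * 0) at_top"
  proof (rule frullani_limit[OF F r])
    fix e :: real assume "e > 0"
    then have "eventually (\<lambda>x. norm (w x) < e) at_top"
      using lim by (auto simp: tendsto_iff)
    then obtain N where N: "\<And>x. x \<ge> N \<Longrightarrow> norm (w x) < e"
      by (auto simp: eventually_at_top_linorder)
    show "\<forall>\<^sub>F x in at_top. x > 0 \<and> (\<forall>s\<in>closed_segment 1 r. norm (w (s * x) - 0) \<le> e)"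
      unfolding eventually_at_top_linorder
    proof (intro exI[of _ "max 1 (N / m)"] conjI allI impI ballI)
      fix x s assume x: "x \<ge> max 1 (N / m)" and s: "s \<in> closed_segment 1 r"
      have "N \<le> m * x" using x mM by (simp add: field_simps)
      also have "\<dots> \<le> s * x" using mM s x by (intro mult_right_mono) auto
      finally show "norm (w (s * x) - 0) \<le> e" using N[of "s * x"] by simp
    qed auto
  qed
  have E: "einterval 0 \<infinity> = {0<..}" by (auto simp: einterval_def)
  have "(LBINT x=0..\<infinity>. (w (r * x) - w x) / of_real x) = of_real (ln r) * 0 - of_real (ln r) * w 0"
  proof (rule interval_integral_FTC_integrable)
    fix x assume "0 < ereal x" then have x: "x > 0" by simp
    show "isCont (\<lambda>x. (w (r * x) - w x) / of_real x) x"
      using x r by (intro continuous_intros isc isCont_o2[of _ "\<lambda>x. r * x" w]) auto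
    have "((\<lambda>x. F (r * x)) has_vector_derivative r *\<^sub>R (w (r * x) / of_real (r * x))) (at x)"
    proof -
      have "((\<lambda>x. r * x) has_vector_derivative r) (at x)"
        unfolding has_real_derivative_iff_has_vector_derivative[symmetric] by (auto intro!: derivative_eq_intros)
      from vector_diff_chain_at[OF this F[of "r * x"]] r x show ?thesis by (simp add: o_def)
    qed
    then have "((\<lambda>x. F (r * x) - F x) has_vector_derivative r *\<^sub>R (w (r * x) / of_real (r * x)) - w x / of_real x) (at x)"
      by (intro has_vector_derivative_diff F x)
    moreover have "r *\<^sub>R (w (r * x) / of_real (r * x)) - w x / of_real x = (w (r * x) - w x) / of_real x"
      using x r by (simp add: scaleR_conv_of_real field_simps)
    ultimately show "((\<lambda>x. F (r * x) - F x) has_vector_derivative (w (r * x) - w x) / of_real x) (at x)" by simp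
  qed (use int lim0 limoo in \<open>simp_all add: E ereal_tendsto_simps zero_ereal_def\<close>)
  then show ?thesis unfolding interval_lebesgue_integral_def E by simp
qed

text \<open>If \<open>w q = \<phi> ((q\<^sup>3 + A)\<^bsup>-1\<^esup> x)\<close>, then by the resolvent identity this is
  \<open>\<phi> ((q\<^sup>3 + A)\<^bsup>-1\<^esup> (p\<^sup>3 + A)\<^bsup>-1\<^esup> x)\<close>; on the diagonal division by zero makes it \<open>0\<close>.\<close>

definition cube_quotient :: "(real \<Rightarrow> complex) \<Rightarrow> real \<Rightarrow> real \<Rightarrow> complex" where
  "cube_quotient w q p = (w q - w p) / of_real (p ^ 3 - q ^ 3)"

section \<open>Double integrals of the resolvent kernel\<close>

lemma cube_denominator_pos: "x \<ge> 0 \<Longrightarrow> 1 + x ^ 3 > (0::real)"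
  using zero_le_power[of x 3] by linarith

lemma set_integral_scale:
  fixes f :: "real \<Rightarrow> complex"
  assumes "c > 0"
  shows "(LINT p:{0<..}|lborel. f p) = of_real c * (LINT r:{0<..}|lborel. f (c * r))"
proof -
  have "(LINT p:{0<..}|lborel. f p) = \<bar>c\<bar> *\<^sub>R (\<integral>r. indicator {0<..} (0 + c * r) *\<^sub>R f (0 + c * r) \<partial>lborel)"
    unfolding set_lebesgue_integral_def using assms by (intro lborel_integral_real_affine) simp
  also have "\<dots> = of_real c * (LINT r:{0<..}|lborel. f (c * r))"
    using assms unfolding set_lebesgue_integral_def
    by (auto simp: scaleR_conv_of_real indicator_def zero_less_mult_iff intro!: Bochner_Integration.integral_cong)
  finally show ?thesis .
qed

lemma set_integrable_scale:
  fixes f :: "real \<Rightarrow> 'b::{banach, second_countable_topology}"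
  assumes "c > 0" "set_integrable lborel {0<..} f"
  shows "set_integrable lborel {0<..} (\<lambda>r. f (c * r))"
proof -
  have "integrable lborel (\<lambda>r. indicator {0<..} (0 + c * r) *\<^sub>R f (0 + c * r))"
    using assms unfolding set_integrable_def by (intro lborel_integrable_real_affine) auto
  moreover have "(\<lambda>r. indicator {0<..} (0 + c * r) *\<^sub>R f (0 + c * r)) = (\<lambda>r. indicator {0<..} r *\<^sub>R f (c * r))"
    using assms by (auto simp: indicator_def zero_less_mult_iff)
  ultimately show ?thesis unfolding set_integrable_def by simp
qed

text \<open>What survives of a resolvent after testing with a functional. \<open>diff\<close>
  combines the resolvent identity with the decay of both factors; it dominates
  \<open>cube_quotient\<close> by a product kernel, which is what Fubini's theorem requires.\<close>

locale cube_kernel =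
  fixes w :: "real \<Rightarrow> complex" and K :: real
  assumes cont: "continuous_on {0..} w"
    and diff: "\<And>p q. p \<ge> 0 \<Longrightarrow> q \<ge> 0 \<Longrightarrow> norm (w q - w p) \<le> K * \<bar>p ^ 3 - q ^ 3\<bar> / ((1 + q ^ 3) * (1 + p ^ 3))"
    and bound: "\<And>q. q \<ge> 0 \<Longrightarrow> norm (w q) \<le> K / (1 + q ^ 3)"
begin

lemma K_nonneg: "K \<ge> 0"
  using order_trans[OF norm_ge_zero bound[of 0]] by simp

lemma norm_cube_quotient_le:
  assumes "p \<ge> 0" "q \<ge> 0"
  shows "norm (cube_quotient w q p) \<le> K / ((1 + q ^ 3) * (1 + p ^ 3))"
proof (cases "p ^ 3 = q ^ 3")
  case True
  then show ?thesis
    using assms K_nonneg cube_denominator_pos[of p] cube_denominator_pos[of q] by (simp add: cube_quotient_def)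
next
  case False
  then show ?thesis
    using diff[OF assms] assms 
    by (simp add: cube_quotient_def norm_divide del: of_real_diff of_real_power) (simp add: field_simps)
qed

text \<open>\<open>w\<close> is controlled on \<open>{0..}\<close> only, so measurability on the
  whole line is stated for the cut-off function.\<close>

lemma measurable_extension: "(\<lambda>q. indicator {0..} q *\<^sub>R w q) \<in> borel_measurable borel"
  using cont by (intro borel_measurable_continuous_on_indicator) auto

lemma power_w_integrable:
  fixes j :: nat
  assumes "j \<le> 1"
  shows "set_integrable lborel {0<..} (\<lambda>q. of_real (q ^ j) * w q)"
proof (rule set_integrable_bound)
  show "set_integrable lborel {0<..} (\<lambda>q. K * (q ^ j / (1 + q ^ 3)))"
    using integral_cube_denominator(1)[OF assms] by (intro set_integrable_mult_right) simp
  have "(\<lambda>q. indicator {0<..} q *\<^sub>R (of_real (q ^ j) * (indicator {0..} q *\<^sub>R w q))) \<in> borel_measurable borel"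
    using measurable_extension by measurable
  also have "(\<lambda>q. indicator {0<..} q *\<^sub>R (of_real (q ^ j) * (indicator {0..} q *\<^sub>R w q))) = (\<lambda>q. indicator {0<..} q *\<^sub>R (of_real (q ^ j) * w q))"
    by (auto simp: indicator_def)
  finally show "set_borel_measurable lborel {0<..} (\<lambda>q. of_real (q ^ j) * w q)" by (simp add: set_borel_measurable_def)
  have "q ^ j * norm (w q) \<le> q ^ j * (K / (1 + q ^ 3))" if "q > 0" for q
    using bound[of q] that by (intro mult_left_mono) auto
  then show "AE x in lborel. x \<in> {0<..} \<longrightarrow> norm (of_real (x ^ j) * w x) \<le> norm (K * (x ^ j / (1 + x ^ 3)))"
    using K_nonneg by (auto simp: abs_mult norm_mult norm_power mult.commute intro!: AE_I2)
qed

lemma w_integrable: "set_integrable lborel {0<..} w"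
  using power_w_integrable[of 0] by simp

lemma cube_quotient_integrable:
  fixes j :: nat
  assumes j: "j \<le> 1" and q: "q \<ge> 0"
  shows "set_integrable lborel {0<..} (\<lambda>p. of_real (p ^ j) * cube_quotient w q p)"
proof (rule set_integrable_bound)
  show "set_integrable lborel {0<..} (\<lambda>p. K / (1 + q ^ 3) * (p ^ j / (1 + p ^ 3)))"
    using integral_cube_denominator(1)[OF j] by (intro set_integrable_mult_right) simp
  have "(\<lambda>p. indicator {0<..} p *\<^sub>R (of_real (p ^ j) * ((w q - indicator {0..} p *\<^sub>R w p) / of_real (p ^ 3 - q ^ 3)))) \<in> borel_measurable borel"
    using measurable_extension by measurable
  also have "(\<lambda>p. indicator {0<..} p *\<^sub>R (of_real (p ^ j) * ((w q - indicator {0..} p *\<^sub>R w p) / of_real (p ^ 3 - q ^ 3)))) 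
      = (\<lambda>p. indicator {0<..} p *\<^sub>R (of_real (p ^ j) * cube_quotient w q p))"
    by (auto simp: indicator_def cube_quotient_def)
  finally show "set_borel_measurable lborel {0<..} (\<lambda>p. of_real (p ^ j) * cube_quotient w q p)"
    by (simp add: set_borel_measurable_def)
  have "p ^ j * norm (cube_quotient w q p) \<le> p ^ j * (K / ((1 + q ^ 3) * (1 + p ^ 3)))" if "p > 0" for p
    using norm_cube_quotient_le[of p q] that q by (intro mult_left_mono) auto
  then show "AE p in lborel. p \<in> {0<..} \<longrightarrow> norm (of_real (p ^ j) * cube_quotient w q p) 
      \<le> norm (K / (1 + q ^ 3) * (p ^ j / (1 + p ^ 3)))"
    using K_nonneg q by (auto simp: abs_mult norm_mult norm_power mult.commute intro!: AE_I2)
qed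

text \<open>The substitution \<open>p = q r\<close> followed by Fubini's theorem.\<close>

lemma integral_cube_quotient_swap:
  fixes i j :: nat
  assumes i: "i \<le> 1" and j: "j \<le> 1"
  shows "(LINT q:{0<..}|lborel. of_real (q ^ i) * (LINT p:{0<..}|lborel. of_real (p ^ j) * cube_quotient w q p))
    = (LINT r:{0<..}|lborel. of_real (r ^ j) * (LINT q:{0<..}|lborel. of_real (q ^ (i + j + 1)) * cube_quotient w q (q * r)))"
proof -
  define v where "v q = indicator {0..} q *\<^sub>R w q" for q
  have [measurable]: "v \<in> borel_measurable borel"
    unfolding v_def by (rule measurable_extension)
  define g :: "real \<Rightarrow> real \<Rightarrow> complex" where "g q r = indicator {0<..} q *\<^sub>R indicator {0<..} r *\<^sub>R
    (of_real (q ^ (i + j + 1) * r ^ j) * ((v q - v (q * r)) / of_real ((q * r) ^ 3 - q ^ 3)))" for q r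
  \<comment> \<open>The dominating product kernel after \<open>p = q * r\<close>, with the Jacobian
    \<open>q\<close>. Undoing the substitution shows that its integral over \<open>r\<close> is a
    constant times \<open>K * q ^ i / (1 + q ^ 3)\<close> for \<open>q > 0\<close>.\<close>
  define h :: "real \<Rightarrow> real \<Rightarrow> real" where "h q r = (indicator {0<..} q * (K * (q ^ i / (1 + q ^ 3)))) *
     (q * (indicator {0<..} r * ((q * r) ^ j / (1 + (q * r) ^ 3))))" for q r
  have g_eq: "g q r = indicator {0<..} q *\<^sub>R indicator {0<..} r *\<^sub>R
    (of_real (q ^ (i + j + 1) * r ^ j) * cube_quotient w q (q * r))" for q r
    by (auto simp: g_def v_def cube_quotient_def indicator_def)
  have meas_h: "case_prod h \<in> borel_measurable (lborel \<Otimes>\<^sub>M lborel)"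
    unfolding h_def split_beta by measurable
  have h_nonneg: "h q r \<ge> 0" for q r
    unfolding h_def using K_nonneg by (auto simp: indicator_def intro!: mult_nonneg_nonneg divide_nonneg_nonneg)
  have h_int: "integrable lborel (h q)" and h_val: "(\<integral>r. h q r \<partial>lborel) = indicator {0<..} q *\<^sub>R (K * (q ^ i / (1 + q ^ 3)) * (2 * pi / (3 * sqrt 3)))" for q
  proof -
    show "integrable lborel (h q)"
    proof (cases "q > 0")
      case True
      have "set_integrable lborel {0<..} (\<lambda>r. (q * r) ^ j / (1 + (q * r) ^ 3))"
        by (rule set_integrable_scale[OF True integral_cube_denominator(1)[OF j]])
      then show ?thesis unfolding h_def set_integrable_def
        by (intro integrable_mult_right) simp_all
    next
      case False
      then have "h q = (\<lambda>r. 0)" by (auto simp: h_def)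
      then show ?thesis by simp
    qed
    show "(\<integral>r. h q r \<partial>lborel) = indicator {0<..} q *\<^sub>R (K * (q ^ i / (1 + q ^ 3)) * (2 * pi / (3 * sqrt 3)))"
    proof (cases "q > 0")
      case True
      have "complex_of_real (2 * pi / (3 * sqrt 3)) = of_real q * (LINT r:{0<..}|lborel. complex_of_real ((q * r) ^ j / (1 + (q * r) ^ 3)))"
        using set_integral_scale[OF True, of "\<lambda>p. complex_of_real (p ^ j / (1 + p ^ 3))"]
        unfolding set_integral_complex_of_real integral_cube_denominator(2)[OF j] .
      then have "2 * pi / (3 * sqrt 3) = q * (LINT r:{0<..}|lborel. (q * r) ^ j / (1 + (q * r) ^ 3))"
        unfolding set_integral_complex_of_real of_real_mult[symmetric] of_real_eq_iff .
      moreover have "(\<integral>r. h q r \<partial>lborel) = K * (q ^ i / (1 + q ^ 3)) * (q * (LINT r:{0<..}|lborel. (q * r) ^ j / (1 + (q * r) ^ 3)))"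
        using True unfolding h_def set_lebesgue_integral_def real_scaleR_def integral_mult_right_zero by simp
      ultimately show ?thesis using True by simp
    qed (simp add: h_def)
  qed
  have int_h: "integrable (lborel \<Otimes>\<^sub>M lborel) (case_prod h)"
  proof (rule lborel_pair.Fubini_integrable[OF meas_h])
    have "integrable lborel (\<lambda>q. indicator {0<..} q *\<^sub>R (K * (q ^ i / (1 + q ^ 3)) * (2 * pi / (3 * sqrt 3))))"
      using integral_cube_denominator(1)[OF i] unfolding set_integrable_def[symmetric]
      by (intro set_integrable_mult_left set_integrable_mult_right) auto
    then show "integrable lborel (\<lambda>x. LINT y|lborel. norm (case (x, y) of (x, y) \<Rightarrow> h x y))"
      using h_nonneg by (simp add: h_val)
    show "AE x in lborel. integrable lborel (\<lambda>y. case (x, y) of (x, y) \<Rightarrow> h x y)"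
      using h_int by simp
  qed
  have meas_g: "case_prod g \<in> borel_measurable (lborel \<Otimes>\<^sub>M lborel)"
    unfolding g_def split_beta by measurable
  have g_le_h: "norm (g q r) \<le> norm (h q r)" for q r
  proof (cases "q > 0 \<and> r > 0")
    case True
    have "norm (g q r) = q ^ (i + j + 1) * r ^ j * norm (cube_quotient w q (q * r))"
      using True by (simp add: g_eq norm_mult norm_power abs_mult power_abs)
    also have "\<dots> \<le> q ^ (i + j + 1) * r ^ j * (K / ((1 + q ^ 3) * (1 + (q * r) ^ 3)))"
      using True by (intro mult_left_mono norm_cube_quotient_le) auto
    also have "\<dots> = h q r"
      using True by (simp add: h_def power_add power_mult_distrib)
    finally show ?thesis using h_nonneg[of q r] by simp
  qed (auto simp: g_def)
  have int_g: "integrable (lborel \<Otimes>\<^sub>M lborel) (case_prod g)"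
    by (rule Bochner_Integration.integrable_bound[OF int_h meas_g]) (use g_le_h in auto)
  have "(\<integral>q. (\<integral>r. g q r \<partial>lborel) \<partial>lborel) = (\<integral>r. (\<integral>q. g q r \<partial>lborel) \<partial>lborel)"
    using lborel_pair.Fubini_integral[OF int_g] by simp
  moreover have "(\<integral>r. (\<integral>q. g q r \<partial>lborel) \<partial>lborel) = 
    (LINT r:{0<..}|lborel. of_real (r ^ j) * (LINT q:{0<..}|lborel. of_real (q ^ (i + j + 1)) * cube_quotient w q (q * r)))"
    unfolding set_lebesgue_integral_def
  proof (intro Bochner_Integration.integral_cong refl)
    fix r
    have "(\<integral>q. g q r \<partial>lborel) = (\<integral>q. (indicator {0<..} r *\<^sub>R of_real (r ^ j)) * (indicator {0<..} q *\<^sub>R (of_real (q ^ (i + j + 1)) * cube_quotient w q (q * r))) \<partial>lborel)"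
      by (intro Bochner_Integration.integral_cong refl) (simp add: g_eq mult_ac scaleR_conv_of_real)
    then show "(\<integral>q. g q r \<partial>lborel) = indicator {0<..} r *\<^sub>R (of_real (r ^ j) * (\<integral>q. indicator {0<..} q *\<^sub>R (of_real (q ^ (i + j + 1)) * cube_quotient w q (q * r)) \<partial>lborel))"
      unfolding integral_mult_right_zero by (simp only: mult_scaleR_left)
  qed
  moreover have "(\<integral>q. (\<integral>r. g q r \<partial>lborel) \<partial>lborel) = 
    (LINT q:{0<..}|lborel. of_real (q ^ i) * (LINT p:{0<..}|lborel. of_real (p ^ j) * cube_quotient w q p))"
    unfolding set_lebesgue_integral_def
  proof (intro Bochner_Integration.integral_cong refl)
    fix q :: real
    show "(\<integral>r. g q r \<partial>lborel) = indicator {0<..} q *\<^sub>R (of_real (q ^ i) * (\<integral>p. indicator {0<..} p *\<^sub>R (of_real (p ^ j) * cube_quotient w q p) \<partial>lborel))"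
    proof (cases "q > 0")
      case True
      have "(\<integral>r. g q r \<partial>lborel) = (\<integral>r. (of_real (q ^ i) * of_real q) * (indicator {0<..} r *\<^sub>R (of_real ((q * r) ^ j) * cube_quotient w q (q * r))) \<partial>lborel)"
        using True
        by (intro Bochner_Integration.integral_cong refl) (simp add: g_eq mult_ac scaleR_conv_of_real power_add power_mult_distrib)
      also have "\<dots> = of_real (q ^ i) * (of_real q * (LINT r:{0<..}|lborel. of_real ((q * r) ^ j) * cube_quotient w q (q * r)))"
        unfolding integral_mult_right_zero set_lebesgue_integral_def by (simp only: mult.assoc)
      also have "\<dots> = of_real (q ^ i) * (LINT p:{0<..}|lborel. of_real (p ^ j) * cube_quotient w q p)"
        using set_integral_scale[OF True, of "\<lambda>p. of_real (p ^ j) * cube_quotient w q p"] by simp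
      finally show ?thesis using True by (simp add: set_lebesgue_integral_def)
    qed (simp add: g_eq)
  qed
  ultimately show ?thesis by simp
qed

text \<open>Since \<open>(q * r) ^ 3 - q ^ 3 = q ^ 3 * (r ^ 3 - 1)\<close>, the weight
  \<open>q ^ 3\<close> cancels and leaves \<open>w q - w (r * q)\<close>, which scaling integrates.
  At \<open>r = 1\<close> both sides are 0 by division by zero.\<close>

lemma inner_integral_11:
  assumes "r > 0"
  shows "(LINT q:{0<..}|lborel. of_real (q ^ 3) * cube_quotient w q (q * r)) 
     = of_real ((1 - 1 / r) / (r ^ 3 - 1)) * (LINT q:{0<..}|lborel. w q)"
proof -
  have "(LINT q:{0<..}|lborel. of_real (q ^ 3) * cube_quotient w q (q * r)) 
    = (LINT q:{0<..}|lborel. of_real (1 / (r ^ 3 - 1)) * (w q - w (r * q)))"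
  proof (rule set_lebesgue_integral_cong)
    have "of_real (q ^ 3) * cube_quotient w q (q * r) = of_real (1 / (r ^ 3 - 1)) * (w q - w (r * q))" if "q > 0" for q
    proof -
      have "(q * r) ^ 3 - q ^ 3 = q ^ 3 * (r ^ 3 - 1)" by (simp add: power_mult_distrib algebra_simps)
      then show ?thesis using that unfolding cube_quotient_def by (simp add: mult.commute)
    qed
    then show "\<forall>q. q \<in> {0<..} \<longrightarrow> of_real (q ^ 3) * cube_quotient w q (q * r) = of_real (1 / (r ^ 3 - 1)) * (w q - w (r * q))"
      by auto
  qed simp
  also have "\<dots> = of_real (1 / (r ^ 3 - 1)) * (LINT q:{0<..}|lborel. w q - w (r * q))"
    by simp
  also have "(LINT q:{0<..}|lborel. w q - w (r * q)) = (LINT q:{0<..}|lborel. w q) - (LINT q:{0<..}|lborel. w (r * q))"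
    by (rule set_integral_diff(2)[OF w_integrable set_integrable_scale[OF assms w_integrable]])
  also have "(LINT q:{0<..}|lborel. w (r * q)) = of_real (1 / r) * (LINT q:{0<..}|lborel. w q)"
    using set_integral_scale[OF assms, of w] assms by simp
  finally show ?thesis by (simp add: algebra_simps diff_divide_distrib)
qed

text \<open>One power of \<open>q\<close> less than before leaves
  \<open>(w (r * q) - w q) / q\<close>, a Frullani integral; this is why the value
  \<open>w 0\<close> appears.\<close>

lemma inner_integral_10:
  assumes "r > 0"
  shows "(LINT q:{0<..}|lborel. of_real (q ^ 2) * cube_quotient w q (q * r)) 
     = of_real (ln r / (r ^ 3 - 1)) * w 0"
proof -
  have eq: "of_real (q ^ 2) * cube_quotient w q (q * r) = of_real (- 1 / (r ^ 3 - 1)) * ((w (r * q) - w q) / of_real q)" if "q > 0" for q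
  proof -
    have "(q * r) ^ 3 - q ^ 3 = q ^ 2 * (q * (r ^ 3 - 1))"
      by (simp add: power_mult_distrib algebra_simps power2_eq_square power3_eq_cube)
    then show ?thesis using that unfolding cube_quotient_def
      by (simp add: mult.commute divide_simps)
  qed
  have int: "set_integrable lborel {0<..} (\<lambda>q. (w (r * q) - w q) / of_real q)"
  proof (rule set_integrable_bound)
    show "set_integrable lborel {0<..} (\<lambda>q. (K * \<bar>r ^ 3 - 1\<bar>) * ((r * q) ^ 0 / (1 + (r * q) ^ 3)))"
      by (intro set_integrable_mult_right set_integrable_scale[OF assms integral_cube_denominator(1)]) auto
    have [measurable]: "(\<lambda>q. indicator {0..} q *\<^sub>R w q) \<in> borel_measurable borel" by (rule measurable_extension)
    have [measurable]: "(\<lambda>q. indicator {0..} (r * q) *\<^sub>R w (r * q)) \<in> borel_measurable borel"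
      by (rule measurable_compose[OF _ measurable_extension]) measurable
    have "(\<lambda>q. indicator {0<..} q *\<^sub>R ((indicator {0..} (r * q) *\<^sub>R w (r * q) - indicator {0..} q *\<^sub>R w q) / of_real q)) \<in> borel_measurable borel"
      by measurable
    also have "(\<lambda>q. indicator {0<..} q *\<^sub>R ((indicator {0..} (r * q) *\<^sub>R w (r * q) - indicator {0..} q *\<^sub>R w q) / of_real q))
       = (\<lambda>q. indicator {0<..} q *\<^sub>R ((w (r * q) - w q) / of_real q))"
      using assms by (auto simp: indicator_def)
    finally show "set_borel_measurable lborel {0<..} (\<lambda>q. (w (r * q) - w q) / of_real q)"
      by (simp add: set_borel_measurable_def)
    show "AE q in lborel. q \<in> {0<..} \<longrightarrow> norm ((w (r * q) - w q) / of_real q) 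
        \<le> norm ((K * \<bar>r ^ 3 - 1\<bar>) * ((r * q) ^ 0 / (1 + (r * q) ^ 3)))"
    proof (intro AE_I2 impI)
      fix q :: real assume "q \<in> {0<..}" then have q: "q > 0" by simp
      have "norm (w (r * q) - w q) \<le> K * \<bar>q ^ 3 - (r * q) ^ 3\<bar> / ((1 + (r * q) ^ 3) * (1 + q ^ 3))"
        using diff[of q "r * q"] q assms by simp
      also have "q ^ 3 - (r * q) ^ 3 = q ^ 3 * (1 - r ^ 3)" by (simp add: power_mult_distrib algebra_simps)
      also have "\<bar>q ^ 3 * (1 - r ^ 3)\<bar> = q ^ 3 * \<bar>r ^ 3 - 1\<bar>"
        using q by (simp add: abs_mult)
      also have "K * (q ^ 3 * \<bar>r ^ 3 - 1\<bar>) / ((1 + (r * q) ^ 3) * (1 + q ^ 3)) 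
         = (K * \<bar>r ^ 3 - 1\<bar> / (1 + (r * q) ^ 3)) * (q ^ 3 / (1 + q ^ 3))" by simp
      finally have 1: "norm (w (r * q) - w q) \<le> (K * \<bar>r ^ 3 - 1\<bar> / (1 + (r * q) ^ 3)) * (q ^ 3 / (1 + q ^ 3))" .
      have pos: "1 + (r * q) ^ 3 > 0" "1 + q ^ 3 > 0"
        using q assms by (auto intro!: cube_denominator_pos)
      \<comment> \<open>This factor compensates the division by \<open>q\<close> near 0, while the
        decay at infinity comes from \<open>1 + (r * q) ^ 3\<close>.\<close>
      have "q ^ 3 / (1 + q ^ 3) \<le> q"
      proof -
        have "q\<^sup>2 \<le> 1 + q ^ 3"
        proof (cases "q \<le> 1")
          case True
          then have "q\<^sup>2 \<le> 1" using q by (simp add: power_le_one)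
          moreover have "q ^ 3 > 0" using q by simp
          ultimately show ?thesis by linarith
        next
          case False
          then have "q\<^sup>2 \<le> q ^ 3" by (intro power_increasing) auto
          then show ?thesis by simp
        qed
        then have "q * q\<^sup>2 \<le> q * (1 + q ^ 3)" using q by (intro mult_left_mono) auto
        then show ?thesis using pos by (simp add: divide_le_eq power3_eq_cube power2_eq_square mult.assoc)
      qed
      then have "norm (w (r * q) - w q) \<le> (K * \<bar>r ^ 3 - 1\<bar> / (1 + (r * q) ^ 3)) * q"
        using 1 K_nonneg pos by (meson order_trans mult_left_mono divide_nonneg_pos mult_nonneg_nonneg abs_ge_zero)
      then show "norm ((w (r * q) - w q) / of_real q) 
        \<le> norm ((K * \<bar>r ^ 3 - 1\<bar>) * ((r * q) ^ 0 / (1 + (r * q) ^ 3)))"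
        using q pos K_nonneg by (simp add: norm_divide abs_mult divide_le_eq)
    qed
  qed
  have lim: "(w \<longlongrightarrow> 0) at_top"
  proof (rule Lim_null_comparison)
    show "\<forall>\<^sub>F q in at_top. norm (w q) \<le> K / (1 + q ^ 3)"
      using bound by (auto simp: eventually_at_top_linorder)
    show "((\<lambda>q. K / (1 + q ^ 3)) \<longlongrightarrow> 0) at_top" by real_asymp
  qed
  have "(LINT q:{0<..}|lborel. of_real (q ^ 2) * cube_quotient w q (q * r)) 
    = (LINT q:{0<..}|lborel. of_real (- 1 / (r ^ 3 - 1)) * ((w (r * q) - w q) / of_real q))"
    by (rule set_lebesgue_integral_cong) (use eq in auto)
  also have "\<dots> = of_real (- 1 / (r ^ 3 - 1)) * (LINT q:{0<..}|lborel. (w (r * q) - w q) / of_real q)"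
    by (rule set_integral_mult_right)
  also have "\<dots> = of_real (- 1 / (r ^ 3 - 1)) * (- (of_real (ln r) * w 0))"
    unfolding frullani[OF cont lim assms int] ..
  finally show ?thesis by simp
qed

text \<open>The factor in front does not involve \<open>w\<close>, so one example determines it; the
  same holds for \<open>integral_10_proportional\<close>.\<close>

lemma integral_11_proportional:
  "(LINT q:{0<..}|lborel. of_real q * (LINT p:{0<..}|lborel. of_real p * cube_quotient w q p))
    = (LINT r:{0<..}|lborel. of_real (r * ((1 - 1 / r) / (r ^ 3 - 1)))) * (LINT q:{0<..}|lborel. w q)"
proof -
  have "(LINT q:{0<..}|lborel. of_real q * (LINT p:{0<..}|lborel. of_real p * cube_quotient w q p)) 
    = (LINT r:{0<..}|lborel. of_real r * (LINT q:{0<..}|lborel. of_real (q ^ 3) * cube_quotient w q (q * r)))"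
    using integral_cube_quotient_swap[of 1 1] by (simp add: numeral_3_eq_3)
  also have "\<dots> = (LINT r:{0<..}|lborel. of_real (r * ((1 - 1 / r) / (r ^ 3 - 1))) * (LINT q:{0<..}|lborel. w q))"
    by (rule set_lebesgue_integral_cong, simp) (intro allI impI, simp only: inner_integral_11 greaterThan_iff of_real_mult mult.assoc)
  also have "\<dots> = (LINT r:{0<..}|lborel. of_real (r * ((1 - 1 / r) / (r ^ 3 - 1)))) * (LINT q:{0<..}|lborel. w q)"
    by (rule set_integral_mult_left)
  finally show ?thesis .
qed

lemma integral_10_proportional:
  "(LINT q:{0<..}|lborel. of_real q * (LINT p:{0<..}|lborel. cube_quotient w q p))
    = (LINT r:{0<..}|lborel. of_real (ln r / (r ^ 3 - 1))) * w 0"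
proof -
  have "(LINT q:{0<..}|lborel. of_real q * (LINT p:{0<..}|lborel. cube_quotient w q p)) 
    = (LINT r:{0<..}|lborel. LINT q:{0<..}|lborel. of_real (q ^ 2) * cube_quotient w q (q * r))"
    using integral_cube_quotient_swap[of 1 0] by (simp add: numeral_2_eq_2)
  also have "\<dots> = (LINT r:{0<..}|lborel. of_real (ln r / (r ^ 3 - 1)) * w 0)"
    by (rule set_lebesgue_integral_cong, simp) (intro allI impI, simp only: inner_integral_10 greaterThan_iff power_0 of_real_1 mult_1)
  also have "\<dots> = (LINT r:{0<..}|lborel. of_real (ln r / (r ^ 3 - 1))) * w 0"
    by (rule set_integral_mult_left)
  finally show ?thesis .
qed

end

section \<open>The two universal constants\<close>

abbreviation cube_const :: real where "cube_const \<equiv> 2 * pi / (3 * sqrt 3)"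

text \<open>The instance A = 1 on the complex line, where \<open>(q^3 + A)^(-1)\<close> is
  \<open>1 / (1 + q ^ 3)\<close>.\<close>

lemma scalar_kernel: "cube_kernel (\<lambda>q. of_real (1 / (1 + q ^ 3))) 1"
proof
  have nz: "1 + x ^ 3 \<noteq> (0::real)" if "x \<ge> 0" for x using cube_denominator_pos[OF that] by simp
  show "continuous_on {0..} (\<lambda>q::real. complex_of_real (1 / (1 + q ^ 3)))"
    by (intro continuous_intros) (use nz in auto)
  fix p q :: real
  assume p: "p \<ge> 0" and q: "q \<ge> 0"
  have "1 / (1 + q ^ 3) - 1 / (1 + p ^ 3) = (p ^ 3 - q ^ 3) / ((1 + q ^ 3) * (1 + p ^ 3))"
    using nz[OF p] nz[OF q] by (simp add: field_simps)
  then show "norm (complex_of_real (1 / (1 + q ^ 3)) - of_real (1 / (1 + p ^ 3))) \<le> 1 * \<bar>p ^ 3 - q ^ 3\<bar> / ((1 + q ^ 3) * (1 + p ^ 3))"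
    using p q cube_denominator_pos[OF p] cube_denominator_pos[OF q] 
    by (simp only: of_real_diff[symmetric] norm_of_real) (simp add: abs_mult)
  show "norm (complex_of_real (1 / (1 + q ^ 3))) \<le> 1 / (1 + q ^ 3)"
    using cube_denominator_pos[OF q] by (simp only: norm_of_real) simp
qed

lemma scalar_cube_quotient:
  assumes "p \<ge> 0" "q \<ge> 0" "p \<noteq> q"
  shows "cube_quotient (\<lambda>q. of_real (1 / (1 + q ^ 3))) q p = of_real (1 / (1 + q ^ 3) * (1 / (1 + p ^ 3)))"
proof -
  have "p ^ 3 \<noteq> q ^ 3" using assms by (simp add: power_eq_iff_eq_base)
  moreover have "1 / (1 + q ^ 3) - 1 / (1 + p ^ 3) = (p ^ 3 - q ^ 3) * (1 / (1 + q ^ 3) * (1 / (1 + p ^ 3)))"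
    using cube_denominator_pos[OF assms(1)] cube_denominator_pos[OF assms(2)] by (simp add: field_simps)
  ultimately show ?thesis 
    unfolding cube_quotient_def of_real_diff[symmetric] of_real_divide[symmetric] of_real_eq_iff by simp
qed

lemma scalar_inner_integral:
  fixes j :: nat
  assumes "j \<le> 1" "q > 0"
  shows "(LINT p:{0<..}|lborel. of_real (p ^ j) * cube_quotient (\<lambda>q. of_real (1 / (1 + q ^ 3))) q p)
    = of_real (cube_const * (1 / (1 + q ^ 3)))"
proof -
  interpret cube_kernel "\<lambda>q. of_real (1 / (1 + q ^ 3))" 1 by (rule scalar_kernel)
  have "(LINT p:{0<..}|lborel. of_real (p ^ j) * cube_quotient (\<lambda>q. of_real (1 / (1 + q ^ 3))) q p)
     = (LINT p:{0<..}|lborel. complex_of_real (1 / (1 + q ^ 3) * (p ^ j / (1 + p ^ 3))))"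
    unfolding set_lebesgue_integral_def
  proof (rule integral_cong_AE)
    show "(\<lambda>x. indicat_real {0<..} x *\<^sub>R (of_real (x ^ j) * cube_quotient (\<lambda>q. of_real (1 / (1 + q ^ 3))) q x)) \<in> borel_measurable lborel"
      using cube_quotient_integrable[OF assms(1) less_imp_le[OF assms(2)]] unfolding set_integrable_def by (rule borel_measurable_integrable)
    show "(\<lambda>x. indicat_real {0<..} x *\<^sub>R complex_of_real (1 / (1 + q ^ 3) * (x ^ j / (1 + x ^ 3)))) \<in> borel_measurable lborel"
      by measurable
    \<comment> \<open>On the diagonal \<open>cube_quotient\<close> is 0 instead of the product, but
      a single point is null.\<close>
    have "AE p in lborel. p \<noteq> q" by (rule AE_lborel_singleton)
    then show "AE x in lborel. indicat_real {0<..} x *\<^sub>R (of_real (x ^ j) * cube_quotient (\<lambda>q. of_real (1 / (1 + q ^ 3))) q x) =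
         indicat_real {0<..} x *\<^sub>R complex_of_real (1 / (1 + q ^ 3) * (x ^ j / (1 + x ^ 3)))"
    proof eventually_elim
      case (elim p)
      show ?case
      proof (cases "p > 0")
        case True
        then show ?thesis using scalar_cube_quotient[of p q] elim assms(2) by simp
      qed simp
    qed
  qed
  also have "\<dots> = of_real (cube_const * (1 / (1 + q ^ 3)))"
    unfolding set_integral_complex_of_real set_integral_mult_right integral_cube_denominator(2)[OF assms(1)]
    by (simp only: mult.commute)
  finally show ?thesis .
qed

text \<open>Both constants are read off from the scalar instance \<open>w q = 1 / (1 + q\<^sup>3)\<close>, for which the double
  integrals factor.\<close>

lemma cube_constant_11: "(LINT r:{0<..}|lborel. complex_of_real (r * ((1 - 1 / r) / (r ^ 3 - 1)))) = of_real cube_const"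
  and cube_constant_10: "(LINT r:{0<..}|lborel. complex_of_real (ln r / (r ^ 3 - 1))) = of_real (cube_const ^ 2)"
proof -
  interpret cube_kernel "\<lambda>q. of_real (1 / (1 + q ^ 3))" 1 by (rule scalar_kernel)
  have w: "(LINT q:{0<..}|lborel. complex_of_real (1 / (1 + q ^ 3))) = of_real cube_const"
    using integral_cube_denominator(2)[of 0] by (simp only: set_integral_complex_of_real power_0)
  have *: "(LINT q:{0<..}|lborel. of_real q * (LINT p:{0<..}|lborel. of_real (p ^ j) * cube_quotient (\<lambda>q. of_real (1 / (1 + q ^ 3))) q p))
     = of_real (cube_const * cube_const)" if "j \<le> 1" for j :: nat
  proof -
    have "(LINT q:{0<..}|lborel. of_real q * (LINT p:{0<..}|lborel. of_real (p ^ j) * cube_quotient (\<lambda>q. of_real (1 / (1 + q ^ 3))) q p))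
       = (LINT q:{0<..}|lborel. complex_of_real (cube_const * (q ^ 1 / (1 + q ^ 3))))"
    proof (rule set_lebesgue_integral_cong, simp, intro allI impI)
      fix q :: real assume "q \<in> {0<..}"
      then have "complex_of_real q * (LINT p:{0<..}|lborel. of_real (p ^ j) * cube_quotient (\<lambda>q. of_real (1 / (1 + q ^ 3))) q p)
         = of_real q * of_real (cube_const * (1 / (1 + q ^ 3)))"
        using scalar_inner_integral[OF that, of q] by (simp only: greaterThan_iff)
      then show "complex_of_real q * (LINT p:{0<..}|lborel. of_real (p ^ j) * cube_quotient (\<lambda>q. of_real (1 / (1 + q ^ 3))) q p)
         = of_real (cube_const * (q ^ 1 / (1 + q ^ 3)))"
        by (simp only: of_real_mult[symmetric]) simp
    qed
    then show ?thesis 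
      unfolding set_integral_complex_of_real set_integral_mult_right integral_cube_denominator(2)[OF order_refl] .
  qed
  have pos: "complex_of_real cube_const \<noteq> 0" by simp
  show "(LINT r:{0<..}|lborel. complex_of_real (r * ((1 - 1 / r) / (r ^ 3 - 1)))) = of_real cube_const"
  proof -
    have "of_real (cube_const * cube_const) = (LINT r:{0<..}|lborel. complex_of_real (r * ((1 - 1 / r) / (r ^ 3 - 1)))) * of_real cube_const"
      using integral_11_proportional *[of 1] unfolding w by (simp only: power_one_right)
    then show ?thesis unfolding of_real_mult[of cube_const cube_const] mult_right_cancel[OF pos] by (rule sym)
  qed
  show "(LINT r:{0<..}|lborel. complex_of_real (ln r / (r ^ 3 - 1))) = of_real (cube_const ^ 2)"
    using integral_10_proportional *[of 0] by (simp add: power2_eq_square)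
qed

section \<open>Improper integrals in Banach spaces\<close>

text \<open>The \<open>integral\<close> in \<open>neg_frac_pow\<close> is a gauge integral with
  vector values and is evaluated through primitives. Differentiability is asked on the open half
  line only, which admits weights that are singular at 0.\<close>

lemma has_integral_halfline_antiderivative:
  fixes H f :: "real \<Rightarrow> 'b::banach"
  assumes cont: "continuous_on {0..} H" and H0: "H 0 = 0"
    and der: "\<And>t. t > 0 \<Longrightarrow> (H has_vector_derivative f t) (at t)"
    and lim: "(H \<longlongrightarrow> I) at_top"
  shows "(f has_integral I) {0<..}"
proof -
  let ?g = "\<lambda>x. if x \<in> {0<..} then f x else 0"
  have *: "(?g has_integral H b) {a..b}" if "a \<le> 0" "b > 0" for a b
  proof -
    have f: "(f has_integral H b - H 0) {0..b}"
      by (rule fundamental_theorem_of_calculus_interior) 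
        (use that der in \<open>auto intro: continuous_on_subset[OF cont]\<close>)
    have "(?g has_integral H b) {0..b}"
      by (rule has_integral_spike_finite[of "{0}" _ _ f]) (use f in \<open>auto simp: H0\<close>)
    then have "((\<lambda>x. if x \<in> {0..b} then ?g x else 0) has_integral H b) {a..b}"
      using that by (subst has_integral_restrict) auto
    then show ?thesis by (rule has_integral_eq[rotated]) (use that in auto)
  qed
  show ?thesis
    unfolding has_integral_alt'
  proof safe
    fix a b :: real
    have "?g integrable_on {min a 0..max b 1}"
      by (rule has_integral_integrable[OF *]) auto
    then have "?g integrable_on {a..b}" by (rule integrable_subinterval_real) auto
    then show "?g integrable_on cbox a b" by simp
  next
    fix e :: real assume "e > 0"
    then obtain N where N: "\<And>b. b \<ge> N \<Longrightarrow> norm (H b - I) < e"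
      using lim unfolding tendsto_iff eventually_at_top_linorder dist_norm by metis
    show "\<exists>B>0. \<forall>a b. ball 0 B \<subseteq> cbox a b \<longrightarrow> norm (integral (cbox a b) ?g - I) < e"
    proof (intro exI[of _ "max 1 N"] conjI allI impI)
      fix a b :: real assume sub: "ball 0 (max 1 N) \<subseteq> cbox a b"
      have "{- max 1 N<..<max 1 N} \<subseteq> {a..b}" using sub by (simp add: ball_eq_greaterThanLessThan)
      then have "a \<le> - max 1 N" "max 1 N \<le> b"
        using greaterThanLessThan_subseteq_atLeastAtMost_iff[of "- max 1 N" "max 1 N" a b] by auto
      then have "integral {a..b} ?g = H b" "b \<ge> N" using *[of a b] by (auto intro!: integral_unique)
      then show "norm (integral (cbox a b) ?g - I) < e" using N by simp
    qed simp
  qed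
qed

lemma convergent_at_top_of_decay:
  fixes H :: "real \<Rightarrow> 'b::banach"
  assumes H: "\<And>a b. 1 \<le> a \<Longrightarrow> a \<le> b \<Longrightarrow> norm (H b - H a) \<le> C / a"
  shows "\<exists>I. (H \<longlongrightarrow> I) at_top"
proof -
  have C: "C \<ge> 0" using order_trans[OF norm_ge_zero H[of 1 1]] by simp
  have small: "\<exists>N\<ge>1. \<forall>a\<ge>N. C / a < e" if "e > 0" for e
  proof (intro exI[of _ "max 1 (C / e + 1)"] conjI allI impI)
    fix a assume "a \<ge> max 1 (C / e + 1)"
    then have "a > C / e" "a > 0" by auto
    then show "C / a < e" using that by (simp add: field_simps)
  qed simp
  have "Cauchy (\<lambda>n. H (real n))"
  proof (rule metric_CauchyI)
    fix e :: real assume "e > 0"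
    then obtain N where N: "N \<ge> 1" "\<And>a. a \<ge> N \<Longrightarrow> C / a < e" using small by blast
    have *: "dist (H (real m)) (H (real n)) < e" if "n \<ge> nat \<lceil>N\<rceil>" "n \<le> m" for m n
    proof -
      have "real n \<ge> N" using that by linarith
      then have "norm (H (real m) - H (real n)) \<le> C / real n" using N that by (intro H) auto
      also have "\<dots> < e" using N(2) \<open>real n \<ge> N\<close> by blast
      finally show ?thesis by (simp add: dist_norm)
    qed
    show "\<exists>M. \<forall>m\<ge>M. \<forall>n\<ge>M. dist (H (real m)) (H (real n)) < e"
    proof (intro exI allI impI)
      fix m n assume "m \<ge> nat \<lceil>N\<rceil>" "n \<ge> nat \<lceil>N\<rceil>"
      then show "dist (H (real m)) (H (real n)) < e"
        using *[of n m] *[of m n] by (cases "n \<le> m") (auto simp: dist_commute)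
    qed
  qed
  then obtain I where I: "(\<lambda>n. H (real n)) \<longlonglongrightarrow> I"
    using Cauchy_convergent_iff convergent_def by blast
  have bd: "norm (I - H a) \<le> C / a" if "a \<ge> 1" for a
  proof (rule Lim_norm_ubound)
    show "(\<lambda>n. H (real n) - H a) \<longlonglongrightarrow> I - H a" by (intro tendsto_diff I tendsto_const)
    show "\<forall>\<^sub>F n in sequentially. norm (H (real n) - H a) \<le> C / a"
      using eventually_ge_at_top[of "nat \<lceil>a\<rceil>"] by eventually_elim (use that in \<open>auto intro!: H\<close>, linarith?)
  qed simp
  have "((\<lambda>a. H a) \<longlongrightarrow> I) at_top"
    unfolding tendsto_iff
  proof safe
    fix e :: real assume "e > 0"
    then obtain N where N: "N \<ge> 1" "\<And>a. a \<ge> N \<Longrightarrow> C / a < e" using small by blast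
    show "\<forall>\<^sub>F a in at_top. dist (H a) I < e"
      using eventually_ge_at_top[of N]
    proof eventually_elim
      case (elim a)
      then have "norm (I - H a) < e" using bd[of a] N by force
      then show ?case by (simp add: dist_norm norm_minus_commute)
    qed
  qed
  then show ?thesis by blast
qed

section \<open>Negative fractional powers from the resolvent\<close>

text \<open>\<open>R t\<close> plays the role of \<open>(t + A)^(-1)\<close>; the moments below and
  their composition laws are derived from these properties without mentioning the domain of
  A.\<close>

locale positive_resolvent =
  fixes R :: "real \<Rightarrow> 'a::banach \<Rightarrow> 'a" and M :: real
  assumes bl: "\<And>t. t \<ge> 0 \<Longrightarrow> bounded_linear (R t)"
    and decay: "\<And>t x. t \<ge> 0 \<Longrightarrow> norm (R t x) \<le> M / (1 + t) * norm x"
    and resolvent_identity: "\<And>s t x. s \<ge> 0 \<Longrightarrow> t \<ge> 0 \<Longrightarrow> R s x - R t x = (t - s) *\<^sub>R R s (R t x)"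
    and M_nonneg: "M \<ge> 0"
begin

text \<open>Testing with functionals reduces the vector-valued double integrals to scalar ones, to
  which Fubini's theorem for the Lebesgue integral applies.\<close>

lemma cube_kernel_functional:
  assumes \<phi>: "bounded_linear (\<phi> :: 'a \<Rightarrow> complex)"
  shows "\<exists>K. cube_kernel (\<lambda>q. \<phi> (R (q ^ 3) x)) K"
proof -
  interpret \<phi>: bounded_linear \<phi> by fact
  obtain B where B: "B \<ge> 0" "\<And>z. norm (\<phi> z) \<le> B * norm z"
    using \<phi>.nonneg_bounded by (auto simp: mult.commute)
  \<comment> \<open>\<open>M * M\<close> bounds a product of two resolvents, as in
    \<open>diff\<close>, and \<open>M\<close> a single one, as in \<open>bound\<close>.\<close>
  define K where "K = B * (M * M + M) * norm x"
  have K: "K \<ge> 0" using B M_nonneg by (simp add: K_def)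
  have diff: "norm (\<phi> (R (q ^ 3) x) - \<phi> (R (p ^ 3) x)) \<le> K * \<bar>p ^ 3 - q ^ 3\<bar> / ((1 + q ^ 3) * (1 + p ^ 3))" if "p \<ge> 0" "q \<ge> 0" for p q
  proof -
    have pos: "1 + q ^ 3 > 0" "1 + p ^ 3 > 0" using that by (auto intro: cube_denominator_pos)
    have "\<phi> (R (q ^ 3) x) - \<phi> (R (p ^ 3) x) = (p ^ 3 - q ^ 3) *\<^sub>R \<phi> (R (q ^ 3) (R (p ^ 3) x))"
      unfolding \<phi>.diff[symmetric] using that by (subst resolvent_identity) (auto simp: \<phi>.scaleR)
    then have eq: "norm (\<phi> (R (q ^ 3) x) - \<phi> (R (p ^ 3) x)) = \<bar>p ^ 3 - q ^ 3\<bar> * norm (\<phi> (R (q ^ 3) (R (p ^ 3) x)))"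
      by simp
    have "norm (\<phi> (R (q ^ 3) (R (p ^ 3) x))) \<le> B * (M / (1 + q ^ 3) * (M / (1 + p ^ 3) * norm x))"
      using that B M_nonneg pos decay[of "p ^ 3" x] decay[of "q ^ 3" "R (p ^ 3) x"]
      by (meson order_trans mult_left_mono divide_nonneg_pos zero_le_power)
    also have "B * (M / (1 + q ^ 3) * (M / (1 + p ^ 3) * norm x)) = (B * (M * M) * norm x) / ((1 + q ^ 3) * (1 + p ^ 3))"
      by simp
    also have "\<dots> \<le> K / ((1 + q ^ 3) * (1 + p ^ 3))"
      using pos B M_nonneg by (intro divide_right_mono mult_nonneg_nonneg) (auto simp: K_def intro!: mult_right_mono mult_left_mono)
    finally have "\<bar>p ^ 3 - q ^ 3\<bar> * norm (\<phi> (R (q ^ 3) (R (p ^ 3) x))) \<le> \<bar>p ^ 3 - q ^ 3\<bar> * (K / ((1 + q ^ 3) * (1 + p ^ 3)))"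
      by (intro mult_left_mono) auto
    then show ?thesis unfolding eq by (simp add: mult.commute)
  qed
  have "cube_kernel (\<lambda>q. \<phi> (R (q ^ 3) x)) K"
  proof
    show "norm (\<phi> (R (q ^ 3) x)) \<le> K / (1 + q ^ 3)" if "q \<ge> 0" for q
    proof -
      have pos: "1 + q ^ 3 > 0" using that by (rule cube_denominator_pos)
      have "norm (\<phi> (R (q ^ 3) x)) \<le> B * (M / (1 + q ^ 3) * norm x)"
        using B decay[of "q ^ 3" x] that by (meson order_trans mult_left_mono zero_le_power)
      also have "\<dots> = (B * M * norm x) / (1 + q ^ 3)" by simp
      also have "\<dots> \<le> K / (1 + q ^ 3)"
        using pos B M_nonneg by (intro divide_right_mono) (auto simp: K_def algebra_simps)
      finally show ?thesis .
    qed
    show "continuous_on {0..} (\<lambda>q. \<phi> (R (q ^ 3) x))"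
      unfolding continuous_on
    proof
      fix q :: real assume q: "q \<in> {0..}"
      have "((\<lambda>p. \<phi> (R (p ^ 3) x) - \<phi> (R (q ^ 3) x)) \<longlongrightarrow> 0) (at q within {0..})"
      proof (rule Lim_null_comparison)
        show "\<forall>\<^sub>F p in at q within {0..}. norm (\<phi> (R (p ^ 3) x) - \<phi> (R (q ^ 3) x)) \<le> K * \<bar>q ^ 3 - p ^ 3\<bar>"
        proof (rule eventually_mono)
          show "\<forall>\<^sub>F p in at q within {0..}. p \<ge> 0" by (simp add: eventually_at_filter)
          fix p :: real assume p: "p \<ge> 0"
          have "(1 + p ^ 3) * (1 + q ^ 3) \<ge> 1 * 1" using p q by (intro mult_mono) auto
          then have "K * \<bar>q ^ 3 - p ^ 3\<bar> / ((1 + p ^ 3) * (1 + q ^ 3)) \<le> K * \<bar>q ^ 3 - p ^ 3\<bar> / 1"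
            using K by (intro divide_left_mono) auto
          then show "norm (\<phi> (R (p ^ 3) x) - \<phi> (R (q ^ 3) x)) \<le> K * \<bar>q ^ 3 - p ^ 3\<bar>"
            using diff[of q p] p q by simp
        qed
        have "((\<lambda>p. K * \<bar>q ^ 3 - p ^ 3\<bar>) \<longlongrightarrow> K * \<bar>q ^ 3 - q ^ 3\<bar>) (at q within {0..})"
          by (intro tendsto_intros)
        then show "((\<lambda>p. K * \<bar>q ^ 3 - p ^ 3\<bar>) \<longlongrightarrow> 0) (at q within {0..})" by simp
      qed
      then show "((\<lambda>q. \<phi> (R (q ^ 3) x)) \<longlongrightarrow> \<phi> (R (q ^ 3) x)) (at q within {0..})"
        by (simp add: LIM_zero_iff)
    qed
  qed (use diff in auto)
  then show ?thesis ..
qed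

lemma continuous_on_R: "continuous_on {0..} (\<lambda>t. R t x)"
  unfolding continuous_on
proof
  fix s :: real assume s: "s \<in> {0..}"
  have "((\<lambda>t. R t x - R s x) \<longlongrightarrow> 0) (at s within {0..})"
  proof (rule Lim_null_comparison)
    show "\<forall>\<^sub>F t in at s within {0..}. norm (R t x - R s x) \<le> \<bar>s - t\<bar> * (M * norm (R s x))"
    proof (rule eventually_mono)
      show "\<forall>\<^sub>F t in at s within {0..}. t \<ge> 0" by (simp add: eventually_at_filter)
      fix t :: real assume t: "t \<ge> 0"
      have "norm (R t (R s x)) \<le> M / (1 + t) * norm (R s x)" by (rule decay[OF t])
      also have "\<dots> \<le> M * norm (R s x)" using t M_nonneg by (intro mult_right_mono) (auto simp: divide_le_eq mult_le_cancel_left1)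
      finally show "norm (R t x - R s x) \<le> \<bar>s - t\<bar> * (M * norm (R s x))"
        using resolvent_identity[of t s x] s t by (simp add: mult_left_mono)
    qed
    have "((\<lambda>t. \<bar>s - t\<bar> * (M * norm (R s x))) \<longlongrightarrow> \<bar>s - s\<bar> * (M * norm (R s x))) (at s within {0..})"
      by (intro tendsto_intros)
    then show "((\<lambda>t. \<bar>s - t\<bar> * (M * norm (R s x))) \<longlongrightarrow> 0) (at s within {0..})" by simp
  qed
  then show "((\<lambda>t. R t x) \<longlongrightarrow> R s x) (at s within {0..})" by (simp add: LIM_zero_iff)
qed

text \<open>Under \<open>t = q^3\<close> the weight \<open>t powr (- \<alpha>)\<close> of the
  Balakrishnan integral becomes \<open>3 * q ^ j\<close>: \<open>j = 0\<close> belongs to \<alpha> =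
  2/3 and \<open>j = 1\<close> to \<alpha> = 1/3.\<close>

definition partial_moment :: "nat \<Rightarrow> 'a \<Rightarrow> real \<Rightarrow> 'a" where
  "partial_moment j x Q = integral {0..Q} (\<lambda>q. q ^ j *\<^sub>R R (q ^ 3) x)"

definition moment :: "nat \<Rightarrow> 'a \<Rightarrow> 'a" where
  "moment j x = Lim at_top (partial_moment j x)"

lemma continuous_on_integrand: "continuous_on {0..} (\<lambda>q. q ^ j *\<^sub>R R (q ^ 3) x)"
  by (intro continuous_intros continuous_on_compose2[OF continuous_on_R]) auto

lemma partial_moment_deriv:
  assumes "q > 0"
  shows "(partial_moment j x has_vector_derivative q ^ j *\<^sub>R R (q ^ 3) x) (at q)"
proof -
  have "((\<lambda>u. integral {0..u} (\<lambda>q. q ^ j *\<^sub>R R (q ^ 3) x)) has_vector_derivative q ^ j *\<^sub>R R (q ^ 3) x) (at q within {0..q+1})"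
    using assms by (intro integral_has_vector_derivative continuous_on_subset[OF continuous_on_integrand]) auto
  then show ?thesis
    using assms by (simp add: partial_moment_def[abs_def] at_within_Icc_at)
qed

lemma partial_moment_cont: "continuous_on {0..} (partial_moment j x)"
proof -
  have "continuous_on {0..b} (partial_moment j x)" for b
    unfolding partial_moment_def[abs_def]
    by (intro indefinite_integral_continuous_1 integrable_continuous_interval 
        continuous_on_subset[OF continuous_on_integrand]) auto
  show ?thesis
    unfolding continuous_on_eq_continuous_within
  proof
    fix q :: real assume q: "q \<in> {0..}"
    have "continuous (at q within {0..q+1}) (partial_moment j x)"
      using \<open>continuous_on {0..q+1} (partial_moment j x)\<close> q by (simp add: continuous_on_eq_continuous_within)
    moreover have "at q within {0..q+1} = at q within {0..}"
      by (rule at_within_nhd[of _ "{..<q+1}"]) auto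
    ultimately show "continuous (at q within {0..}) (partial_moment j x)"
      by (simp add: continuous_within)
  qed
qed

lemma partial_moment_diff:
  assumes "j \<le> 1" and ab: "1 \<le> a" "a \<le> b"
  shows "norm (partial_moment j x b - partial_moment j x a) \<le> M * norm x / a"
proof -
  let ?C = "M * norm x"
  have C: "?C \<ge> 0" using M_nonneg by simp
  have "norm (partial_moment j x b - partial_moment j x a) \<le> - (?C / b) - - (?C / a)" if "a < b"
  \<comment> \<open>For \<open>q \<ge> 1\<close> and \<open>j \<le> 1\<close> the integrand has norm
    at most \<open>M * norm x / q\<^sup>2\<close>; it is compared with the primitive of this
    bound.\<close>
  proof (rule differentiable_bound_general[OF that, where f' = "\<lambda>q. q ^ j *\<^sub>R R (q ^ 3) x" and \<phi>' = "\<lambda>q. ?C / q ^ 2"])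
    show "continuous_on {a..b} (partial_moment j x)"
      by (rule continuous_on_subset[OF partial_moment_cont]) (use ab in auto)
    show "continuous_on {a..b} (\<lambda>q. - (?C / q))" by (intro continuous_intros) (use ab in auto)
    fix q assume q: "a < q" "q < b"
    show "(partial_moment j x has_vector_derivative q ^ j *\<^sub>R R (q ^ 3) x) (at q)"
      using ab q by (intro partial_moment_deriv) auto
    show "((\<lambda>q. - (?C / q)) has_vector_derivative ?C / q ^ 2) (at q)"
      unfolding has_real_derivative_iff_has_vector_derivative[symmetric]
      using ab q by (auto intro!: derivative_eq_intros simp: power2_eq_square)
    have "q ^ j \<le> q ^ 1" using assms ab q by (intro power_increasing) auto
    have "norm (R (q ^ 3) x) \<le> M / (1 + q ^ 3) * norm x" using ab q by (intro decay) auto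
    also have "\<dots> \<le> M / q ^ 3 * norm x"
      using ab q M_nonneg by (intro mult_right_mono divide_left_mono mult_pos_pos add_pos_pos) auto
    finally have "q ^ j * norm (R (q ^ 3) x) \<le> q ^ 1 * (M / q ^ 3 * norm x)"
      using \<open>q ^ j \<le> q ^ 1\<close> ab q by (intro mult_mono) auto
    then show "norm (q ^ j *\<^sub>R R (q ^ 3) x) \<le> ?C / q ^ 2"
      using ab q by (simp add: power2_eq_square power3_eq_cube)
  qed
  then show ?thesis
    using ab C by (cases "a < b") (auto intro: order_trans)
qed

lemma partial_moment_tendsto:
  assumes "j \<le> 1"
  shows "(partial_moment j x \<longlongrightarrow> moment j x) at_top"
proof -
  have "\<exists>I. (partial_moment j x \<longlongrightarrow> I) at_top"
    using partial_moment_diff[OF assms] by (rule convergent_at_top_of_decay)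
  then show ?thesis unfolding moment_def by (metis tendsto_Lim trivial_limit_at_top_linorder)
qed

text \<open>The substitution is performed on primitives: \<open>partial_moment j x\<close> is
  composed with \<open>t powr (1/3)\<close>, and the chain rule produces the fractional
  weight.\<close>

lemma moment_has_integral:
  assumes "j \<le> 1"
  shows "((\<lambda>t. t powr (- (2 - real j) / 3) *\<^sub>R R t x) has_integral 3 *\<^sub>R moment j x) {0<..}"
proof (rule has_integral_halfline_antiderivative)
  let ?H = "\<lambda>t. 3 *\<^sub>R partial_moment j x (t powr (1/3))"
  show "continuous_on {0..} ?H"
    by (intro continuous_intros continuous_on_compose2[OF partial_moment_cont] continuous_on_powr') auto
  show "?H 0 = 0" by (simp add: partial_moment_def)
  show "(?H \<longlongrightarrow> 3 *\<^sub>R moment j x) at_top"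
    by (intro tendsto_intros filterlim_compose[OF partial_moment_tendsto[OF assms]]) real_asymp
  fix t :: real assume t: "t > 0"
  have d: "((\<lambda>t. t powr (1/3)) has_vector_derivative (1/3) * t powr (1/3 - 1)) (at t)"
    unfolding has_real_derivative_iff_has_vector_derivative[symmetric]
    using t by (auto intro!: derivative_eq_intros)
  have c: "(t powr (1/3)) ^ 3 = t" using t by (simp add: powr_power)
  have "((partial_moment j x \<circ> (\<lambda>t. t powr (1/3))) has_vector_derivative 
      ((1/3) * t powr (1/3 - 1)) *\<^sub>R ((t powr (1/3)) ^ j *\<^sub>R R ((t powr (1/3)) ^ 3) x)) (at t)"
    using t by (intro vector_diff_chain_at d partial_moment_deriv) auto
  then have "(?H has_vector_derivative 3 *\<^sub>R (((1/3) * t powr (1/3 - 1)) *\<^sub>R ((t powr (1/3)) ^ j *\<^sub>R R ((t powr (1/3)) ^ 3) x))) (at t)"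
    unfolding o_def by (intro has_vector_derivative_scaleR[OF DERIV_const, simplified])
  moreover have "3 *\<^sub>R (((1/3) * t powr (1/3 - 1)) *\<^sub>R ((t powr (1/3)) ^ j *\<^sub>R R ((t powr (1/3)) ^ 3) x)) 
     = t powr (- (2 - real j) / 3) *\<^sub>R R t x"
  proof -
    have "t powr (1/3 - 1) * (t powr (1/3)) ^ j = t powr (1/3 - 1 + real j * (1/3))"
      using t by (simp add: powr_power powr_add[symmetric])
    also have "1/3 - 1 + real j * (1/3) = - (2 - real j) / 3" by (simp add: field_simps)
    finally show ?thesis unfolding c by simp
  qed
  ultimately show "(?H has_vector_derivative t powr (- (2 - real j) / 3) *\<^sub>R R t x) (at t)" by simp
qed

lemma functional_moment_has_integral:
  assumes "j \<le> 1" and \<phi>: "bounded_linear (\<phi> :: 'a \<Rightarrow> complex)"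
  shows "((\<lambda>q. of_real (q ^ j) * \<phi> (R (q ^ 3) x)) has_integral \<phi> (moment j x)) {0<..}"
proof (rule has_integral_halfline_antiderivative)
  interpret \<phi>: bounded_linear \<phi> by fact
  let ?H = "\<lambda>q. \<phi> (partial_moment j x q)"
  show "continuous_on {0..} ?H"
    by (rule continuous_on_compose2[OF linear_continuous_on[OF \<phi>, of UNIV] partial_moment_cont]) auto
  show "?H 0 = 0" by (simp add: partial_moment_def \<phi>.zero)
  show "(?H \<longlongrightarrow> \<phi> (moment j x)) at_top"
    by (intro \<phi>.tendsto partial_moment_tendsto assms)
  fix q :: real assume q: "q > 0"
  have "(?H has_vector_derivative \<phi> (q ^ j *\<^sub>R R (q ^ 3) x)) (at q)"
    using \<phi>.has_vector_derivative[OF partial_moment_deriv[OF q]] .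
  then show "(?H has_vector_derivative of_real (q ^ j) * \<phi> (R (q ^ 3) x)) (at q)"
    by (simp add: \<phi>.scaleR scaleR_conv_of_real)
qed

lemma functional_moment_eq_set_integral:
  assumes "j \<le> 1" and \<phi>: "bounded_linear (\<phi> :: 'a \<Rightarrow> complex)"
  shows "\<phi> (moment j x) = (LINT q:{0<..}|lborel. of_real (q ^ j) * \<phi> (R (q ^ 3) x))"
proof -
  obtain K where "cube_kernel (\<lambda>q. \<phi> (R (q ^ 3) x)) K" using cube_kernel_functional[OF \<phi>] by blast
  then interpret cube_kernel "\<lambda>q. \<phi> (R (q ^ 3) x)" K .
  show ?thesis
    unfolding set_borel_integral_eq_integral(2)[OF power_w_integrable[OF assms(1)]]
    by (rule integral_unique[OF functional_moment_has_integral[OF assms], symmetric])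
qed

text \<open>\<open>\<phi>\<close> composed with \<open>R (q ^ 3)\<close> is again a bounded
  functional, so the moment formula applies to it; the resolvent identity then rewrites the
  integrand except at the point \<open>p = q\<close>.\<close>

lemma functional_R_moment:
  assumes j: "j \<le> 1" and \<phi>: "bounded_linear (\<phi> :: 'a \<Rightarrow> complex)" and q: "q \<ge> 0"
  shows "\<phi> (R (q ^ 3) (moment j x)) = (LINT p:{0<..}|lborel. of_real (p ^ j) * cube_quotient (\<lambda>q. \<phi> (R (q ^ 3) x)) q p)"
proof -
  interpret \<phi>: bounded_linear \<phi> by fact
  obtain K where "cube_kernel (\<lambda>q. \<phi> (R (q ^ 3) x)) K" using cube_kernel_functional[OF \<phi>] by blast
  then interpret cube_kernel "\<lambda>q. \<phi> (R (q ^ 3) x)" K .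
  have bl': "bounded_linear (\<lambda>z. \<phi> (R (q ^ 3) z))"
    using q by (intro bounded_linear_compose[OF \<phi> bl]) auto
  have "((\<lambda>p. of_real (p ^ j) * cube_quotient (\<lambda>q. \<phi> (R (q ^ 3) x)) q p) has_integral \<phi> (R (q ^ 3) (moment j x))) {0<..}"
  proof (rule has_integral_spike_finite[OF _ _ functional_moment_has_integral[OF j bl']])
    fix p assume p: "p \<in> {0<..} - {q}"
    have "p ^ 3 \<noteq> q ^ 3" using p q by (simp add: power_eq_iff_eq_base)
    moreover have "R (q ^ 3) x - R (p ^ 3) x = (p ^ 3 - q ^ 3) *\<^sub>R R (q ^ 3) (R (p ^ 3) x)"
      using p q by (intro resolvent_identity) auto
    ultimately have "cube_quotient (\<lambda>q. \<phi> (R (q ^ 3) x)) q p = \<phi> (R (q ^ 3) (R (p ^ 3) x))"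
      unfolding cube_quotient_def \<phi>.diff[symmetric] by (simp add: \<phi>.scaleR scaleR_conv_of_real del: of_real_diff of_real_power)
    then show "of_real (p ^ j) * cube_quotient (\<lambda>q. \<phi> (R (q ^ 3) x)) q p = of_real (p ^ j) * \<phi> (R (q ^ 3) (R (p ^ 3) x))"
      by simp
  qed simp
  then show ?thesis
    unfolding set_borel_integral_eq_integral(2)[OF cube_quotient_integrable[OF j q]] by (rule integral_unique[symmetric])
qed

text \<open>The law A^(-1/3) A^(-1/3) = A^(-2/3) in weak form: the double integral is proportional
  to the integral of the kernel, which is the zeroth moment.\<close>

lemma functional_moment_1_1:
  assumes \<phi>: "bounded_linear (\<phi> :: 'a \<Rightarrow> complex)"
  shows "\<phi> (moment 1 (moment 1 x)) = of_real cube_const * \<phi> (moment 0 x)"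
proof -
  obtain K where "cube_kernel (\<lambda>q. \<phi> (R (q ^ 3) x)) K" using cube_kernel_functional[OF \<phi>] by blast
  then interpret cube_kernel "\<lambda>q. \<phi> (R (q ^ 3) x)" K .
  have "\<phi> (moment 1 (moment 1 x)) = (LINT q:{0<..}|lborel. of_real (q ^ 1) * \<phi> (R (q ^ 3) (moment 1 x)))"
    by (rule functional_moment_eq_set_integral[OF order_refl \<phi>])
  also have "\<dots> = (LINT q:{0<..}|lborel. of_real q * (LINT p:{0<..}|lborel. of_real p * cube_quotient (\<lambda>q. \<phi> (R (q ^ 3) x)) q p))"
    by (rule set_lebesgue_integral_cong) (use functional_R_moment[OF order_refl \<phi>] in auto)
  also have "\<dots> = of_real cube_const * (LINT q:{0<..}|lborel. \<phi> (R (q ^ 3) x))"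
    unfolding integral_11_proportional cube_constant_11 ..
  also have "(LINT q:{0<..}|lborel. \<phi> (R (q ^ 3) x)) = \<phi> (moment 0 x)"
    using functional_moment_eq_set_integral[OF _ \<phi>, of 0] by simp
  finally show ?thesis .
qed

text \<open>The law A^(-1/3) A^(-2/3) = A^(-1) in weak form: here the double integral is
  proportional to the value of the kernel at \<open>q = 0\<close>, where the resolvent is the
  inverse of A.\<close>

lemma functional_moment_1_0:
  assumes \<phi>: "bounded_linear (\<phi> :: 'a \<Rightarrow> complex)"
  shows "\<phi> (moment 1 (moment 0 x)) = of_real (cube_const ^ 2) * \<phi> (R 0 x)"
proof -
  obtain K where "cube_kernel (\<lambda>q. \<phi> (R (q ^ 3) x)) K" using cube_kernel_functional[OF \<phi>] by blast
  then interpret cube_kernel "\<lambda>q. \<phi> (R (q ^ 3) x)" K .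
  have "\<phi> (moment 1 (moment 0 x)) = (LINT q:{0<..}|lborel. of_real (q ^ 1) * \<phi> (R (q ^ 3) (moment 0 x)))"
    by (rule functional_moment_eq_set_integral[OF order_refl \<phi>])
  also have "\<dots> = (LINT q:{0<..}|lborel. of_real q * (LINT p:{0<..}|lborel. cube_quotient (\<lambda>q. \<phi> (R (q ^ 3) x)) q p))"
    by (rule set_lebesgue_integral_cong) (use functional_R_moment[OF _ \<phi>, of 0] in auto)
  also have "\<dots> = of_real (cube_const ^ 2) * \<phi> (R 0 x)"
    unfolding integral_10_proportional cube_constant_10 by simp
  finally show ?thesis .
qed

lemma moment_bounded_linear:
  assumes "j \<le> 1"
  shows "bounded_linear (moment j)"
proof -
  note lim = partial_moment_tendsto[OF assms]
  have int: "(\<lambda>q. q ^ j *\<^sub>R R (q ^ 3) x) integrable_on {0..Q}" for x Q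
    by (intro integrable_continuous_interval continuous_on_subset[OF continuous_on_integrand]) auto
  have R_lin: "R (q ^ 3) (x + y) = R (q ^ 3) x + R (q ^ 3) y" "R (q ^ 3) (r *\<^sub>R x) = r *\<^sub>R R (q ^ 3) x" if "q \<ge> 0" for q r x y
  proof -
    interpret bounded_linear "R (q ^ 3)" using that by (intro bl) auto
    show "R (q ^ 3) (x + y) = R (q ^ 3) x + R (q ^ 3) y" "R (q ^ 3) (r *\<^sub>R x) = r *\<^sub>R R (q ^ 3) x"
      by (simp_all add: add scale)
  qed
  have add: "partial_moment j (x + y) Q = partial_moment j x Q + partial_moment j y Q" for x y Q
    unfolding partial_moment_def integral_add[OF int int, symmetric]
    by (intro integral_cong) (simp add: R_lin scaleR_add_right)
  have scale: "partial_moment j (r *\<^sub>R x) Q = r *\<^sub>R partial_moment j x Q" for r x Q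
    unfolding partial_moment_def integral_cmul[symmetric]
    by (intro integral_cong) (simp add: R_lin)
  have bound1: "norm (partial_moment j x 1) \<le> M * norm x" for x
  proof -
    have "norm (partial_moment j x 1) \<le> (M * norm x) * (1 - 0)"
      unfolding partial_moment_def
    proof (rule integral_bound)
      show "continuous_on {0..1} (\<lambda>q. q ^ j *\<^sub>R R (q ^ 3) x)"
        by (rule continuous_on_subset[OF continuous_on_integrand]) auto
      fix q :: real assume q: "q \<in> {0..1}"
      have "norm (R (q ^ 3) x) \<le> M / (1 + q ^ 3) * norm x" using q by (intro decay) auto
      also have "\<dots> \<le> M * norm x" using q M_nonneg cube_denominator_pos[of q]
        by (intro mult_right_mono) (auto simp: divide_le_eq mult_le_cancel_left1)
      finally have "norm (R (q ^ 3) x) \<le> M * norm x" .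
      moreover have "q ^ j \<le> 1" using q by (intro power_le_one) auto
      ultimately have "q ^ j * norm (R (q ^ 3) x) \<le> 1 * (M * norm x)"
        using q by (intro mult_mono) auto
      then show "norm (q ^ j *\<^sub>R R (q ^ 3) x) \<le> M * norm x" using q by simp
    qed simp
    then show ?thesis by simp
  qed
  show ?thesis
  proof (rule bounded_linear_intro)
    show "moment j (x + y) = moment j x + moment j y" for x y
    proof (rule tendsto_unique[OF _ lim])
      show "(partial_moment j (x + y) \<longlongrightarrow> moment j x + moment j y) at_top"
        unfolding add[abs_def] using tendsto_add[OF lim lim] by (simp add: add[abs_def])
    qed simp
    show "moment j (r *\<^sub>R x) = r *\<^sub>R moment j x" for r x
    proof (rule tendsto_unique[OF _ lim])
      show "(partial_moment j (r *\<^sub>R x) \<longlongrightarrow> r *\<^sub>R moment j x) at_top"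
        using tendsto_scaleR[OF tendsto_const lim] by (simp add: scale[abs_def])
    qed simp
    show "norm (moment j x) \<le> norm x * (2 * M)" for x
    proof -
      \<comment> \<open>The tail beyond 1 contributes \<open>M * norm x\<close>, and
        \<open>bound1\<close> the same for \<open>{0..1}\<close>; hence
        \<open>2 * M\<close>.\<close>
      have "norm (moment j x - partial_moment j x 1) \<le> M * norm x / 1"
      proof (rule Lim_norm_ubound)
        show "((\<lambda>Q. partial_moment j x Q - partial_moment j x 1) \<longlongrightarrow> moment j x - partial_moment j x 1) at_top"
          by (intro tendsto_diff lim tendsto_const)
        show "\<forall>\<^sub>F Q in at_top. norm (partial_moment j x Q - partial_moment j x 1) \<le> M * norm x / 1"
          using eventually_ge_at_top[of 1] by eventually_elim (use partial_moment_diff[OF assms, of 1] in auto)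
      qed simp
      then show ?thesis
        using bound1[of x] norm_triangle_sub[of "moment j x" "partial_moment j x 1"] by (simp add: algebra_simps)
    qed
  qed
qed

end

section \<open>Sectorial operators on a complex Hilbert space\<close>

locale complex_hilbert_space =
  fixes sc :: "complex \<Rightarrow> 'a::banach \<Rightarrow> 'a" and ip :: "'a \<Rightarrow> 'a \<Rightarrow> complex"
  assumes hilbert: "complex_hilbert sc ip"
begin

lemma sc_one [simp]: "sc 1 x = x"
  and sc_sc [simp]: "sc a (sc b x) = sc (a * b) x"
  and sc_add_right: "sc a (x + y) = sc a x + sc a y"
  and sc_add_left: "sc (a + b) x = sc a x + sc b x"
  and sc_of_real [simp]: "sc (complex_of_real r) x = r *\<^sub>R x"
  and ip_sc_add: "ip (sc a x + y) z = a * ip x z + ip y z"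
  and ip_commute: "ip y x = cnj (ip x y)"
  and norm_ip: "(norm x)\<^sup>2 = Re (ip x x)"
  using hilbert unfolding complex_hilbert_def by blast+

lemma sc_zero_left [simp]: "sc 0 x = 0"
  using sc_of_real[of 0 x] by simp

lemma sc_zero_right [simp]: "sc a 0 = 0"
  using sc_add_right[of a 0 0] by simp

lemma sc_minus_right: "sc a (- x) = - sc a x"
  using sc_add_right[of a x "- x"] by (simp add: eq_neg_iff_add_eq_0 add.commute)

lemma sc_minus_left: "sc (- a) x = - sc a x"
  using sc_add_left[of a "- a" x] by (simp add: eq_neg_iff_add_eq_0 add.commute)

lemma sc_diff_right: "sc a (x - y) = sc a x - sc a y"
  using sc_add_right[of a x "- y"] by (simp add: sc_minus_right)

lemma sc_diff_left: "sc (a - b) x = sc a x - sc b x"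
  using sc_add_left[of a "- b" x] by (simp add: sc_minus_left)

lemma sc_scaleR: "sc a (r *\<^sub>R x) = r *\<^sub>R sc a x"
  by (metis sc_of_real sc_sc mult.commute)

lemma ip_add_left: "ip (x + y) z = ip x z + ip y z"
  using ip_sc_add[of 1 x y z] by simp

lemma ip_zero_left [simp]: "ip 0 z = 0"
  using ip_add_left[of 0 0 z] by simp

lemma ip_sc_left: "ip (sc a x) z = a * ip x z"
  using ip_sc_add[of a x 0 z] by simp

lemma ip_diff_left: "ip (x - y) z = ip x z - ip y z"
  using ip_add_left[of "x - y" y z] by simp

lemma ip_sc_right: "ip x (sc a y) = cnj a * ip x y"
  by (metis ip_commute ip_sc_left complex_cnj_mult)

lemma ip_diff_right: "ip x (y - z) = ip x y - ip x z"
  by (metis ip_commute ip_diff_left complex_cnj_diff)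

lemma ip_self: "ip x x = of_real ((norm x)\<^sup>2)"
  using ip_commute[of x x] norm_ip[of x] by (simp add: complex_eq_iff)

lemma norm_sc: "norm (sc a x) = cmod a * norm x"
proof -
  have "(norm (sc a x))\<^sup>2 = Re (a * cnj a * ip x x)"
    by (simp add: norm_ip ip_sc_left ip_sc_right mult_ac)
  also have "\<dots> = (cmod a * norm x)\<^sup>2"
    unfolding ip_self complex_norm_square[symmetric] of_real_mult[symmetric] Re_complex_of_real
    by (simp add: power_mult_distrib)
  finally show ?thesis by (simp add: power2_eq_iff_nonneg)
qed

lemma Cauchy_Schwarz: "cmod (ip x y) \<le> norm x * norm y"
proof (cases "y = 0")
  case True
  then show ?thesis using ip_commute[of x 0] by simp
next
  case False
  then have n: "(norm y)\<^sup>2 > 0" by simp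
  define c where "c = ip x y / of_real ((norm y)\<^sup>2)"
  have "ip (x - sc c y) (x - sc c y) = ip x x - cnj c * ip x y - c * cnj (ip x y) + c * cnj c * of_real ((norm y)\<^sup>2)"
    by (simp add: ip_diff_left ip_diff_right ip_sc_left ip_sc_right ip_commute[of y x] ip_self[of y] algebra_simps)
  also have "\<dots> = of_real ((norm x)\<^sup>2 - (cmod (ip x y))\<^sup>2 / (norm y)\<^sup>2)"
  proof -
    have "u - cnj (i / v) * i - i / v * cnj i + i / v * cnj (i / v) * v = u - i * cnj i / v" if "v \<noteq> 0" "cnj v = v" for u v i
      using that by (simp add: field_simps)
    from this[of "of_real ((norm y)\<^sup>2)" "ip x x" "ip x y"] show ?thesis 
      using n unfolding c_def by (simp add: ip_self[of x] complex_norm_square[symmetric])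
  qed
  finally have "(norm (x - sc c y))\<^sup>2 = (norm x)\<^sup>2 - (cmod (ip x y))\<^sup>2 / (norm y)\<^sup>2"
    unfolding ip_self of_real_eq_iff .
  then have "(cmod (ip x y))\<^sup>2 / (norm y)\<^sup>2 \<le> (norm x)\<^sup>2"
    using zero_le_power2[of "norm (x - sc c y)"] by linarith
  then have "(cmod (ip x y))\<^sup>2 \<le> (norm x * norm y)\<^sup>2"
    using n by (simp add: pos_divide_le_eq power_mult_distrib)
  then show ?thesis by (rule power2_le_imp_le) simp
qed

lemma bounded_linear_ip: "bounded_linear (\<lambda>x. ip x y)"
proof (rule bounded_linear_intro)
  show "ip (x + x') y = ip x y + ip x' y" for x x' by (rule ip_add_left)
  show "ip (r *\<^sub>R x) y = r *\<^sub>R ip x y" for r x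
    using ip_sc_left[of "of_real r" x y] by (simp add: scaleR_conv_of_real)
  show "norm (ip x y) \<le> norm x * norm y" for x by (rule Cauchy_Schwarz)
qed

lemma norm_le_of_ip_le:
  assumes "\<And>y. cmod (ip x y) \<le> C * norm y" "C \<ge> 0"
  shows "norm x \<le> C"
proof (cases "x = 0")
  case False
  have "norm x * norm x \<le> C * norm x"
    using assms(1)[of x] by (simp add: ip_self power2_eq_square norm_mult)
  then show ?thesis using False by simp
qed (use assms in simp)

lemma ip_eqI: "(\<And>y. ip x y = ip x' y) \<Longrightarrow> x = x'"
  using ip_self[of "x - x'"] by (simp add: ip_diff_left)

end

text \<open>Replaces the angle in the definition of sectoriality by an inequality that survives
  perturbation and needs no computation of arguments.\<close>

lemma Arg_ge_of_Re_le:
  assumes "z \<noteq> 0" "0 < \<phi>" "\<phi> < pi" "Re z \<le> cos \<phi> * cmod z"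
  shows "\<phi> \<le> \<bar>Arg z\<bar>"
proof (rule ccontr)
  assume "\<not> ?thesis"
  then have "\<bar>Arg z\<bar> < \<phi>" by simp
  then have "cos \<phi> < cos \<bar>Arg z\<bar>" using assms by (intro cos_monotone_0_pi) auto
  then have "cos \<phi> < cos (Arg z)" by (simp add: cos_abs_real)
  then have "cmod z * cos \<phi> < cmod z * cos (Arg z)" using assms(1) by simp
  also have "\<dots> = Re z" using Re_complex_of_real rcis_cmod_Arg[of z] by (metis Re_rcis)
  finally show False using assms(4) by (simp add: mult.commute)
qed

locale closed_resolvent = complex_hilbert_space sc ip 
  for sc :: "complex \<Rightarrow> 'a::banach \<Rightarrow> 'a" and ip +
  fixes D :: "'a set" and A :: "'a \<Rightarrow> 'a"
  assumes linear: "clinear_on sc sc D A"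
begin

lemma D_add: "x \<in> D \<Longrightarrow> y \<in> D \<Longrightarrow> x + y \<in> D"
  and D_sc: "x \<in> D \<Longrightarrow> sc a x \<in> D"
  and A_add: "x \<in> D \<Longrightarrow> y \<in> D \<Longrightarrow> A (x + y) = A x + A y"
  and A_sc: "x \<in> D \<Longrightarrow> A (sc a x) = sc a (A x)"
  using linear unfolding clinear_on_def csubspace_def by auto

lemma D_scaleR: "x \<in> D \<Longrightarrow> r *\<^sub>R x \<in> D"
  and A_scaleR: "x \<in> D \<Longrightarrow> A (r *\<^sub>R x) = r *\<^sub>R A x"
  using D_sc[of x "of_real r"] A_sc[of x "of_real r"] by auto

lemma D_minus: "x \<in> D \<Longrightarrow> - x \<in> D"
  and A_minus: "x \<in> D \<Longrightarrow> A (- x) = - A x"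
  using D_scaleR[of x "-1"] A_scaleR[of x "-1"] by auto

abbreviation "\<rho> \<equiv> resolvent_set sc D A"
abbreviation "Res \<equiv> resolvent_op sc D A"

lemma resolvent:
  assumes "lam \<in> \<rho>"
  shows Res_in: "Res lam y \<in> D" and Res_eq: "sc lam (Res lam y) - A (Res lam y) = y"
    and Res_unique: "x \<in> D \<Longrightarrow> sc lam x - A x = y \<Longrightarrow> Res lam y = x"
    and Res_bound: "\<exists>K. \<forall>y. norm (Res lam y) \<le> K * norm y"
proof -
  have ex: "\<exists>!x. x \<in> D \<and> sc lam x - A x = y" and bd: "\<exists>K. \<forall>y. norm (Res lam y) \<le> K * norm y" for y
    using assms unfolding resolvent_set_def by auto
  show "Res lam y \<in> D" "sc lam (Res lam y) - A (Res lam y) = y"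
    using theI'[OF ex[of y]] unfolding resolvent_op_def by auto
  show "Res lam y = x" if "x \<in> D" "sc lam x - A x = y"
    unfolding resolvent_op_def using ex[of y] that by (intro the1_equality) auto
  show "\<exists>K. \<forall>y. norm (Res lam y) \<le> K * norm y" by (rule bd)
qed

lemma Res_add:
  assumes "lam \<in> \<rho>"
  shows "Res lam (x + y) = Res lam x + Res lam y"
  using assms by (intro Res_unique D_add Res_in) 
    (simp_all add: A_add Res_in sc_add_right Res_eq[OF assms, unfolded diff_eq_eq] algebra_simps)

lemma Res_sc:
  assumes "lam \<in> \<rho>"
  shows "Res lam (sc a x) = sc a (Res lam x)"
proof (rule Res_unique[OF assms D_sc[OF Res_in[OF assms]]])
  have "sc lam (sc a (Res lam x)) - A (sc a (Res lam x)) = sc a (sc lam (Res lam x) - A (Res lam x))"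
    using Res_in[OF assms] by (simp add: A_sc sc_diff_right mult.commute)
  then show "sc lam (sc a (Res lam x)) - A (sc a (Res lam x)) = sc a x" by (simp add: Res_eq[OF assms])
qed

lemma Res_bounded_linear:
  assumes "lam \<in> \<rho>"
  shows "bounded_linear (Res lam)"
proof -
  obtain K where "\<And>y. norm (Res lam y) \<le> K * norm y" using Res_bound[OF assms] by blast
  then show ?thesis
    using Res_sc[OF assms, of "of_real _"] by (intro bounded_linear_intro[of _ K]) (auto simp: Res_add[OF assms] mult.commute)
qed

text \<open>\<open>Res lam\<close> inverts \<open>lam - A\<close>, so the two signs make
  \<open>R t\<close> the inverse of \<open>t + A\<close>.\<close>

definition R :: "real \<Rightarrow> 'a \<Rightarrow> 'a" where "R t x = - Res (complex_of_real (- t)) x"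

end

locale sectorial_setting = closed_resolvent sc ip D A
  for sc :: "complex \<Rightarrow> 'a::banach \<Rightarrow> 'a" and ip D A +
  fixes lam0 :: real
  assumes sect: "sectorial sc D A" and lam0: "lam0 > 0"
    and spectrum: "\<forall>mu\<in>spectrum_op sc D A. Re mu > lam0"
begin

lemma nonpos_in_resolvent_set: "t \<ge> 0 \<Longrightarrow> complex_of_real (- t) \<in> \<rho>"
  using spectrum lam0 unfolding spectrum_op_def by force

lemma sector_resolvent:
  "\<exists>a \<phi> Ms. 0 < \<phi> \<and> \<phi> < pi / 2 \<and> Ms \<ge> 1 \<and> 
    (\<forall>lam. lam \<noteq> complex_of_real a \<longrightarrow> Re lam - a \<le> cos \<phi> * cmod (lam - complex_of_real a) \<longrightarrow>
       lam \<in> \<rho> \<and> (\<forall>y. norm (Res lam y) \<le> Ms / cmod (lam - complex_of_real a) * norm y))"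
proof -
  obtain a \<phi> Ms where *: "0 < \<phi>" "\<phi> < pi / 2" "Ms \<ge> 1"
    "\<forall>lam. lam \<noteq> complex_of_real a \<and> \<phi> \<le> \<bar>Arg (lam - complex_of_real a)\<bar> \<longrightarrow>
       lam \<in> \<rho> \<and> (\<forall>y. norm (Res lam y) \<le> Ms / cmod (lam - complex_of_real a) * norm y)"
    using sect unfolding sectorial_def by blast
  show ?thesis
  proof (intro exI conjI allI impI)
    fix lam assume lam: "lam \<noteq> complex_of_real a" "Re lam - a \<le> cos \<phi> * cmod (lam - complex_of_real a)"
    have "\<phi> \<le> \<bar>Arg (lam - complex_of_real a)\<bar>"
      using lam * by (intro Arg_ge_of_Re_le) auto
    then show "lam \<in> \<rho>" "norm (Res lam y) \<le> Ms / cmod (lam - complex_of_real a) * norm y" for y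
      using *(4) lam by blast+
  qed (use * in auto)
qed

lemma R_in: "t \<ge> 0 \<Longrightarrow> R t x \<in> D"
  unfolding R_def by (intro D_minus Res_in nonpos_in_resolvent_set)

lemma R_eq: "t \<ge> 0 \<Longrightarrow> t *\<^sub>R R t x + A (R t x) = x"
  using Res_eq[OF nonpos_in_resolvent_set, of t x] Res_in[OF nonpos_in_resolvent_set, of t x] 
  by (simp only: R_def A_minus sc_of_real) (simp add: algebra_simps)

lemma R_unique:
  assumes "t \<ge> 0" "x \<in> D" "t *\<^sub>R x + A x = y" shows "R t y = x"
proof -
  have "Res (complex_of_real (- t)) y = - x"
    using assms by (intro Res_unique nonpos_in_resolvent_set D_minus) (simp_all only: A_minus sc_of_real, simp)
  then show ?thesis by (simp add: R_def)
qed

lemma R_bounded_linear: "t \<ge> 0 \<Longrightarrow> bounded_linear (R t)"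
  unfolding R_def[abs_def] by (intro bounded_linear_minus Res_bounded_linear nonpos_in_resolvent_set)

lemma R_resolvent_identity:
  assumes "s \<ge> 0" "t \<ge> 0"
  shows "R s x - R t x = (t - s) *\<^sub>R R s (R t x)"
proof -
  interpret bounded_linear "R s" by (rule R_bounded_linear[OF assms(1)])
  have "s *\<^sub>R R t x + A (R t x) = x + (s - t) *\<^sub>R R t x"
    using R_eq[OF assms(2), of x] by (simp add: algebra_simps)
  then have "R t x = R s (x + (s - t) *\<^sub>R R t x)"
    using R_unique[OF assms(1) R_in[OF assms(2)]] by metis
  also have "\<dots> = R s x + (s - t) *\<^sub>R R s (R t x)" by (simp add: add scale)
  finally show ?thesis by (simp add: algebra_simps)
qed

text \<open>The sector estimate degenerates at its vertex, which may lie anywhere on the real line.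
  Near it the spectral hypothesis still bounds each single \<open>R t\<close>; interval bisection
  makes these bounds uniform.\<close>

lemma R_bounded_on_compact:
  assumes "0 \<le> c"
  shows "\<exists>B. \<forall>t\<in>{0..c}. \<forall>x. norm (R t x) \<le> B * norm x"
proof -
  have "\<exists>B\<ge>0. \<forall>t\<in>{0..c}. t \<ge> 0 \<longrightarrow> (\<forall>x. norm (R t x) \<le> B * norm x)"
  proof (rule Bolzano[OF assms, where P = "\<lambda>a b. \<exists>B\<ge>0. \<forall>t\<in>{a..b}. t \<ge> 0 \<longrightarrow> (\<forall>x. norm (R t x) \<le> B * norm x)"])
    fix a b c :: real
    assume "\<exists>B\<ge>0. \<forall>t\<in>{a..b}. t \<ge> 0 \<longrightarrow> (\<forall>x. norm (R t x) \<le> B * norm x)"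
      and "\<exists>B\<ge>0. \<forall>t\<in>{b..c}. t \<ge> 0 \<longrightarrow> (\<forall>x. norm (R t x) \<le> B * norm x)"
    then obtain B1 B2 where B: "\<And>t x. t \<in> {a..b} \<Longrightarrow> t \<ge> 0 \<Longrightarrow> norm (R t x) \<le> B1 * norm x"
      "\<And>t x. t \<in> {b..c} \<Longrightarrow> t \<ge> 0 \<Longrightarrow> norm (R t x) \<le> B2 * norm x" "B1 \<ge> 0" "B2 \<ge> 0" by blast
    have "norm (R t x) \<le> (B1 + B2) * norm x" if "t \<in> {a..c}" "t \<ge> 0" for t x
    proof -
      have "B1 * norm x \<le> (B1 + B2) * norm x" "B2 * norm x \<le> (B1 + B2) * norm x"
        using B(3,4) by (auto intro!: mult_right_mono)
      then show "norm (R t x) \<le> (B1 + B2) * norm x"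
        using B(1)[of t x] B(2)[of t x] that by (cases "t \<le> b") (auto intro: order_trans)
    qed
    then show "\<exists>B\<ge>0. \<forall>t\<in>{a..c}. t \<ge> 0 \<longrightarrow> (\<forall>x. norm (R t x) \<le> B * norm x)"
      using B(3,4) by (intro exI[of _ "B1 + B2"]) auto
  next
    fix s :: real assume s: "0 \<le> s" "s \<le> c"
    obtain B where B: "B > 0" "\<And>x. norm (R s x) \<le> B * norm x"
      using bounded_linear.pos_bounded[OF R_bounded_linear[OF s(1)]] by (auto simp: mult.commute)
    \<comment> \<open>At distance at most \<open>1 / (2 * B)\<close> the resolvent identity lets
      half of \<open>norm (R t x)\<close> be absorbed on the left.\<close>
    have "norm (R t x) \<le> (2 * B) * norm x" if t: "t \<ge> 0" "\<bar>s - t\<bar> \<le> 1 / (2 * B)" for t x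
    proof -
      have "R t x = R s x + (s - t) *\<^sub>R R s (R t x)"
        using R_resolvent_identity[OF s(1) t(1), of x] by (simp add: algebra_simps)
      then have "norm (R t x) \<le> norm (R s x) + norm ((s - t) *\<^sub>R R s (R t x))"
        by (metis norm_triangle_ineq)
      also have "\<dots> \<le> B * norm x + 1 / (2 * B) * (B * norm (R t x))"
      proof (rule add_mono[OF B(2)])
        have "\<bar>s - t\<bar> * norm (R s (R t x)) \<le> 1 / (2 * B) * (B * norm (R t x))"
          using t B by (intro mult_mono) auto
        then show "norm ((s - t) *\<^sub>R R s (R t x)) \<le> 1 / (2 * B) * (B * norm (R t x))" by simp
      qed
      also have "1 / (2 * B) * (B * norm (R t x)) = norm (R t x) / 2" using B(1) by simp
      finally show ?thesis by simp
    qed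
    then have "\<exists>B\<ge>0. \<forall>t\<in>{a..b}. t \<ge> 0 \<longrightarrow> (\<forall>x. norm (R t x) \<le> B * norm x)" if "a \<le> s" "s \<le> b" "b - a < 1 / (2 * B)" for a b
      using B(1) that by (intro exI[of _ "2 * B"]) (auto simp: abs_le_iff)
    then show "\<exists>d>0. \<forall>a b. a \<le> s \<and> s \<le> b \<and> b - a < d \<longrightarrow> 
        (\<exists>B\<ge>0. \<forall>t\<in>{a..b}. t \<ge> 0 \<longrightarrow> (\<forall>x. norm (R t x) \<le> B * norm x))"
      using B(1) by (intro exI[of _ "1 / (2 * B)"]) auto
  qed
  then show ?thesis by auto
qed

lemma R_decay: "\<exists>M\<ge>0. \<forall>t\<ge>0. \<forall>x. norm (R t x) \<le> M / (1 + t) * norm x"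
proof -
  obtain a \<phi> Ms where S: "0 < \<phi>" "\<phi> < pi / 2" "Ms \<ge> 1"
    "\<forall>lam. lam \<noteq> complex_of_real a \<longrightarrow> Re lam - a \<le> cos \<phi> * cmod (lam - complex_of_real a) \<longrightarrow>
       lam \<in> \<rho> \<and> (\<forall>y. norm (Res lam y) \<le> Ms / cmod (lam - complex_of_real a) * norm y)"
    using sector_resolvent by blast
  \<comment> \<open>Beyond \<open>c\<close> the point \<open>- t\<close> is left of the vertex
    \<open>a\<close>, and \<open>1 + t \<le> 4 * (t + a)\<close>; this is the 4 in
    \<open>M\<close>.\<close>
  define c where "c = 1 + 2 * \<bar>a\<bar>"
  obtain B where B: "\<And>t x. t \<in> {0..c} \<Longrightarrow> norm (R t x) \<le> B * norm x"
    using R_bounded_on_compact[of c] unfolding c_def by fastforce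
  define M where "M = max (4 * Ms) (\<bar>B\<bar> * (1 + c))"
  have "norm (R t x) \<le> M / (1 + t) * norm x" if t: "t \<ge> 0" for t x
  proof (cases "t \<le> c")
    case True
    have "B * norm x \<le> \<bar>B\<bar> * norm x" by (intro mult_right_mono) auto
    then have "norm (R t x) \<le> \<bar>B\<bar> * norm x" using B[of t x] True t by simp
    moreover have "\<bar>B\<bar> \<le> M / (1 + t)"
    proof -
      have "\<bar>B\<bar> * (1 + t) \<le> \<bar>B\<bar> * (1 + c)" using True by (intro mult_left_mono) auto
      also have "\<dots> \<le> M" by (simp add: M_def)
      finally show ?thesis using t by (simp add: pos_le_divide_eq)
    qed
    ultimately show ?thesis by (meson mult_right_mono norm_ge_zero order_trans)
  next
    case False
    have e: "complex_of_real (- t) - complex_of_real a = - complex_of_real (t + a)" by simp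
    have cm: "cmod (complex_of_real (- t) - complex_of_real a) = t + a"
      unfolding e norm_minus_cancel norm_of_real using False by (simp add: c_def)
    have cosp: "cos \<phi> > 0" using S by (intro cos_gt_zero) auto
    have "norm (Res (complex_of_real (- t)) x) \<le> Ms / (t + a) * norm x"
    proof -
      have "complex_of_real (- t) \<noteq> complex_of_real a" unfolding of_real_eq_iff using False by (auto simp: c_def)
      moreover have "Re (complex_of_real (- t)) - a \<le> cos \<phi> * cmod (complex_of_real (- t) - complex_of_real a)"
      proof -
        have "0 \<le> cos \<phi> * (t + a)" using False cosp by (intro mult_nonneg_nonneg) (auto simp: c_def)
        then show ?thesis unfolding cm using False by (simp add: c_def)
      qed
      ultimately show ?thesis using S(4) unfolding cm[symmetric] by blast
    qed
    moreover have "Ms / (t + a) \<le> M / (1 + t)"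
    proof -
      have "Ms * (1 + t) \<le> Ms * (4 * (t + a))" using False S(3) by (intro mult_left_mono) (auto simp: c_def)
      also have "\<dots> = (4 * Ms) * (t + a)" by simp
      also have "\<dots> \<le> M * (t + a)" using False by (intro mult_right_mono) (auto simp: M_def c_def)
      finally show ?thesis using False t by (simp add: c_def frac_le_eq divide_simps) (auto simp: c_def abs_if split: if_splits)
    qed
    ultimately show ?thesis unfolding R_def norm_minus_cancel by (meson mult_right_mono norm_ge_zero order_trans)
  qed
  moreover have "M \<ge> 0" using S(3) by (simp add: M_def)
  ultimately show ?thesis by blast
qed

text \<open>The locale \<open>positive_resolvent\<close> takes its constant as a parameter, so one
  is fixed by choice.\<close>

definition Mdecay :: real where "Mdecay = (SOME M. M \<ge> 0 \<and> (\<forall>t\<ge>0. \<forall>x. norm (R t x) \<le> M / (1 + t) * norm x))"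

sublocale positive_resolvent R Mdecay
proof -
  have "Mdecay \<ge> 0 \<and> (\<forall>t\<ge>0. \<forall>x. norm (R t x) \<le> Mdecay / (1 + t) * norm x)"
    unfolding Mdecay_def by (rule someI_ex) (use R_decay in blast)
  then show "positive_resolvent R Mdecay"
    by (intro positive_resolvent.intro R_bounded_linear R_resolvent_identity) auto
qed

section \<open>The negative powers with exponents 1/3 and 2/3\<close>

abbreviation "L \<equiv> neg_frac_pow sc D A (1/3)"
abbreviation "P \<equiv> neg_frac_pow sc D A (2/3)"

text \<open>The substitution \<open>t = q^3\<close> contributes a factor 3, and
  \<open>3 * sin (pi / 3) / pi\<close> is the reciprocal of \<open>cube_const\<close>. As
  \<open>sin (2 * pi / 3)\<close> is the same number, \<open>P_eq\<close> has the same
  factor.\<close>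

lemma L_eq: "L x = (1 / cube_const) *\<^sub>R moment 1 x"
proof -
  have "integral {0<..} (\<lambda>t. t powr (- (1/3)) *\<^sub>R R t x) = 3 *\<^sub>R moment 1 x"
    using moment_has_integral[of 1 x] by (intro integral_unique) simp
  moreover have "sin (pi * (1/3)) / pi * 3 = 1 / cube_const"
    by (simp add: sin_60 field_simps)
  ultimately show ?thesis unfolding neg_frac_pow_def R_def[symmetric] by (simp only: scaleR_scaleR)
qed

lemma P_eq: "P x = (1 / cube_const) *\<^sub>R moment 0 x"
proof -
  have "integral {0<..} (\<lambda>t. t powr (- (2/3)) *\<^sub>R R t x) = 3 *\<^sub>R moment 0 x"
    using moment_has_integral[of 0 x] by (intro integral_unique) simp
  moreover have "sin (pi * (2/3)) / pi * 3 = 1 / cube_const"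
    using sin_120 by (simp add: field_simps)
  ultimately show ?thesis unfolding neg_frac_pow_def R_def[symmetric] by (simp only: scaleR_scaleR)
qed

lemma L_bounded_linear: "bounded_linear L"
  unfolding L_eq[abs_def] by (intro bounded_linear_const_scaleR moment_bounded_linear) simp

lemma R_sc: "t \<ge> 0 \<Longrightarrow> R t (sc a x) = sc a (R t x)"
  unfolding R_def by (simp only: Res_sc nonpos_in_resolvent_set sc_minus_right)

text \<open>The vector integral is built with real scalars; complex ones are pulled out of the
  scalar integral after testing with \<open>ip\<close>.\<close>

lemma L_sc: "L (sc a x) = sc a (L x)"
proof -
  have "moment 1 (sc a x) = sc a (moment 1 x)"
  proof (rule ip_eqI)
    fix y
    have "ip (moment 1 (sc a x)) y = (LINT q:{0<..}|lborel. of_real (q ^ 1) * ip (R (q ^ 3) (sc a x)) y)"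
      by (rule functional_moment_eq_set_integral[OF order_refl bounded_linear_ip])
    also have "\<dots> = (LINT q:{0<..}|lborel. a * (of_real (q ^ 1) * ip (R (q ^ 3) x) y))"
      by (rule set_lebesgue_integral_cong) (auto simp: R_sc ip_sc_left)
    also have "\<dots> = a * ip (moment 1 x) y"
      unfolding set_integral_mult_right functional_moment_eq_set_integral[OF order_refl bounded_linear_ip] ..
    finally show "ip (moment 1 (sc a x)) y = ip (sc a (moment 1 x)) y" by (simp add: ip_sc_left)
  qed
  then show ?thesis by (simp add: L_eq sc_scaleR)
qed

text \<open>Together with \<open>L_P\<close> this makes the cube of \<open>L\<close> the inverse of
  \<open>A\<close>, so no other power of \<open>A\<close> has to be considered afterwards.\<close>

lemma L_L: "L (L x) = P x"
proof -
  interpret m: bounded_linear "moment 1" by (rule moment_bounded_linear) simp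
  have "moment 1 (moment 1 x) = cube_const *\<^sub>R moment 0 x"
    by (rule ip_eqI) (simp only: functional_moment_1_1[OF bounded_linear_ip] sc_of_real[symmetric] ip_sc_left)
  then have "L (L x) = (1 / cube_const * (1 / cube_const * cube_const)) *\<^sub>R moment 0 x"
    by (simp only: L_eq m.scaleR scaleR_scaleR)
  then show ?thesis by (simp add: P_eq)
qed

lemma L_P: "L (P x) = R 0 x"
proof -
  interpret m: bounded_linear "moment 1" by (rule moment_bounded_linear) simp
  have "moment 1 (moment 0 x) = (cube_const ^ 2) *\<^sub>R R 0 x"
    by (rule ip_eqI) (simp only: functional_moment_1_0[OF bounded_linear_ip] sc_of_real[symmetric] ip_sc_left)
  then have "L (P x) = (1 / cube_const * (1 / cube_const * cube_const ^ 2)) *\<^sub>R R 0 x"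
    by (simp only: L_eq P_eq m.scaleR scaleR_scaleR)
  also have "1 / cube_const * (1 / cube_const * cube_const ^ 2) = 1" by (simp add: power2_eq_square)
  finally show ?thesis by simp
qed

end

section \<open>Polynomially bounded resolvents near infinity\<close>

context complex_hilbert_space
begin

text \<open>With \<open>E \<mu> = (1 - \<mu> L)\<^bsup>-1\<^esup>\<close>, the function \<open>\<mu> E \<mu> L\<^sup>4 w\<close> tends weakly to \<open>-L\<^sup>3 w\<close> at infinity, so the
  maximum principle in \<open>1 / \<mu>\<close> bounds \<open>L\<^sup>3 w\<close> by the values of \<open>E \<mu> L\<^sup>4 w\<close> on a circle. The power \<open>4\<close> beats
  the quadratic growth of \<open>E\<close>.\<close>

lemma inverse_pencil_estimate:
  fixes L :: "'a \<Rightarrow> 'a"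
  assumes L: "bounded_linear L" and L_sc: "\<And>a x. L (sc a x) = sc a (L x)" and r: "r \<ge> 1"
    and surj: "\<And>\<mu> y. cmod \<mu> \<ge> r \<Longrightarrow> \<exists>x. x - sc \<mu> (L x) = y"
    and low: "\<And>\<mu> x. cmod \<mu> \<ge> r \<Longrightarrow> norm x \<le> K * (cmod \<mu>)\<^sup>2 * norm (x - sc \<mu> (L x))"
  shows "\<exists>C\<ge>0. \<forall>w. norm (L (L (L w))) \<le> C * norm (L (L (L (L w))))"
proof -
  interpret L: bounded_linear L by fact
  \<comment> \<open>The inverse of the pencil \<open>1 - \<mu> L\<close>: it exists by
    \<open>surj\<close> and is unique by \<open>low\<close>.\<close>
  define E where "E \<mu> y = (SOME x. x - sc \<mu> (L x) = y)" for \<mu> y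
  have E_eq: "E \<mu> y - sc \<mu> (L (E \<mu> y)) = y" if "cmod \<mu> \<ge> r" for \<mu> y
    unfolding E_def by (rule someI_ex[OF surj[OF that]])
  have E_unique: "E \<mu> y = x" if "cmod \<mu> \<ge> r" "x - sc \<mu> (L x) = y" for \<mu> x y
  proof -
    have "E \<mu> y - x - sc \<mu> (L (E \<mu> y - x)) = (E \<mu> y - sc \<mu> (L (E \<mu> y))) - (x - sc \<mu> (L x))"
      by (simp add: L.diff sc_diff_right)
    also have "\<dots> = 0" using E_eq[OF that(1)] that(2) by simp
    finally have "norm (E \<mu> y - x) \<le> 0" using low[OF that(1), of "E \<mu> y - x"] by simp
    then show ?thesis by simp
  qed
  have E_bound: "norm (E \<mu> y) \<le> K * (cmod \<mu>)\<^sup>2 * norm y" if "cmod \<mu> \<ge> r" for \<mu> y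
    using low[OF that, of "E \<mu> y"] by (simp add: E_eq[OF that])
  have E_L: "E \<mu> (L y) = L (E \<mu> y)" if "cmod \<mu> \<ge> r" for \<mu> y
    using E_eq[OF that, of y] by (intro E_unique that) (metis L.diff L_sc)
  \<comment> \<open>The resolvent identity of the pencil; weak continuity and then the complex
    derivative follow from it.\<close>
  have E_diff: "E \<mu> y - E \<nu> y = sc (\<mu> - \<nu>) (E \<mu> (L (E \<nu> y)))" if "cmod \<mu> \<ge> r" "cmod \<nu> \<ge> r" for \<mu> \<nu> y
  proof -
    define v where "v = sc (\<mu> - \<nu>) (E \<mu> (L (E \<nu> y)))"
    have "v - sc \<mu> (L v) = sc (\<mu> - \<nu>) (E \<mu> (L (E \<nu> y)) - sc \<mu> (L (E \<mu> (L (E \<nu> y)))))"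
      by (simp add: v_def sc_diff_right L_sc mult.commute)
    then have "v - sc \<mu> (L v) = sc \<mu> (L (E \<nu> y)) - sc \<nu> (L (E \<nu> y))"
      by (simp add: E_eq[OF that(1)] sc_diff_left)
    moreover have "E \<nu> y + v - sc \<mu> (L (E \<nu> y + v)) = (E \<nu> y - sc \<nu> (L (E \<nu> y))) + (v - sc \<mu> (L v)) - (sc \<mu> (L (E \<nu> y)) - sc \<nu> (L (E \<nu> y)))"
      by (simp add: L.add sc_add_right)
    ultimately have "E \<nu> y + v - sc \<mu> (L (E \<nu> y + v)) = y"
      using E_eq[OF that(2), of y] by simp
    then have "E \<mu> y = E \<nu> y + v" by (rule E_unique[OF that(1)])
    then have "E \<mu> y = E \<nu> y + sc (\<mu> - \<nu>) (E \<mu> (L (E \<nu> y)))" unfolding v_def .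
    then show ?thesis by simp
  qed
  have lim_E: "((\<lambda>\<mu>. ip (E \<mu> z) y) \<longlongrightarrow> ip (E \<nu> z) y) (at \<nu>)" if "cmod \<nu> > r" for \<nu> y z
  proof -
    have ev: "\<forall>\<^sub>F \<mu> in at \<nu>. cmod \<mu> > r"
      using that by (intro order_tendstoD(1)[OF tendsto_norm[OF tendsto_ident_at]])
    have "((\<lambda>\<mu>. ip (E \<mu> z) y - ip (E \<nu> z) y) \<longlongrightarrow> 0) (at \<nu>)"
    proof (rule Lim_null_comparison)
      show "\<forall>\<^sub>F \<mu> in at \<nu>. norm (ip (E \<mu> z) y - ip (E \<nu> z) y) \<le> cmod (\<mu> - \<nu>) * (K * (cmod \<mu>)\<^sup>2 * norm (L (E \<nu> z))) * norm y"
        using ev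
      proof eventually_elim
        case (elim \<mu>)
        have "norm (ip (E \<mu> z) y - ip (E \<nu> z) y) \<le> norm (E \<mu> z - E \<nu> z) * norm y"
          unfolding ip_diff_left[symmetric] by (rule Cauchy_Schwarz)
        also have "norm (E \<mu> z - E \<nu> z) = cmod (\<mu> - \<nu>) * norm (E \<mu> (L (E \<nu> z)))"
          using elim that by (subst E_diff) (auto simp: norm_sc)
        also have "\<dots> * norm y \<le> cmod (\<mu> - \<nu>) * (K * (cmod \<mu>)\<^sup>2 * norm (L (E \<nu> z))) * norm y"
          using elim by (intro mult_right_mono mult_left_mono E_bound) auto
        finally show ?case .
      qed
      have "((\<lambda>\<mu>. cmod (\<mu> - \<nu>) * (K * (cmod \<mu>)\<^sup>2 * norm (L (E \<nu> z))) * norm y) \<longlongrightarrow>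
          cmod (\<nu> - \<nu>) * (K * (cmod \<nu>)\<^sup>2 * norm (L (E \<nu> z))) * norm y) (at \<nu>)"
        by (intro tendsto_intros)
      then show "((\<lambda>\<mu>. cmod (\<mu> - \<nu>) * (K * (cmod \<mu>)\<^sup>2 * norm (L (E \<nu> z))) * norm y) \<longlongrightarrow> 0) (at \<nu>)" by simp
    qed
    then show ?thesis by (simp add: LIM_zero_iff)
  qed
  have holo: "(\<lambda>\<mu>. ip (E \<mu> x) y) holomorphic_on {\<mu>. cmod \<mu> > r}" for x y
  proof (rule holomorphic_onI)
    fix \<nu> assume "\<nu> \<in> {\<mu>. cmod \<mu> > r}" then have \<nu>: "cmod \<nu> > r" by simp
    have "((\<lambda>\<mu>. ip (E \<mu> x) y) has_field_derivative ip (E \<nu> (L (E \<nu> x))) y) (at \<nu>)"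
      unfolding has_field_derivative_iff
    proof (rule Lim_transform_eventually[OF lim_E[OF \<nu>]])
      have ev: "\<forall>\<^sub>F \<mu> in at \<nu>. cmod \<mu> > r"
        using \<nu> by (intro order_tendstoD(1)[OF tendsto_norm[OF tendsto_ident_at]])
      have ne: "\<forall>\<^sub>F \<mu> in at \<nu>. \<mu> \<noteq> \<nu>" by (simp add: eventually_at_filter)
      show "\<forall>\<^sub>F \<mu> in at \<nu>. ip (E \<mu> (L (E \<nu> x))) y = (ip (E \<mu> x) y - ip (E \<nu> x) y) / (\<mu> - \<nu>)"
        using ev ne
      proof eventually_elim
        case (elim \<mu>)
        then have "ip (E \<mu> x) y - ip (E \<nu> x) y = (\<mu> - \<nu>) * ip (E \<mu> (L (E \<nu> x))) y"
          using \<nu> unfolding ip_diff_left[symmetric] by (subst E_diff) (auto simp: ip_sc_left)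
        then show ?case using elim by simp
      qed
    qed
    then show "(\<lambda>\<mu>. ip (E \<mu> x) y) field_differentiable at \<nu> within {\<mu>. cmod \<mu> > r}"
      using field_differentiable_at_within field_differentiable_def by blast
  qed
  \<comment> \<open>A bound for \<open>\<mu> E \<mu>\<close> on the circle
    \<open>cmod \<mu> = 2 * r\<close>, namely the radius times the quadratic bound for
    \<open>E \<mu>\<close>.\<close>
  define C where "C = 2 * r * (K * (2 * r)\<^sup>2)"
  \<comment> \<open>The sign of \<open>K\<close> can be inferred only from a nonzero vector; the
    zero space is treated at the end.\<close>
  have K: "0 \<le> K" if nz: "\<exists>x::'a. x \<noteq> 0"
  proof -
    obtain x :: 'a where x: "x \<noteq> 0" using nz by blast
    have "0 < norm x" using x by simp
    also have "\<dots> \<le> K * r\<^sup>2 * norm (x - sc (of_real r) (L x))"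
      using low[of "of_real r" x] r by simp
    finally have "0 < K * (r\<^sup>2 * norm (x - sc (of_real r) (L x)))" by (simp add: mult.assoc)
    moreover have "0 \<le> r\<^sup>2 * norm (x - sc (of_real r) (L x))" by simp
    ultimately show ?thesis by (meson less_imp_le mult_nonpos_nonneg not_le)
  qed
  \<comment> \<open>Each use trades one factor \<open>L\<close> for one power of
    \<open>1 / \<mu>\<close>, up to a term free of \<open>E\<close>.\<close>
  have E_shift: "sc \<mu> (E \<mu> (L v)) = E \<mu> v - v" if "cmod \<mu> \<ge> r" for \<mu> v
    using E_eq[OF that, of v] by (simp add: E_L[OF that] algebra_simps)
  have main: "cmod (ip (L (L (L w))) y) \<le> C * norm (L (L (L (L w)))) * norm y" for w y
  proof -
    define f where "f \<mu> = ip (E \<mu> (L (L (L (L w))))) y" for \<mu>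
    \<comment> \<open>The coordinate is \<open>z = 1 / \<mu>\<close>. \<open>E_shift\<close> turns
      \<open>\<mu> E \<mu> L^4 w\<close> into \<open>E \<mu> L^3 w - L^3 w\<close>, which dictates
      the value at 0.\<close>
    define g where "g z = (if z = 0 then - ip (L (L (L w))) y else f (1 / z) / z)" for z
    define Cw where "Cw = (K * norm w + norm w + norm (L w) + norm (L (L w))) * norm y"
    \<comment> \<open>Three uses of \<open>E_shift\<close> express
      \<open>\<mu>^3 E \<mu> L^3 w\<close> by \<open>E \<mu> w\<close> and terms of degree at most 2
      in \<open>\<mu>\<close>. As \<open>E \<mu> w\<close> is quadratic too,
      \<open>E \<mu> L^3 w\<close> is of order \<open>1 / \<mu>\<close>. The constant
      \<open>Cw\<close> depends on \<open>w\<close>, but enters only the continuity of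
      \<open>g\<close> at 0, not the final bound.\<close>
    have near: "cmod (g z - g 0) \<le> cmod z * Cw" if z: "z \<in> ball 0 (1 / r)" for z
    proof (cases "z = 0")
      case False
      define \<mu> where "\<mu> = 1 / z"
      have \<mu>: "cmod \<mu> \<ge> r" "\<mu> \<noteq> 0" "1 / z = \<mu>"
        using z False r by (auto simp: \<mu>_def norm_divide field_simps)
      have \<mu>1: "cmod \<mu> \<ge> 1" using \<mu>(1) r by simp
      have "g z = ip (sc \<mu> (E \<mu> (L (L (L (L w)))))) y"
        using False by (simp add: g_def f_def \<mu>_def ip_sc_left)
      then have "g z - g 0 = ip (E \<mu> (L (L (L w)))) y"
        by (simp add: E_shift[OF \<mu>(1)] g_def ip_diff_left)
      then have 1: "cmod (g z - g 0) \<le> norm (E \<mu> (L (L (L w)))) * norm y"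
        using Cauchy_Schwarz by simp
      have "sc (\<mu> ^ 3) (E \<mu> (L (L (L w)))) = sc \<mu> (sc \<mu> (sc \<mu> (E \<mu> (L (L (L w))))))"
        by (simp add: power3_eq_cube mult.assoc)
      also have "\<dots> = sc \<mu> (sc \<mu> (E \<mu> (L (L w)))) - sc \<mu> (sc \<mu> (L (L w)))"
        by (simp only: E_shift[OF \<mu>(1)] sc_diff_right)
      also have "\<dots> = sc \<mu> (E \<mu> (L w)) - sc \<mu> (L w) - sc \<mu> (sc \<mu> (L (L w)))"
        by (simp only: E_shift[OF \<mu>(1)] sc_diff_right)
      also have "\<dots> = E \<mu> w - w - sc \<mu> (L w) - sc (\<mu>\<^sup>2) (L (L w))"
        by (simp only: E_shift[OF \<mu>(1)] sc_sc power2_eq_square)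
      finally have "norm (sc (\<mu> ^ 3) (E \<mu> (L (L (L w))))) \<le> norm (E \<mu> w) + norm w + norm (sc \<mu> (L w)) + norm (sc (\<mu>\<^sup>2) (L (L w)))"
        by (simp only:) (intro norm_triangle_le_diff add_mono order_refl)
      also have "\<dots> \<le> K * (cmod \<mu>)\<^sup>2 * norm w + (cmod \<mu>)\<^sup>2 * norm w + (cmod \<mu>)\<^sup>2 * norm (L w) + (cmod \<mu>)\<^sup>2 * norm (L (L w))"
      proof (intro add_mono E_bound \<mu>(1))
        show "norm w \<le> (cmod \<mu>)\<^sup>2 * norm w" using \<mu>1 by (simp add: mult_le_cancel_right1)
        have "cmod \<mu> \<le> (cmod \<mu>)\<^sup>2" using mult_right_mono[OF \<mu>1, of "cmod \<mu>"] by (simp add: power2_eq_square)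
        then show "norm (sc \<mu> (L w)) \<le> (cmod \<mu>)\<^sup>2 * norm (L w)" by (simp add: norm_sc mult_right_mono)
        show "norm (sc (\<mu>\<^sup>2) (L (L w))) \<le> (cmod \<mu>)\<^sup>2 * norm (L (L w))" by (simp add: norm_sc norm_power)
      qed
      finally have "(cmod \<mu>)\<^sup>2 * (cmod \<mu> * norm (E \<mu> (L (L (L w))))) \<le> (cmod \<mu>)\<^sup>2 * (K * norm w + norm w + norm (L w) + norm (L (L w)))"
        by (simp add: norm_sc norm_power norm_mult power2_eq_square power3_eq_cube algebra_simps)
      then have "cmod \<mu> * norm (E \<mu> (L (L (L w)))) \<le> K * norm w + norm w + norm (L w) + norm (L (L w))"
        using \<mu>(2) by simp
      then have "cmod \<mu> * (norm (E \<mu> (L (L (L w)))) * norm y) \<le> Cw"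
        unfolding Cw_def mult.assoc[symmetric] by (rule mult_right_mono) simp
      then have "norm (E \<mu> (L (L (L w)))) * norm y \<le> cmod z * Cw"
        using False by (simp add: \<mu>_def norm_divide field_simps)
      then show ?thesis using 1 by simp
    qed simp
    have holo1: "g holomorphic_on ball 0 (1 / r) - {0}"
    proof -
      have "(\<lambda>z. f (1 / z) / z) holomorphic_on ball 0 (1 / r) - {0}"
      proof (intro holomorphic_intros)
        have "(f \<circ> (\<lambda>z. 1 / z)) holomorphic_on ball 0 (1 / r) - {0}"
          using holo[of "L (L (L (L w)))" y] unfolding f_def[symmetric]
          by (intro holomorphic_on_compose_gen[where t = "{\<mu>. cmod \<mu> > r}"] holomorphic_intros)
             (use r in \<open>auto simp: norm_divide field_simps\<close>)
        then show "(\<lambda>z. f (1 / z)) holomorphic_on ball 0 (1 / r) - {0}" by (simp add: o_def)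
      qed auto
      then show ?thesis by (rule holomorphic_transform) (auto simp: g_def)
    qed
    have cont: "continuous_on (ball 0 (1 / r)) g"
      unfolding continuous_on_eq_continuous_at[OF open_ball]
    proof
      fix z :: complex assume z: "z \<in> ball 0 (1 / r)"
      show "isCont g z"
      proof (cases "z = 0")
        case False
        then show ?thesis using holomorphic_on_imp_continuous_on[OF holo1] z
          by (subst (asm) continuous_on_eq_continuous_at) auto
      next
        case True
        have "((\<lambda>z. g z - g 0) \<longlongrightarrow> 0) (at 0)"
        proof (rule Lim_null_comparison)
          show "\<forall>\<^sub>F z in at 0. norm (g z - g 0) \<le> cmod z * Cw"
            unfolding eventually_at using r near by (intro exI[of _ "1 / r"]) auto
          have "((\<lambda>z::complex. cmod z * Cw) \<longlongrightarrow> cmod 0 * Cw) (at 0)" by (intro tendsto_intros)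
          then show "((\<lambda>z::complex. cmod z * Cw) \<longlongrightarrow> 0) (at 0)" by simp
        qed
        then show ?thesis unfolding True isCont_def by (simp add: LIM_zero_iff)
      qed
    qed
    have holo_g: "g holomorphic_on ball 0 (1 / r)"
      by (rule no_isolated_singularity[OF cont holo1]) auto
    have sub: "cball 0 (1 / (2 * r)) \<subseteq> ball (0::complex) (1 / r)" using r by (auto simp: field_simps)
    have "cmod (g 0) \<le> C * norm (L (L (L (L w)))) * norm y"
    proof (rule maximum_modulus_frontier[of g "cball 0 (1 / (2 * r))"])
      show "g holomorphic_on interior (cball 0 (1 / (2 * r)))"
        by (rule holomorphic_on_subset[OF holo_g]) (use sub in auto)
      show "continuous_on (closure (cball 0 (1 / (2 * r)))) g"
        using continuous_on_subset[OF cont sub] by simp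
      fix z assume "z \<in> frontier (cball (0::complex) (1 / (2 * r)))"
      then have z: "cmod z = 1 / (2 * r)" by (simp add: frontier_cball)
      define \<mu> where "\<mu> = 1 / z"
      have \<mu>: "cmod \<mu> = 2 * r" "cmod \<mu> \<ge> r" using z r by (auto simp: \<mu>_def norm_divide)
      have "z \<noteq> 0" using z r by auto
      then have "cmod (g z) = 2 * r * cmod (ip (E \<mu> (L (L (L (L w))))) y)"
        using \<mu>(1) by (simp add: g_def f_def \<mu>_def norm_divide field_simps)
      also have "\<dots> \<le> 2 * r * ((K * (2 * r)\<^sup>2 * norm (L (L (L (L w))))) * norm y)"
        using r E_bound[OF \<mu>(2), of "L (L (L (L w)))"] unfolding \<mu>(1)
        by (intro mult_left_mono order_trans[OF Cauchy_Schwarz] mult_right_mono) auto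
      finally show "cmod (g z) \<le> C * norm (L (L (L (L w)))) * norm y" by (simp add: C_def mult.assoc)
    qed (use r in auto)
    then show ?thesis by (simp add: g_def)
  qed
  show ?thesis
  proof (cases "\<exists>x::'a. x \<noteq> 0")
    case True
    have "C \<ge> 0" using K[OF True] r by (simp add: C_def)
    then show ?thesis using norm_le_of_ip_le[OF main] by (intro exI[of _ C]) auto
  next
    case False
    then show ?thesis by (intro exI[of _ 0]) auto
  qed
qed

end

section \<open>Covering a neighbourhood of infinity\<close>

text \<open>Outside both half planes \<open>\<mu> = - X + i y\<close> with \<open>X > 0\<close> and
  \<open>\<bar>y\<bar> * s < \<Omega> + X * k\<close>. Since \<open>k \<le> 1/2\<close> and
  \<open>s\<^sup>2 \<ge> 3/4\<close>, the difference \<open>3 * y\<^sup>2 - X\<^sup>2\<close> is at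
  most linear in \<open>X\<close>. So
  \<open>Re (\<mu> ^ 3) = X * (3 * y\<^sup>2 - X\<^sup>2)\<close> is at most quadratic in
  \<open>cmod \<mu>\<close> and is beaten by \<open>c * cmod \<mu> ^ 3\<close>.\<close>

lemma half_planes_and_sector_cover:
  fixes \<kappa> :: complex
  assumes \<kappa>: "cmod \<kappa> = 1" "0 < Re \<kappa>" "Re \<kappa> \<le> 1/2" and \<Omega>: "\<Omega> > 0" and c: "c > 0"
  shows "\<exists>r\<ge>1. \<forall>\<mu>. cmod \<mu> \<ge> r \<longrightarrow> Re (\<mu> * \<kappa>) \<ge> \<Omega> \<or> Re (\<mu> * cnj \<kappa>) \<ge> \<Omega> \<or>
     (cmod (\<mu> ^ 3) \<ge> 2 * \<bar>a\<bar> + 1 \<and> Re (\<mu> ^ 3) - a \<le> c * cmod (\<mu> ^ 3 - of_real a))"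
proof -
  define k where "k = Re \<kappa>"
  define s where "s = \<bar>Im \<kappa>\<bar>"
  have ks: "k > 0" "k \<le> 1/2" "k\<^sup>2 + s\<^sup>2 = 1" "s \<ge> 0"
    using \<kappa> cmod_power2[of \<kappa>] by (auto simp: k_def s_def)
  have k2: "k\<^sup>2 \<le> 1/4" using ks power_mono[of k "1/2" 2] by (simp add: power_divide)
  then have s2: "s\<^sup>2 \<ge> 3/4" using ks by simp
  have s12: "s \<ge> 1/2"
  proof (rule power2_le_imp_le)
    show "(1/2)\<^sup>2 \<le> s\<^sup>2" using s2 by (simp add: power_divide)
  qed (use ks in simp)
  \<comment> \<open>Each summand has a purpose: \<open>2 * \<bar>a\<bar> + 1\<close> for the size of
    the cube, \<open>\<Omega> / k + 2 * \<Omega>\<close> to exclude \<open>Re \<mu> \<ge> 0\<close>,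
    the quotient by \<open>c\<close> to absorb the quadratic error.\<close>
  define r where "r = 2 * \<bar>a\<bar> + 1 + \<Omega> / k + 2 * \<Omega> + (4 * \<Omega> + 4 * \<Omega>\<^sup>2 + (1 + c) * \<bar>a\<bar>) / c"
  have r1: "r \<ge> 1" unfolding r_def using \<Omega> ks c by (auto intro!: add_nonneg_nonneg divide_nonneg_pos)
  have key: "cmod (\<mu> ^ 3) \<ge> 2 * \<bar>a\<bar> + 1 \<and> Re (\<mu> ^ 3) - a \<le> c * cmod (\<mu> ^ 3 - of_real a)"
    if \<mu>: "cmod \<mu> \<ge> r" and n1: "Re (\<mu> * \<kappa>) < \<Omega>" and n2: "Re (\<mu> * cnj \<kappa>) < \<Omega>" for \<mu>
  proof -
    define x where "x = Re \<mu>"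
    define y where "y = Im \<mu>"
    define m where "m = cmod \<mu>"
    have m: "m \<ge> 1" "m \<ge> 2 * \<bar>a\<bar> + 1" "m \<ge> \<Omega> / k + 2 * \<Omega> + 1" "m * c \<ge> 4 * \<Omega> + 4 * \<Omega>\<^sup>2 + (1 + c) * \<bar>a\<bar>"
    proof -
      have nn: "0 \<le> \<Omega> / k" "0 \<le> (4 * \<Omega> + 4 * \<Omega>\<^sup>2 + (1 + c) * \<bar>a\<bar>) / c" using \<Omega> ks c by auto
      show "m \<ge> 1" "m \<ge> 2 * \<bar>a\<bar> + 1" "m \<ge> \<Omega> / k + 2 * \<Omega> + 1" using \<mu> nn \<Omega> r1 unfolding m_def r_def by linarith+
      have "m \<ge> (4 * \<Omega> + 4 * \<Omega>\<^sup>2 + (1 + c) * \<bar>a\<bar>) / c" using \<mu> nn \<Omega> unfolding m_def r_def by linarith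
      then show "m * c \<ge> 4 * \<Omega> + 4 * \<Omega>\<^sup>2 + (1 + c) * \<bar>a\<bar>" using c by (simp add: divide_le_eq)
    qed
    have xy: "x * k + \<bar>y\<bar> * s < \<Omega>"
    proof -
      have "x * k - y * Im \<kappa> < \<Omega>" "x * k + y * Im \<kappa> < \<Omega>" using n1 n2 by (simp_all add: x_def y_def k_def)
      then show ?thesis by (simp add: s_def abs_mult[symmetric] abs_if split: if_splits)
    qed
    have mle: "m \<le> \<bar>x\<bar> + \<bar>y\<bar>" unfolding m_def x_def y_def by (rule cmod_le)
    have x0: "x < 0"
    proof (rule ccontr)
      assume "\<not> x < 0"
      then have x: "x \<ge> 0" by simp
      have p: "0 \<le> x * k" "0 \<le> \<bar>y\<bar> * s" using x ks by auto
      have "x * k < \<Omega>" "\<bar>y\<bar> * s < \<Omega>" using xy p by linarith+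
      then have "x < \<Omega> / k" using ks by (simp add: field_simps)
      moreover have "\<bar>y\<bar> * (1/2) \<le> \<bar>y\<bar> * s" using s12 by (intro mult_left_mono) auto
      ultimately show False using \<open>\<bar>y\<bar> * s < \<Omega>\<close> mle m(3) x by linarith
    qed
    define X where "X = - x"
    have X: "X > 0" using x0 by (simp add: X_def)
    have Xm: "X \<le> m" using abs_Re_le_cmod[of \<mu>] by (simp add: X_def m_def x_def)
    have "\<bar>y\<bar> * s \<le> \<Omega> + X * k" using xy by (simp add: X_def)
    then have "(\<bar>y\<bar> * s)\<^sup>2 \<le> (\<Omega> + X * k)\<^sup>2" using ks by (intro power_mono) auto
    then have ys: "y\<^sup>2 * s\<^sup>2 \<le> (\<Omega> + X * k)\<^sup>2" by (simp add: power_mult_distrib)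
    have "(\<Omega> + X * k)\<^sup>2 \<le> (\<Omega> + X * (1/2))\<^sup>2" using ks X \<Omega> by (intro power_mono add_mono mult_left_mono) auto
    moreover have "y\<^sup>2 * (3/4) \<le> y\<^sup>2 * s\<^sup>2" using s2 by (intro mult_left_mono) auto
    ultimately have "3 * y\<^sup>2 \<le> 4 * (\<Omega> + X * (1/2))\<^sup>2" using ys by linarith
    also have "\<dots> = X\<^sup>2 + 4 * \<Omega> * X + 4 * \<Omega>\<^sup>2" by (simp add: power2_eq_square algebra_simps)
    finally have y3: "3 * y\<^sup>2 - X\<^sup>2 \<le> 4 * \<Omega> * X + 4 * \<Omega>\<^sup>2" by simp
    have "Re (\<mu> ^ 3) = X * (3 * y\<^sup>2 - X\<^sup>2)"
      by (simp add: X_def x_def y_def power3_eq_cube power2_eq_square algebra_simps)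
    also have "\<dots> \<le> X * (4 * \<Omega> * X + 4 * \<Omega>\<^sup>2)" using y3 X by (intro mult_left_mono) auto
    also have "\<dots> \<le> m * (4 * \<Omega> * m + 4 * \<Omega>\<^sup>2 * m)"
    proof (rule mult_mono[OF Xm add_mono])
      show "4 * \<Omega> * X \<le> 4 * \<Omega> * m" using Xm \<Omega> by simp
      show "4 * \<Omega>\<^sup>2 \<le> 4 * \<Omega>\<^sup>2 * m" using m(1) by (simp add: mult_le_cancel_left1)
    qed (use X \<Omega> m in auto)
    also have "\<dots> = (4 * \<Omega> + 4 * \<Omega>\<^sup>2) * m\<^sup>2" by (simp add: power2_eq_square algebra_simps)
    finally have re: "Re (\<mu> ^ 3) \<le> (4 * \<Omega> + 4 * \<Omega>\<^sup>2) * m\<^sup>2" .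
    have m2: "m\<^sup>2 \<ge> 1" using m(1) by simp
    have "(4 * \<Omega> + 4 * \<Omega>\<^sup>2) * m\<^sup>2 + (1 + c) * \<bar>a\<bar> \<le> (4 * \<Omega> + 4 * \<Omega>\<^sup>2) * m\<^sup>2 + (1 + c) * \<bar>a\<bar> * m\<^sup>2"
      using mult_left_mono[OF m2, of "(1 + c) * \<bar>a\<bar>"] c by simp
    also have "\<dots> = (4 * \<Omega> + 4 * \<Omega>\<^sup>2 + (1 + c) * \<bar>a\<bar>) * m\<^sup>2" by (simp add: algebra_simps)
    also have "\<dots> \<le> (m * c) * m\<^sup>2" using m(4) by (intro mult_right_mono) auto
    also have "\<dots> = c * m ^ 3" by (simp add: power2_eq_square power3_eq_cube)
    finally have 1: "Re (\<mu> ^ 3) + (1 + c) * \<bar>a\<bar> \<le> c * m ^ 3" using re by simp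
    have m3: "cmod (\<mu> ^ 3) = m ^ 3" by (simp add: m_def norm_power)
    have "m ^ 1 \<le> m ^ 3" using m(1) by (intro power_increasing) auto
    then have 2: "cmod (\<mu> ^ 3) \<ge> 2 * \<bar>a\<bar> + 1" using m(2) m3 by simp
    have "m ^ 3 - \<bar>a\<bar> \<le> cmod (\<mu> ^ 3 - of_real a)"
      using norm_triangle_ineq2[of "\<mu> ^ 3" "of_real a"] m3 by simp
    then have "c * (m ^ 3 - \<bar>a\<bar>) \<le> c * cmod (\<mu> ^ 3 - of_real a)" using c by (intro mult_left_mono) auto
    moreover have "Re (\<mu> ^ 3) - a \<le> c * (m ^ 3 - \<bar>a\<bar>)"
      using 1 abs_ge_minus_self[of a] by (simp add: algebra_simps)
    ultimately show ?thesis using 2 by simp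
  qed
  show ?thesis using r1 key by (intro exI[of _ r]) (meson not_less)
qed

section \<open>Reduction to the cube root of the operator\<close>

context sectorial_setting
begin

lemma A_R0: "A (R 0 x) = x"
  using R_eq[of 0 x] by simp

lemma R0_A: "x \<in> D \<Longrightarrow> R 0 (A x) = x"
  by (rule R_unique) auto

lemma R0_eq: "R 0 x = L (L (L x))"
  by (simp only: L_L L_P)

lemma L_inj: "L x = L y \<Longrightarrow> x = y"
  using A_R0[of x] A_R0[of y] by (simp add: R0_eq)

text \<open>\<open>1 - \<nu> A^(-1)\<close> is \<open>(A - \<nu>) A^(-1)\<close>, so its inverse is
  \<open>1 - \<nu> (\<nu> - A)^(-1)\<close>. The lower bound on \<open>cmod \<nu>\<close> gives
  \<open>cmod \<nu> \<le> 2 * cmod (\<nu> - a)\<close>, and the decay of the resolvent yields the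
  uniform bound \<open>1 + 2 * Ms\<close>.\<close>

lemma sector_pencil:
  "\<exists>a c Ks. c > 0 \<and> Ks \<ge> 0 \<and> (\<forall>\<nu>. cmod \<nu> \<ge> 2 * \<bar>a\<bar> + 1 \<and> Re \<nu> - a \<le> c * cmod (\<nu> - of_real a) \<longrightarrow>
     (\<forall>y. \<exists>x. x - sc \<nu> (R 0 x) = y) \<and> (\<forall>x. norm x \<le> Ks * norm (x - sc \<nu> (R 0 x))))"
proof -
  obtain a \<phi> Ms where S: "0 < \<phi>" "\<phi> < pi / 2" "Ms \<ge> 1"
    "\<forall>lam. lam \<noteq> complex_of_real a \<longrightarrow> Re lam - a \<le> cos \<phi> * cmod (lam - complex_of_real a) \<longrightarrow>
       lam \<in> \<rho> \<and> (\<forall>y. norm (Res lam y) \<le> Ms / cmod (lam - complex_of_real a) * norm y)"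
    using sector_resolvent by blast
  have cosp: "cos \<phi> > 0" using S by (intro cos_gt_zero) auto
  show ?thesis
  proof (rule exI[of _ a], rule exI[of _ "cos \<phi>"], rule exI[of _ "1 + 2 * Ms"], intro conjI allI impI cosp)
    show "0 \<le> 1 + 2 * Ms" using S(3) by simp
    fix \<nu> assume \<nu>: "cmod \<nu> \<ge> 2 * \<bar>a\<bar> + 1 \<and> Re \<nu> - a \<le> cos \<phi> * cmod (\<nu> - of_real a)"
    have "cmod \<nu> - \<bar>a\<bar> \<le> cmod (\<nu> - of_real a)"
      using norm_triangle_ineq2[of \<nu> "of_real a"] by simp
    then have far: "cmod \<nu> \<le> 2 * cmod (\<nu> - of_real a)" "cmod (\<nu> - of_real a) > 0" using \<nu> by linarith+
    then have res: "\<nu> \<in> \<rho>" "\<And>y. norm (Res \<nu> y) \<le> Ms / cmod (\<nu> - of_real a) * norm y"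
      using S(4) \<nu> by auto
    show "\<exists>x. x - sc \<nu> (R 0 x) = y" for y
    proof (intro exI[of _ "A (- Res \<nu> y)"])
      have "R 0 (A (- Res \<nu> y)) = - Res \<nu> y"
        by (intro R0_A D_minus Res_in res)
      then show "A (- Res \<nu> y) - sc \<nu> (R 0 (A (- Res \<nu> y))) = y"
        using Res_eq[OF res(1), of y] Res_in[OF res(1), of y] by (simp add: A_minus sc_minus_right)
    qed
    show "norm x \<le> (1 + 2 * Ms) * norm (x - sc \<nu> (R 0 x))" for x
    proof -
      define y where "y = x - sc \<nu> (R 0 x)"
      have "Res \<nu> y = - R 0 x"
        by (intro Res_unique[OF res(1)] D_minus R_in) (simp_all add: A_minus R_in A_R0 sc_minus_right y_def)
      then have x: "x = y - sc \<nu> (Res \<nu> y)" by (simp add: y_def sc_minus_right)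
      have "norm x \<le> norm y + norm (sc \<nu> (Res \<nu> y))" by (subst x) (rule norm_triangle_ineq4)
      also have "norm (sc \<nu> (Res \<nu> y)) \<le> (2 * cmod (\<nu> - of_real a)) * (Ms / cmod (\<nu> - of_real a) * norm y)"
        unfolding norm_sc using far by (intro mult_mono res) auto
      also have "\<dots> = 2 * Ms * norm y" using far(2) by simp
      finally show ?thesis by (simp add: y_def algebra_simps)
    qed
  qed
qed

text \<open>Everything is phrased with the bounded pencil \<open>1 - \<mu> L\<close> in place of
  \<open>\<mu> - C\<close>; in each of the three regions it is invertible with a bound of order
  \<open>cmod \<mu> ^ 2\<close>.\<close>

lemma bounded_of_half_planes:
  assumes \<kappa>: "cmod \<kappa> = 1" "0 < Re \<kappa>" "Re \<kappa> \<le> 1/2" and \<Omega>: "\<Omega> > 0" and K1: "K1 \<ge> 0"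
    and surj: "\<And>k lam y. k \<in> {\<kappa>, cnj \<kappa>} \<Longrightarrow> Re lam \<ge> \<Omega> \<Longrightarrow> \<exists>d. sc lam (L d) - sc k d = y"
    and low: "\<And>k lam d. k \<in> {\<kappa>, cnj \<kappa>} \<Longrightarrow> Re lam \<ge> \<Omega> \<Longrightarrow> norm (L d) \<le> K1 * norm (sc lam (L d) - sc k d)"
  shows "\<not> unbounded_operator D A"
proof -
  interpret L: bounded_linear L by (rule L_bounded_linear)
  obtain B where B: "B \<ge> 0" "\<And>x. norm (L x) \<le> B * norm x"
    using L.nonneg_bounded by (auto simp: mult.commute)
  obtain a c Ks where S: "c > 0" "Ks \<ge> 0" "\<And>\<nu> y. cmod \<nu> \<ge> 2 * \<bar>a\<bar> + 1 \<Longrightarrow> Re \<nu> - a \<le> c * cmod (\<nu> - of_real a) \<Longrightarrow>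
     \<exists>x. x - sc \<nu> (R 0 x) = y" 
     "\<And>\<nu> x. cmod \<nu> \<ge> 2 * \<bar>a\<bar> + 1 \<Longrightarrow> Re \<nu> - a \<le> c * cmod (\<nu> - of_real a) \<Longrightarrow> norm x \<le> Ks * norm (x - sc \<nu> (R 0 x))"
    using sector_pencil by metis
  obtain r where r: "r \<ge> 1" "\<And>\<mu>. cmod \<mu> \<ge> r \<Longrightarrow> Re (\<mu> * \<kappa>) \<ge> \<Omega> \<or> Re (\<mu> * cnj \<kappa>) \<ge> \<Omega> \<or>
     (cmod (\<mu> ^ 3) \<ge> 2 * \<bar>a\<bar> + 1 \<and> Re (\<mu> ^ 3) - a \<le> c * cmod (\<mu> ^ 3 - of_real a))"
    using half_planes_and_sector_cover[OF \<kappa> \<Omega> S(1), of a] by blast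
  define K where "K = (1 + K1) + Ks * (1 + B + B\<^sup>2)"
  have pencil: "(\<exists>x. x - sc \<mu> (L x) = y) \<and> norm z \<le> K * (cmod \<mu>)\<^sup>2 * norm (z - sc \<mu> (L z))" if \<mu>: "cmod \<mu> \<ge> r" for \<mu> y z
  proof -
    have \<mu>1: "1 \<le> cmod \<mu>" "1 \<le> (cmod \<mu>)\<^sup>2" "cmod \<mu> \<le> (cmod \<mu>)\<^sup>2"
      using r(1) \<mu> mult_right_mono[of 1 "cmod \<mu>" "cmod \<mu>"] by (auto simp: power2_eq_square)
    consider k where "k \<in> {\<kappa>, cnj \<kappa>}" "Re (\<mu> * k) \<ge> \<Omega>" 
      | "cmod (\<mu> ^ 3) \<ge> 2 * \<bar>a\<bar> + 1" "Re (\<mu> ^ 3) - a \<le> c * cmod (\<mu> ^ 3 - of_real a)"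
      using r(2)[OF \<mu>] by blast
    then show ?thesis
    proof cases
      case 1
      have k: "cmod k = 1" "k \<noteq> 0" using 1(1) \<kappa>(1) by auto
      \<comment> \<open>With \<open>lam = \<mu> * k\<close> and \<open>cmod k = 1\<close> the
        hypotheses become statements on \<open>1 - \<mu> L\<close>. They bound only
        \<open>L z\<close>; recovering \<open>z\<close> costs one factor
        \<open>cmod \<mu>\<close>.\<close>
      have eq: "sc (\<mu> * k) (L d) - sc k d = sc (- k) (d - sc \<mu> (L d))" for d
        by (simp add: sc_diff_right sc_minus_left mult.commute)
      obtain d where "sc (\<mu> * k) (L d) - sc k d = sc (- k) y" using surj[OF 1] by blast
      then have "sc (- 1 / k) (sc (- k) (d - sc \<mu> (L d))) = sc (- 1 / k) (sc (- k) y)" unfolding eq by simp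
      then have "d - sc \<mu> (L d) = y" using k(2) unfolding sc_sc by simp
      moreover have "norm z \<le> K * (cmod \<mu>)\<^sup>2 * norm (z - sc \<mu> (L z))"
      proof -
        let ?n = "norm (z - sc \<mu> (L z))"
        have "norm (L z) \<le> K1 * ?n"
          using low[OF 1, of z] unfolding eq norm_sc using k by simp
        then have "norm z \<le> ?n + cmod \<mu> * (K1 * ?n)"
          using norm_triangle_ineq[of "z - sc \<mu> (L z)" "sc \<mu> (L z)"] mult_left_mono[of "norm (L z)" "K1 * ?n" "cmod \<mu>"]
          by (simp add: norm_sc)
        also have "\<dots> \<le> (cmod \<mu>)\<^sup>2 * ?n + (cmod \<mu>)\<^sup>2 * (K1 * ?n)"
          using \<mu>1 K1 mult_right_mono[of 1 "(cmod \<mu>)\<^sup>2" ?n] by (intro add_mono mult_right_mono) auto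
        also have "\<dots> = (1 + K1) * ((cmod \<mu>)\<^sup>2 * ?n)" by (simp add: algebra_simps)
        also have "\<dots> \<le> K * ((cmod \<mu>)\<^sup>2 * ?n)"
          using S(2) B by (intro mult_right_mono) (auto simp: K_def)
        finally show ?thesis by (simp add: mult.assoc)
      qed
      ultimately show ?thesis by blast
    next
      case 2
      \<comment> \<open>The two orders of
        \<open>1 - \<mu>^3 L^3 = (1 - \<mu> L) (1 + \<mu> L + \<mu>^2 L^2)\<close>: this one
        transfers surjectivity, \<open>fac2\<close> the lower bound.\<close>
      have fac1: "x + sc \<mu> (L x) + sc (\<mu>\<^sup>2) (L (L x)) - sc \<mu> (L (x + sc \<mu> (L x) + sc (\<mu>\<^sup>2) (L (L x)))) = x - sc (\<mu> ^ 3) (R 0 x)" for x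
        by (simp add: L.add sc_add_right L_sc R0_eq power2_eq_square power3_eq_cube mult.assoc)
      have fac2: "x - sc (\<mu> ^ 3) (R 0 x) = (x - sc \<mu> (L x)) + sc \<mu> (L (x - sc \<mu> (L x))) + sc (\<mu>\<^sup>2) (L (L (x - sc \<mu> (L x))))" for x
        by (simp add: L.diff sc_diff_right L_sc R0_eq power2_eq_square power3_eq_cube mult.assoc)
      obtain x where "x - sc (\<mu> ^ 3) (R 0 x) = y" using S(3)[OF 2] by blast
      then have "\<exists>x. x - sc \<mu> (L x) = y" using fac1[of x] by metis
      moreover have "norm z \<le> K * (cmod \<mu>)\<^sup>2 * norm (z - sc \<mu> (L z))"
      proof -
        define y where "y = z - sc \<mu> (L z)"
        have "norm (z - sc (\<mu> ^ 3) (R 0 z)) \<le> norm y + norm (sc \<mu> (L y)) + norm (sc (\<mu>\<^sup>2) (L (L y)))"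
          unfolding fac2 y_def[symmetric] 
          by (rule order_trans[OF norm_triangle_ineq add_mono[OF norm_triangle_ineq order_refl]])
        also have "\<dots> \<le> (cmod \<mu>)\<^sup>2 * norm y + (cmod \<mu>)\<^sup>2 * (B * norm y) + (cmod \<mu>)\<^sup>2 * (B * (B * norm y))"
        proof (intro add_mono)
          show "norm y \<le> (cmod \<mu>)\<^sup>2 * norm y" using mult_right_mono[OF \<mu>1(2), of "norm y"] by simp
          show "norm (sc \<mu> (L y)) \<le> (cmod \<mu>)\<^sup>2 * (B * norm y)"
            unfolding norm_sc using \<mu>1 B by (intro mult_mono) auto
          have "norm (L (L y)) \<le> B * (B * norm y)" using B by (meson mult_left_mono order_trans)
          then show "norm (sc (\<mu>\<^sup>2) (L (L y))) \<le> (cmod \<mu>)\<^sup>2 * (B * (B * norm y))"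
            unfolding norm_sc norm_power by (intro mult_left_mono) auto
        qed
        also have "\<dots> = (1 + B + B\<^sup>2) * ((cmod \<mu>)\<^sup>2 * norm y)" by (simp add: power2_eq_square algebra_simps)
        finally have "Ks * norm (z - sc (\<mu> ^ 3) (R 0 z)) \<le> Ks * ((1 + B + B\<^sup>2) * ((cmod \<mu>)\<^sup>2 * norm y))"
          using S(2) by (rule mult_left_mono)
        then have "norm z \<le> (Ks * (1 + B + B\<^sup>2)) * ((cmod \<mu>)\<^sup>2 * norm y)"
          using S(4)[OF 2, of z] by (simp add: mult.assoc)
        also have "\<dots> \<le> K * ((cmod \<mu>)\<^sup>2 * norm y)"
          using K1 by (intro mult_right_mono) (auto simp: K_def)
        finally show ?thesis by (simp add: y_def mult.assoc)
      qed
      ultimately show ?thesis by blast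
    qed
  qed
  obtain C where C: "C \<ge> 0" "\<And>w. norm (L (L (L w))) \<le> C * norm (L (L (L (L w))))"
    using inverse_pencil_estimate[OF L_bounded_linear L_sc r(1)] pencil by blast
  \<comment> \<open>The estimate holds on the range of \<open>L^3\<close>, which contains the dense
    set \<open>D\<close> because \<open>v = L^3 (A v)\<close> there; closedness extends it to the
    whole space.\<close>
  have all: "norm v \<le> C * norm (L v)" for v
  proof -
    have "closed {v. norm v \<le> C * norm (L v)}"
      by (intro closed_Collect_le continuous_intros linear_continuous_on L_bounded_linear)
    moreover have "D \<subseteq> {v. norm v \<le> C * norm (L v)}"
    proof
      fix v assume "v \<in> D"
      then have "v = L (L (L (A v)))" using R0_A R0_eq by metis
      then show "v \<in> {v. norm v \<le> C * norm (L v)}" using C(2)[of "A v"] by simp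
    qed
    ultimately have "closure D \<subseteq> {v. norm v \<le> C * norm (L v)}" by (rule closure_minimal[rotated])
    then show ?thesis using sect unfolding sectorial_def by auto
  qed
  \<comment> \<open>Three applications pass from \<open>A x\<close> to
    \<open>L^3 (A x) = x\<close>.\<close>
  have "norm (A x) \<le> (C * (C * C)) * norm x" if "x \<in> D" for x
  proof -
    have "norm (A x) \<le> C * norm (L (A x))" by (rule all)
    also have "\<dots> \<le> C * (C * norm (L (L (A x))))" by (intro mult_left_mono all C)
    also have "\<dots> \<le> C * (C * (C * norm (L (L (L (A x))))))" by (intro mult_left_mono all C)
    also have "L (L (L (A x))) = x" using R0_A[OF that] by (simp add: R0_eq)
    finally show ?thesis by (simp add: mult.assoc)
  qed
  then show ?thesis unfolding unbounded_operator_def by blast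
qed

end

section \<open>Rescaled semigroups on the threefold product\<close>

context complex_hilbert_space
begin

lemma norm_sc3: "norm (sc3 sc a x) = cmod a * norm x"
  by (cases x) (simp add: sc3_def norm_sc norm_Pair power_mult_distrib real_sqrt_mult flip: distrib_left)

lemma bounded_bilinear_sc3: "bounded_bilinear (sc3 sc)"
proof
  fix a b :: complex and x y :: "'a \<times> 'a \<times> 'a" and r :: real
  show "sc3 sc (a + b) x = sc3 sc a x + sc3 sc b x" by (cases x) (simp add: sc3_def sc_add_left)
  show "sc3 sc a (x + y) = sc3 sc a x + sc3 sc a y" by (cases x, cases y) (simp add: sc3_def sc_add_right)
  show "sc3 sc (r *\<^sub>R a) x = r *\<^sub>R sc3 sc a x"
    by (cases x) (simp add: sc3_def scaleR_conv_of_real flip: sc_sc)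
  show "sc3 sc a (r *\<^sub>R x) = r *\<^sub>R sc3 sc a x" by (cases x) (simp add: sc3_def sc_scaleR)
next
  show "\<exists>K. \<forall>a x. norm (sc3 sc a x) \<le> norm a * norm x * K"
    by (intro exI[of _ 1]) (simp add: norm_sc3)
qed

lemma sc3_sc3: "sc3 sc a (sc3 sc b x) = sc3 sc (a * b) x"
  by (cases x) (simp add: sc3_def)

lemma sc3_of_real: "sc3 sc (of_real r) x = r *\<^sub>R x"
  by (cases x) (simp add: sc3_def)

lemma sc3_one [simp]: "sc3 sc 1 x = x"
  by (cases x) (simp add: sc3_def)

text \<open>The product rule for e^(m t) S(t), which adds m to the generator. Rescaling by
  \<open>- lam\<close> and back by \<open>lam\<close> gives an equivalence of graphs.\<close>

lemma gen_at_rescale: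
  assumes "gen_at S x y"
  shows "gen_at (\<lambda>t x. sc3 sc (exp (m * of_real t)) (S t x)) x (y + sc3 sc m x)"
proof -
  interpret b: bounded_bilinear "sc3 sc" by (rule bounded_bilinear_sc3)
  have of_real_lim: "filterlim complex_of_real (at 0) (at_right 0)"
    unfolding filterlim_at by (auto intro!: tendsto_eq_intros simp: eventually_at_filter)
  have e1: "((\<lambda>h. exp (m * complex_of_real h)) \<longlongrightarrow> 1) (at_right 0)"
    by (auto intro!: tendsto_eq_intros)
  have "((\<lambda>z. exp (m * z)) has_field_derivative m) (at 0)"
    by (auto intro!: derivative_eq_intros)
  then have "((\<lambda>z. (exp (m * z) - 1) / z) \<longlongrightarrow> m) (at 0)"
    by (simp add: has_field_derivative_iff)
  from filterlim_compose[OF this of_real_lim]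
  have e2: "((\<lambda>h. (exp (m * complex_of_real h) - 1) / of_real h) \<longlongrightarrow> m) (at_right 0)" .
  have "((\<lambda>h. sc3 sc (exp (m * complex_of_real h)) ((1 / h) *\<^sub>R (S h x - x)) + sc3 sc ((exp (m * complex_of_real h) - 1) / of_real h) x)
     \<longlongrightarrow> sc3 sc 1 y + sc3 sc m x) (at_right 0)"
    using assms unfolding gen_at_def by (intro tendsto_add b.tendsto e1 e2 tendsto_const)
  moreover have "\<forall>\<^sub>F h in at_right 0. sc3 sc (exp (m * complex_of_real h)) ((1 / h) *\<^sub>R (S h x - x)) + sc3 sc ((exp (m * complex_of_real h) - 1) / of_real h) x
      = (1 / h) *\<^sub>R (sc3 sc (exp (m * of_real h)) (S h x) - x)"
  proof -
    have eq: "sc3 sc e ((1 / h) *\<^sub>R (S h x - x)) + sc3 sc ((e - 1) / of_real h) x = (1 / h) *\<^sub>R (sc3 sc e (S h x) - x)" for e h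
    proof -
      have "sc3 sc ((e - 1) / of_real h) x = (1 / h) *\<^sub>R (sc3 sc e x - x)"
        using b.scaleR_left[of "1 / h" "e - 1" x] by (simp add: scaleR_conv_of_real b.diff_left divide_inverse mult.commute)
      then show ?thesis by (simp add: b.scaleR_right b.diff_right scaleR_diff_right)
    qed
    show ?thesis by (rule always_eventually) (use eq in blast)
  qed
  ultimately show ?thesis unfolding gen_at_def by (simp add: Lim_transform_eventually)
qed

end

section \<open>Transport from Z to the threefold product\<close>

context sectorial_setting
begin

definition J :: "'a \<times> 'a \<times> 'a \<Rightarrow> 'a \<times> 'a \<times> 'a" where
  "J z = (case z of (p, q, r) \<Rightarrow> (P p, L q, r))"

text \<open>Total, but an inverse of \<open>J\<close> only on \<open>Zspace\<close>: elsewhere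
  \<open>frac_pow\<close> is a description without a witness in at least one component.\<close>

definition Jinv :: "'a \<times> 'a \<times> 'a \<Rightarrow> 'a \<times> 'a \<times> 'a" where
  "Jinv z = (case z of (u, v, w) \<Rightarrow> (frac_pow sc D A (2/3) u, frac_pow sc D A (1/3) v, w))"

lemma frac_pow_L: "frac_pow sc D A (1/3) (L y) = y"
  unfolding frac_pow_def by (auto dest: L_inj)

lemma frac_pow_P: "frac_pow sc D A (2/3) (P y) = y"
  unfolding frac_pow_def by (auto simp flip: L_L dest!: L_inj)

lemma frac_dom_eq:
  "frac_dom sc D A (1/3) = range L" "frac_dom sc D A (2/3) = range P" "frac_dom sc D A 1 = range (\<lambda>x. L (P x))"
proof -
  show "frac_dom sc D A (1/3) = range L" "frac_dom sc D A (2/3) = range P" by (simp_all add: frac_dom_def)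
  have "D = range (R 0)" using R0_A R_in[of 0] by (auto simp: image_iff) (metis R0_A)
  then show "frac_dom sc D A 1 = range (\<lambda>x. L (P x))" by (simp add: frac_dom_def L_P)
qed

lemma Jinv_J [simp]: "Jinv (J z) = z"
  by (cases z) (simp add: J_def Jinv_def frac_pow_L frac_pow_P)

lemma Zspace_eq: "Zspace sc D A = range J"
  unfolding Zspace_def frac_dom_eq J_def by (auto simp: image_iff)

lemma J_Jinv: "z \<in> Zspace sc D A \<Longrightarrow> J (Jinv z) = z"
  unfolding Zspace_eq by auto

lemma Znorm_eq: "Znorm sc D A z = norm (Jinv z)"
  by (cases z) (simp add: Znorm_def Jinv_def norm_Pair add.assoc)

lemma bounded_linear_J: "bounded_linear J"
proof -
  have "bounded_linear P" unfolding L_L[symmetric, abs_def]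
    by (rule bounded_linear_compose[OF L_bounded_linear L_bounded_linear])
  then have "bounded_linear (\<lambda>z. (P (fst z), L (fst (snd z)), snd (snd z)))"
    by (intro bounded_linear_Pair bounded_linear_compose[OF _ bounded_linear_fst] bounded_linear_compose[OF L_bounded_linear]
       bounded_linear_compose[OF bounded_linear_fst bounded_linear_snd] bounded_linear_compose[OF bounded_linear_snd bounded_linear_snd]) 
  then show ?thesis by (simp add: J_def[abs_def] case_prod_unfold)
qed

lemma J_sc3: "J (sc3 sc a z) = sc3 sc a (J z)"
  by (cases z) (simp add: J_def sc3_def L_sc flip: L_L)

text \<open>Parametrising the domain as \<open>(L a, L b, L c)\<close> makes the unbounded factor C
  disappear: what remains is the scalar matrix -M applied to \<open>(a, b, c)\<close>.\<close>

lemma B_op_J: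
  "- B_op sc D A \<eta> (J (L a, L b, L c)) = J (b - a, c, (1 - \<eta>) *\<^sub>R c - b)"
proof -
  interpret L: bounded_linear L by (rule L_bounded_linear)
  have "P (L a) = L (P a)" by (simp flip: L_L)
  moreover have "L (L b) = P b" by (rule L_L)
  ultimately show ?thesis
    by (simp add: J_def B_op_def frac_pow_L frac_pow_P algebra_simps) (simp add: L.diff flip: L_L)
qed

lemma J_in_B_dom_iff: "J z \<in> B_dom sc D A \<longleftrightarrow> (\<exists>a b c. z = (L a, L b, L c))"
proof
  assume "J z \<in> B_dom sc D A"
  then obtain a b c where "J z = (L (P a), P b, L c)" unfolding B_dom_def frac_dom_eq by auto
  moreover have "L (P a) = P (L a)" by (simp flip: L_L)
  moreover have "P b = L (L b)" by (simp add: L_L)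
  ultimately have "J z = J (L a, L b, L c)" by (simp add: J_def)
  then have "z = (L a, L b, L c)" by (metis Jinv_J)
  then show "\<exists>a b c. z = (L a, L b, L c)" by blast
next
  assume "\<exists>a b c. z = (L a, L b, L c)"
  then obtain a b c where z: "z = (L a, L b, L c)" by blast
  have "P (L a) = L (P a)" "L (L b) = P b" by (simp_all flip: L_L)
  then show "J z \<in> B_dom sc D A" unfolding z B_dom_def frac_dom_eq J_def by auto
qed

text \<open>The resolvent half of the Hille-Yosida theorem, obtained without Laplace transforms:
  after multiplication by e^(-lam t) the semigroup is a strict contraction at time \<open>d\<close>,
  so its generator is boundedly invertible.\<close>

lemma generator_pencil_estimate:
  assumes gen: "is_C0_generator (Zspace sc D A) (Znorm sc D A) (sc3 sc) (B_dom sc D A) (\<lambda>z. - B_op sc D A \<eta> z)"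
  shows "\<exists>\<Omega>>0. \<exists>K\<ge>0. \<forall>lam. Re lam \<ge> \<Omega> \<longrightarrow>
     (\<forall>f. \<exists>a b c. sc3 sc lam (L a, L b, L c) - (b - a, c, (1 - \<eta>) *\<^sub>R c - b) = f) \<and>
     (\<forall>a b c. norm (L a, L b, L c) \<le> K * norm (sc3 sc lam (L a, L b, L c) - (b - a, c, (1 - \<eta>) *\<^sub>R c - b)))"
proof -
  interpret J: bounded_linear J by (rule bounded_linear_J)
  interpret s3: bounded_bilinear "sc3 sc" by (rule bounded_bilinear_sc3)
  let ?Z = "Zspace sc D A" and ?N = "Znorm sc D A"
  obtain T where T: "C0_semigroup_on ?Z ?N (sc3 sc) T"
    and dom: "B_dom sc D A = {z \<in> ?Z. \<exists>y\<in>?Z. ((\<lambda>t. ?N ((1 / t) *\<^sub>R (T t z - z) - y)) \<longlongrightarrow> 0) (at_right 0)}"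
    and G: "\<And>z. z \<in> B_dom sc D A \<Longrightarrow> - B_op sc D A \<eta> z \<in> ?Z \<and>
         ((\<lambda>t. ?N ((1 / t) *\<^sub>R (T t z - z) - (- B_op sc D A \<eta> z))) \<longlongrightarrow> 0) (at_right 0)"
    using gen unfolding is_C0_generator_def by blast
  have JZ: "J x \<in> ?Z" for x by (simp add: Zspace_eq)
  note T_parts = T[unfolded C0_semigroup_on_def]
  have T_op: "T t ` ?Z \<subseteq> ?Z" "clinear_on (sc3 sc) (sc3 sc) ?Z (T t)" "\<exists>K. \<forall>z\<in>?Z. ?N (T t z) \<le> K * ?N z" if "t \<ge> 0" for t
    using T_parts[THEN conjunct1, THEN spec, THEN mp, OF that] by auto
  have TZ: "T t (J x) \<in> ?Z" if "t \<ge> 0" for t x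
    using T_op(1)[OF that] JZ by blast
  have T_add: "T t (J x + J y) = T t (J x) + T t (J y)" if "t \<ge> 0" for t x y
    using T_op(2)[OF that] JZ unfolding clinear_on_def by blast
  have T_sc: "T t (sc3 sc a (J x)) = sc3 sc a (T t (J x))" if "t \<ge> 0" for t x a
    using T_op(2)[OF that] JZ unfolding clinear_on_def by blast
  \<comment> \<open>Conjugation by \<open>J\<close> moves the semigroup from Z to the Banach space
    of triples, where the type class norm is available.\<close>
  define U where "U t x = Jinv (T t (J x))" for t x
  have JU: "J (U t x) = T t (J x)" if "t \<ge> 0" for t x
    unfolding U_def by (rule J_Jinv[OF TZ[OF that]])
  have J_inj: "J x = J y \<Longrightarrow> x = y" for x y by (metis Jinv_J)
  have U_sc: "U t (sc3 sc a x) = sc3 sc a (U t x)" if "t \<ge> 0" for t a x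
    by (rule J_inj) (simp add: JU that T_sc J_sc3)
  have U_bl: "bounded_linear (U t)" if t: "t \<ge> 0" for t
  proof -
    obtain K where K: "\<forall>z\<in>?Z. ?N (T t z) \<le> K * ?N z"
      using T_op(3)[OF t] by blast
    show ?thesis
    proof (rule bounded_linear_intro[of _ K])
      show "U t (x + y) = U t x + U t y" for x y
        by (rule J_inj) (simp add: JU t J.add T_add)
      show "U t (r *\<^sub>R x) = r *\<^sub>R U t x" for r x
        using U_sc[OF t, of "of_real r" x] by (simp add: sc3_of_real)
      show "norm (U t x) \<le> norm x * K" for x
        using bspec[OF K JZ, of x] by (simp add: Znorm_eq U_def mult.commute)
    qed
  qed
  have U0: "U 0 x = x" for x
    using T_parts[THEN conjunct2, THEN conjunct1] JZ unfolding U_def by simp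
  have U_sg: "U (t + s) x = U t (U s x)" if "t \<ge> 0" "s \<ge> 0" for t s x
  proof (rule J_inj)
    have "T (t + s) (J x) = T t (T s (J x))"
      using T_parts[THEN conjunct2, THEN conjunct2, THEN conjunct1] that JZ by blast
    then show "J (U (t + s) x) = J (U t (U s x))" using that by (simp add: JU)
  qed
  have N_diff: "?N ((1 / t) *\<^sub>R (T t (J x) - J x) - J y) = norm ((1 / t) *\<^sub>R (U t x - x) - y)" if "t \<ge> 0" for t x y
  proof -
    have "(1 / t) *\<^sub>R (T t (J x) - J x) - J y = J ((1 / t) *\<^sub>R (U t x - x) - y)"
      by (simp add: J.diff J.scaleR JU that)
    then show ?thesis by (simp add: Znorm_eq)
  qed
  have pos: "\<forall>\<^sub>F t in at_right (0::real). t \<ge> 0" by (simp add: eventually_at_filter)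
  have U_cont: "((\<lambda>t. U t x) \<longlongrightarrow> x) (at_right 0)" for x
  proof -
    have lim: "((\<lambda>t. ?N (T t (J x) - J x)) \<longlongrightarrow> 0) (at_right 0)"
      using T_parts[THEN conjunct2, THEN conjunct2, THEN conjunct2] JZ by blast
    have "\<forall>\<^sub>F t in at_right 0. ?N (T t (J x) - J x) = norm (U t x - x)"
      using pos
    proof eventually_elim
      case (elim t)
      then have "T t (J x) - J x = J (U t x - x)" by (simp add: J.diff JU)
      then show ?case by (simp add: Znorm_eq)
    qed
    from Lim_transform_eventually[OF lim this] show ?thesis
      by (simp add: tendsto_norm_zero_iff LIM_zero_iff)
  qed
  have N_gen: "((\<lambda>t. ?N ((1 / t) *\<^sub>R (T t (J x) - J x) - J y)) \<longlongrightarrow> 0) (at_right 0) \<longleftrightarrow> gen_at U x y" for x y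
  proof -
    have "\<forall>\<^sub>F t in at_right 0. ?N ((1 / t) *\<^sub>R (T t (J x) - J x) - J y) = norm ((1 / t) *\<^sub>R (U t x - x) - y)"
      using pos by eventually_elim (rule N_diff)
    from tendsto_cong[OF this] show ?thesis
      by (simp add: gen_at_def tendsto_norm_zero_iff LIM_zero_iff)
  qed
  have gen_L: "gen_at U (L a, L b, L c) (b - a, c, (1 - \<eta>) *\<^sub>R c - b)" for a b c
  proof -
    have "J (L a, L b, L c) \<in> B_dom sc D A" unfolding J_in_B_dom_iff by blast
    from G[OF this] show ?thesis unfolding B_op_J N_gen by blast
  qed
  \<comment> \<open>This uses the reverse inclusion of domains: every pair in the graph comes from
    \<open>B_dom\<close>, not merely conversely. Surjectivity of the pencil depends on it.\<close>
  have gen_dest: "\<exists>a b c. x = (L a, L b, L c) \<and> y = (b - a, c, (1 - \<eta>) *\<^sub>R c - b)" if "gen_at U x y" for x y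
  proof -
    have "J x \<in> B_dom sc D A" unfolding dom using that JZ N_gen by blast
    then obtain a b c where x: "x = (L a, L b, L c)" unfolding J_in_B_dom_iff by blast
    have "y = (b - a, c, (1 - \<eta>) *\<^sub>R c - b)"
      using that gen_L[of a b c] unfolding x gen_at_def by (rule tendsto_unique[rotated]) simp
    then show ?thesis using x by blast
  qed
  obtain d0 M0 where d0: "d0 > 0" "M0 \<ge> 0" "\<And>t x. t \<in> {0..d0} \<Longrightarrow> norm (U t x) \<le> M0 * norm x"
    using semigroup_bounded_near_0[OF U_bl U0 U_cont] by blast
  \<comment> \<open>Halved because the bijectivity lemma integrates up to \<open>d + h\<close> and
    needs the bound on \<open>{0..2*d}\<close>.\<close>
  define d where "d = d0 / 2"
  define M where "M = max 1 M0"
  have d: "d > 0" "M \<ge> 1" "\<And>t x. t \<in> {0..2*d} \<Longrightarrow> norm (U t x) \<le> M * norm x"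
    using d0 by (auto simp: d_def M_def intro: order_trans[OF _ mult_right_mono[of M0 "max 1 M0"]])
  \<comment> \<open>Chosen so that \<open>M * exp (- \<Omega> * d) = 1/2\<close>.\<close>
  define \<Omega> where "\<Omega> = ln (2 * M) / d"
  have \<Omega>: "\<Omega> > 0" using d by (simp add: \<Omega>_def)
  have key: "(\<exists>a b c. sc3 sc lam (L a, L b, L c) - (b - a, c, (1 - \<eta>) *\<^sub>R c - b) = f) \<and>
     norm (L a', L b', L c') \<le> 2 * d * M * norm (sc3 sc lam (L a', L b', L c') - (b' - a', c', (1 - \<eta>) *\<^sub>R c' - b'))"
    if lam: "Re lam \<ge> \<Omega>" for lam f a' b' c'
  proof -
    define S where "S t x = sc3 sc (exp (- lam * of_real t)) (U t x)" for t x
    have S_gen: "gen_at S x y \<longleftrightarrow> gen_at U x (y + sc3 sc lam x)" for x y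
    proof
      assume "gen_at S x y"
      from gen_at_rescale[OF this, of lam] show "gen_at U x (y + sc3 sc lam x)"
        by (simp add: S_def sc3_sc3 flip: exp_add)
    next
      assume "gen_at U x (y + sc3 sc lam x)"
      from gen_at_rescale[OF this, of "- lam"] show "gen_at S x y"
        by (simp add: S_def[abs_def] s3.minus_left)
    qed
    have e: "norm (S t x) = exp (- (Re lam * t)) * norm (U t x)" for t x
      by (simp add: S_def norm_sc3)
    have S_bl: "bounded_linear (S t)" if "t \<ge> 0" for t
      unfolding S_def[abs_def] by (rule bounded_linear_compose[OF s3.bounded_linear_right U_bl[OF that]])
    have S0: "S 0 x = x" for x by (simp add: S_def U0)
    have S_sg: "S (s + t) x = S s (S t x)" if "s \<ge> 0" "t \<ge> 0" for s t x
      using that by (simp add: S_def U_sg U_sc sc3_sc3 distrib_left flip: exp_add)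
    have S_cont: "((\<lambda>t. S t x) \<longlongrightarrow> x) (at_right 0)" for x
    proof -
      have "((\<lambda>t. exp (- lam * complex_of_real t)) \<longlongrightarrow> 1) (at_right 0)"
        by (auto intro!: tendsto_eq_intros)
      from s3.tendsto[OF this U_cont[of x]] show ?thesis by (simp add: S_def)
    qed
    have S_bd: "norm (S t x) \<le> M * norm x" if "t \<in> {0..2*d}" for t x
    proof -
      have "exp (- (Re lam * t)) \<le> 1" using that lam \<Omega> by simp
      then have "exp (- (Re lam * t)) * norm (U t x) \<le> 1 * (M * norm x)"
        using d(3)[OF that] by (intro mult_mono) auto
      then show ?thesis by (simp add: e)
    qed
    have S_half: "norm (S d x) \<le> norm x / 2" for x
    proof -
      have "ln (2 * M) \<le> Re lam * d" using lam d(1) by (simp add: \<Omega>_def pos_divide_le_eq)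
      then have "exp (- (Re lam * d)) \<le> exp (- ln (2 * M))" by simp
      also have "\<dots> = 1 / (2 * M)" using d(2) by (simp add: exp_minus inverse_eq_divide)
      finally have "exp (- (Re lam * d)) * norm (U d x) \<le> 1 / (2 * M) * (M * norm x)"
        using d by (intro mult_mono) auto
      then show ?thesis using d(2) by (simp add: e)
    qed
    have S_surj: "\<exists>x. gen_at S x y" for y
      by (rule contractive_semigroup_generator_bijective(1)[OF S_bl S0 S_sg S_cont d(1) S_bd S_half])
    have S_low: "norm x \<le> 2 * d * M * norm y" if "gen_at S x y" for x y
      by (rule contractive_semigroup_generator_bijective(2)[OF S_bl S0 S_sg S_cont d(1) S_bd S_half that])
    have "\<exists>a b c. sc3 sc lam (L a, L b, L c) - (b - a, c, (1 - \<eta>) *\<^sub>R c - b) = f"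
    proof -
      \<comment> \<open>The generator of \<open>S\<close> is that of \<open>U\<close> minus
        \<open>lam\<close>, the negative of the pencil; hence the sign of \<open>f\<close>.\<close>
      obtain x where "gen_at S x (- f)" using S_surj by blast
      then have "gen_at U x (- f + sc3 sc lam x)" unfolding S_gen .
      then obtain a b c where x: "x = (L a, L b, L c)" and y: "- f + sc3 sc lam x = (b - a, c, (1 - \<eta>) *\<^sub>R c - b)"
        using gen_dest by blast
      have "sc3 sc lam x - (- f + sc3 sc lam x) = f" by simp
      then show ?thesis unfolding y unfolding x by blast
    qed
    moreover have "norm (L a', L b', L c') \<le> 2 * d * M * norm (sc3 sc lam (L a', L b', L c') - (b' - a', c', (1 - \<eta>) *\<^sub>R c' - b'))"
    proof -
      let ?x = "(L a', L b', L c')" and ?y = "(b' - a', c', (1 - \<eta>) *\<^sub>R c' - b')"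
      have "gen_at S ?x (?y - sc3 sc lam ?x)" unfolding S_gen using gen_L by simp
      from S_low[OF this] show ?thesis unfolding norm_minus_commute[of ?y] .
    qed
    ultimately show ?thesis by blast
  qed
  show ?thesis
    using \<Omega> d key by (intro exI[of _ \<Omega>] conjI exI[of _ "2 * d * M"]) auto
qed

end

section \<open>Eigenvectors of the scalar matrix and the contradiction\<close>

theorem theorem3p5:
  fixes sc :: "complex \<Rightarrow> 'a::banach \<Rightarrow> 'a"
    and ip :: "'a \<Rightarrow> 'a \<Rightarrow> complex"
    and D :: "'a set" and A :: "'a \<Rightarrow> 'a"
    and lam0 \<eta> :: real
  assumes "complex_hilbert sc ip"
    and "separable_set (UNIV :: 'a set)"
    and "sectorial sc D A"
    and "unbounded_operator D A"
    and "compact_resolvent sc D A"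
    and "lam0 > 0"
    and "\<forall>mu\<in>spectrum_op sc D A. Re mu > lam0"
    and "0 \<le> \<eta>" and "\<eta> < 1"
  shows "\<not> is_C0_generator (Zspace sc D A) (Znorm sc D A) (sc3 sc)
            (B_dom sc D A) (\<lambda>z. - B_op sc D A \<eta> z)"
proof
  assume gen: "is_C0_generator (Zspace sc D A) (Znorm sc D A) (sc3 sc) (B_dom sc D A) (\<lambda>z. - B_op sc D A \<eta> z)"
  interpret sectorial_setting sc ip D A lam0
    using assms by unfold_locales (auto simp: sectorial_def)
  interpret L: bounded_linear L by (rule L_bounded_linear)
  obtain \<Omega> K where \<Omega>: "\<Omega> > 0" and K: "K \<ge> 0"
    and surj: "\<And>lam f. Re lam \<ge> \<Omega> \<Longrightarrow> \<exists>a b c. sc3 sc lam (L a, L b, L c) - (b - a, c, (1 - \<eta>) *\<^sub>R c - b) = f"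
    and low: "\<And>lam a b c. Re lam \<ge> \<Omega> \<Longrightarrow> 
       norm (L a, L b, L c) \<le> K * norm (sc3 sc lam (L a, L b, L c) - (b - a, c, (1 - \<eta>) *\<^sub>R c - b))"
    using generator_pencil_estimate[OF gen] by blast
  \<comment> \<open>A root of \<open>k^2 - (1 - \<eta>) k + 1\<close>, the cofactor of
    \<open>k + 1\<close> in the characteristic polynomial of -M.\<close>
  define \<kappa> where "\<kappa> = Complex ((1 - \<eta>) / 2) (sqrt (1 - ((1 - \<eta>) / 2)\<^sup>2))"
  have sq: "((1 - \<eta>) / 2)\<^sup>2 \<le> 1"
    using assms(8,9) by (intro power_le_one) auto
  have \<kappa>1: "cmod \<kappa> = 1" using sq by (simp add: \<kappa>_def cmod_def)
  have root: "k * k = of_real (1 - \<eta>) * k - 1" and k1: "cmod k = 1" and kre: "Re k > 0" if k: "k \<in> {\<kappa>, cnj \<kappa>}" for k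
  proof -
    show k1: "cmod k = 1" using k \<kappa>1 by auto
    have re: "Re k = (1 - \<eta>) / 2" using k by (auto simp: \<kappa>_def)
    then show "Re k > 0" using assms(9) by simp
    have "k + cnj k = of_real (1 - \<eta>)" using re by (simp add: complex_eq_iff)
    moreover have "k * cnj k = 1" using k1 by (simp flip: complex_norm_square)
    ultimately have "of_real (1 - \<eta>) * k = k * k + 1" by (metis distrib_right mult.commute)
    then show "k * k = of_real (1 - \<eta>) * k - 1" by simp
  qed
  have "\<not> unbounded_operator D A"
  proof (rule bounded_of_half_planes[OF \<kappa>1 _ _ \<Omega>])
    show "0 < Re \<kappa>" "Re \<kappa> \<le> 1/2" using assms(8,9) by (auto simp: \<kappa>_def)
    show "3 * K \<ge> 0" using K by simp
    fix k lam assume k: "k \<in> {\<kappa>, cnj \<kappa>}" and lam: "Re lam \<ge> \<Omega>"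
    show "\<exists>d. sc lam (L d) - sc k d = y" for y
    proof - \<comment> \<open>\<open>(0, 1, -k)\<close> is a left eigenvector of \<open>-M\<close> for the eigenvalue \<open>k\<close>\<close>
      obtain a b c where "sc3 sc lam (L a, L b, L c) - (b - a, c, (1 - \<eta>) *\<^sub>R c - b) = (0, y, 0)"
        using surj[OF lam] by blast
      then have b: "sc lam (L b) = y + c" and c: "sc lam (L c) = (1 - \<eta>) *\<^sub>R c - b"
        by (auto simp: sc3_def algebra_simps)
      have "sc lam (L (b - sc k c)) = sc lam (L b) - sc k (sc lam (L c))"
        by (simp add: L.diff L_sc sc_diff_right mult.commute)
      also have "\<dots> = y + c - (sc (of_real (1 - \<eta>) * k) c - sc k b)"
        by (simp only: b c sc_diff_right sc_scaleR) (simp add: mult.commute flip: sc_of_real)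
      finally have "sc lam (L (b - sc k c)) - sc k (b - sc k c) = y + c - sc (of_real (1 - \<eta>) * k) c + sc (k * k) c"
        by (simp add: sc_diff_right)
      also have "\<dots> = y" unfolding root[OF k] sc_diff_left by simp
      finally show ?thesis by blast
    qed
    show "norm (L d) \<le> 3 * K * norm (sc lam (L d) - sc k d)" for d
    proof - \<comment> \<open>\<open>(1 / (1 + k), 1, k)\<close> is a right eigenvector of \<open>-M\<close> for the eigenvalue \<open>k\<close>\<close>
      define e where "e = 1 / (1 + k)"
      define w where "w = sc lam (L d) - sc k d"
      \<comment> \<open>\<open>Re k > 0\<close> keeps \<open>1 + k\<close> away from 0; all three
        entries of the eigenvector have modulus at most 1, whence the factor 3.\<close>
      have "Re (1 + k) \<le> cmod (1 + k)" by (rule complex_Re_le_cmod)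
      then have ge: "cmod (1 + k) \<ge> 1" using kre[OF k] by simp
      then have e1: "cmod e \<le> 1" and nz: "1 + k \<noteq> 0" by (auto simp: e_def norm_divide divide_le_eq)
      have "1 - e = e * k" using nz by (simp add: e_def field_simps)
      then have x1: "d - sc e d = sc (e * k) d" by (metis sc_diff_left sc_one)
      have x3: "(1 - \<eta>) *\<^sub>R sc k d - d = sc (k * k) d"
        unfolding root[OF k] by (simp add: sc_diff_left flip: sc_of_real)
      have "sc3 sc lam (L (sc e d), L d, L (sc k d)) - (d - sc e d, sc k d, (1 - \<eta>) *\<^sub>R sc k d - d) = (sc e w, w, sc k w)"
        unfolding x1 x3 by (simp add: sc3_def w_def sc_diff_right L_sc mult.commute)
      then have "norm (L (sc e d), L d, L (sc k d)) \<le> K * norm (sc e w, w, sc k w)"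
        using low[OF lam, of "sc e d" d "sc k d"] by simp
      moreover have "norm (L d) \<le> norm (L (sc e d), L d, L (sc k d))"
        by (meson norm_fst_le norm_snd_le order_trans)
      moreover have "norm (sc e w, w, sc k w) \<le> 3 * norm w"
      proof -
        have "norm (sc e w, w, sc k w) \<le> norm (sc e w) + (norm w + norm (sc k w))"
          by (intro order_trans[OF norm_Pair_le] add_mono norm_Pair_le order_refl)
        also have "\<dots> \<le> 3 * norm w" using mult_right_mono[OF e1, of "norm w"] k1[OF k] by (simp add: norm_sc)
        finally show ?thesis .
      qed
      then have "K * norm (sc e w, w, sc k w) \<le> K * (3 * norm w)" using K by (rule mult_left_mono)
      ultimately show ?thesis unfolding w_def by linarith
    qed
  qed
  then show False using assms(4) by simp
qed

end
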